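(* Let $\mathbf k$ be a field, $G$ a finite group, $\alpha$ a normalised 3-cocycle on $G$ with values in $\mathbf k^\times$ (trivial action), and $\mathcal G$ the corresponding skeletal categorical group. Then representations of the inertia groupoid $\Pi_1\Lambda\mathcal G$ are modules over the twisted Drinfeld double $D^\alpha(G)$; that is, the category of representations of $\Pi_1\Lambda\mathcal G$ is equivalent to the category of $D^\alpha(G)$-modules.
   Context: The skeletal 2-group $\mathcal G$ classified by $\alpha$ has object set $G$ with tensor product the group law, strict units, $\mathrm{Aut}(g)=\mathbf k^\times$ for every $g$, no morphisms between distinct objects, and associator $(g\bullet h)\bullet k\to g\bullet(h\bullet k)$ equal to $\alpha(g,h,k)$. $\Lambda\mathcal G=\mathrm{Bicat}(\bullet/\!\!/\mathbb Z,\bullet/\!\!/\mathcal G)$ is the 2-groupoid of bifunctors, pseudonatural transformations and modifications between the one-object bicategories associated with the discrete 2-group $\mathbb Z$ and with $\mathcal G$. Explicitly: objects are pairs $(g,\gamma)$ with $g\in G$ and $\gamma:\mathbb Z\times\mathbb Z\to\mathbf k^\times$ satisfying $\frac{\gamma(l+m,n)\gamma(l,m)}{\gamma(l,m+n)\gamma(m,n)}=\alpha(g^l,g^m,g^n)$. A 1-morphism $(g,\gamma)\to(f,\phi)$ is a pair $(s,\eta)$ with $s\in G$, $sgs^{-1}=f$, and $\eta:\mathbb Z\to\mathbf k^\times$ satisfying $\frac{\eta(n)\eta(m)}{\eta(m+n)}=\frac{\gamma(m,n)}{\phi(m,n)}\cdot\frac{\alpha(f^m,f^n,s)\,\alpha(s,g^m,g^n)}{\alpha(f^m,s,g^n)}$.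 The composite of $(s,\eta):(g,\gamma)\to(f,\phi)$ with $(t,\zeta):(f,\phi)\to(k,\kappa)$ is $(ts,\xi)$ with $\xi(n)=\eta(n)\zeta(n)\frac{\alpha(t,s,g^n)\alpha(k^n,t,s)}{\alpha(t,f^n,s)}$. All 2-morphisms are 2-automorphisms, and $\Pi_1\Lambda\mathcal G$ is the groupoid obtained by forgetting 2-morphisms. The group $\mathbf k^\times$ acts on the arrows by $a\cdot(s,\eta)=(s,\,n\mapsto a^n\eta(n))$, exhibiting $\Pi_1\Lambda\mathcal G$, up to equivalence, as a central extension by $\mathbf k^\times$ of the groupoid $\Lambda G$ with objects $g\in G$ and arrows $s:g\to sgs^{-1}$. A representation of $\Pi_1\Lambda\mathcal G$ is a functor $F$ from $\Pi_1\Lambda\mathcal G$ to $\mathbf k$-vector spaces in which the central $\mathbf k^\times$ acts by scalars: $F(a\cdot(s,\eta))=a\,F(s,\eta)$. Morphisms are natural transformations. The twisted Drinfeld double $D^\alpha(G)$ is the $\mathbf k$-algebra with basis $\{\delta_g x : g,x\in G\}$ and product $(\delta_g x)(\delta_h y)=\theta_g(x,y)\,\delta_g(xy)$ if $g=xhx^{-1}$ and $0$ otherwise, where $\theta_g(x,y)=\dfrac{\alpha(g,x,y)\,\alpha(x,y,(xy)^{-1}gxy)}{\alpha(x,x^{-1}gx,y)}$; the unit is $\sum_g\delta_g 1$. Modules are left modules. *)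

theory Defs
  imports "HOL-Algebra.Module" "HOL-Library.FuncSet"
begin

section \<open>Categories\<close>

text \<open>Composition carries the three objects involved:
  \<open>Comp C X Y Z g f\<close> is \<open>g \<circ> f\<close> for \<open>f : X \<rightarrow> Y\<close> and \<open>g : Y \<rightarrow> Z\<close>.
  The same element may therefore occur in several hom-sets.\<close>

record ('o, 'a) cat =
  Ob :: "'o set"
  Hom :: "'o \<Rightarrow> 'o \<Rightarrow> 'a set"
  Id :: "'o \<Rightarrow> 'a"
  Comp :: "'o \<Rightarrow> 'o \<Rightarrow> 'o \<Rightarrow> 'a \<Rightarrow> 'a \<Rightarrow> 'a"

locale category =
  fixes C :: "('o, 'a) cat"
  assumes Id_in: "X \<in> Ob C \<Longrightarrow> Id C X \<in> Hom C X X"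
    and Comp_in: "\<lbrakk>X \<in> Ob C; Y \<in> Ob C; Z \<in> Ob C; f \<in> Hom C X Y; g \<in> Hom C Y Z\<rbrakk>
      \<Longrightarrow> Comp C X Y Z g f \<in> Hom C X Z"
    and Comp_Id_right: "\<lbrakk>X \<in> Ob C; Y \<in> Ob C; f \<in> Hom C X Y\<rbrakk>
      \<Longrightarrow> Comp C X X Y f (Id C X) = f"
    and Comp_Id_left: "\<lbrakk>X \<in> Ob C; Y \<in> Ob C; f \<in> Hom C X Y\<rbrakk>
      \<Longrightarrow> Comp C X Y Y (Id C Y) f = f"
    and Comp_assoc: "\<lbrakk>W \<in> Ob C; X \<in> Ob C; Y \<in> Ob C; Z \<in> Ob C;
        f \<in> Hom C W X; g \<in> Hom C X Y; h \<in> Hom C Y Z\<rbrakk>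
      \<Longrightarrow> Comp C W Y Z h (Comp C W X Y g f) = Comp C W X Z (Comp C X Y Z h g) f"

record ('o, 'a, 'p, 'b) func =
  FOb :: "'o \<Rightarrow> 'p"
  FAr :: "'o \<Rightarrow> 'o \<Rightarrow> 'a \<Rightarrow> 'b"

locale is_functor = C: category C + D: category D
  for C :: "('o, 'a) cat" and D :: "('p, 'b) cat" +
  fixes F :: "('o, 'a, 'p, 'b) func"
  assumes FOb_in: "X \<in> Ob C \<Longrightarrow> FOb F X \<in> Ob D"
    and FAr_in: "\<lbrakk>X \<in> Ob C; Y \<in> Ob C; f \<in> Hom C X Y\<rbrakk>
      \<Longrightarrow> FAr F X Y f \<in> Hom D (FOb F X) (FOb F Y)"
    and FAr_Id: "X \<in> Ob C \<Longrightarrow> FAr F X X (Id C X) = Id D (FOb F X)"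
    and FAr_Comp: "\<lbrakk>X \<in> Ob C; Y \<in> Ob C; Z \<in> Ob C; f \<in> Hom C X Y; g \<in> Hom C Y Z\<rbrakk>
      \<Longrightarrow> FAr F X Z (Comp C X Y Z g f) =
          Comp D (FOb F X) (FOb F Y) (FOb F Z) (FAr F Y Z g) (FAr F X Y f)"

definition id_func :: "('o, 'a, 'o, 'a) func" where
  "id_func = \<lparr>FOb = (\<lambda>X. X), FAr = (\<lambda>X Y f. f)\<rparr>"

definition comp_func ::
    "('p, 'b, 'q, 'c) func \<Rightarrow> ('o, 'a, 'p, 'b) func \<Rightarrow> ('o, 'a, 'q, 'c) func" where
  "comp_func F' F = \<lparr>FOb = (\<lambda>X. FOb F' (FOb F X)),
     FAr = (\<lambda>X Y f. FAr F' (FOb F X) (FOb F Y) (FAr F X Y f))\<rparr>"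

text \<open>Natural transformations are extensional, i.e. \<open>undefined\<close> off the objects of the source,
  so that two of them are equal exactly when their components are.\<close>

definition nat_trans ::
    "('o, 'a) cat \<Rightarrow> ('p, 'b) cat \<Rightarrow> ('o, 'a, 'p, 'b) func \<Rightarrow> ('o, 'a, 'p, 'b) func \<Rightarrow> ('o \<Rightarrow> 'b) set"
  where
  "nat_trans C D F F' = {\<tau> \<in> (\<Pi>\<^sub>E X \<in> Ob C. Hom D (FOb F X) (FOb F' X)).
     \<forall>X \<in> Ob C. \<forall>Y \<in> Ob C. \<forall>f \<in> Hom C X Y.
       Comp D (FOb F X) (FOb F Y) (FOb F' Y) (\<tau> Y) (FAr F X Y f) =
       Comp D (FOb F X) (FOb F' X) (FOb F' Y) (FAr F' X Y f) (\<tau> X)}"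

definition isos :: "('o, 'a) cat \<Rightarrow> 'o \<Rightarrow> 'o \<Rightarrow> 'a set" where
  "isos C X Y = {f \<in> Hom C X Y. \<exists>g \<in> Hom C Y X.
     Comp C X Y X g f = Id C X \<and> Comp C Y X Y f g = Id C Y}"

definition naturally_isomorphic ::
    "('o, 'a) cat \<Rightarrow> ('p, 'b) cat \<Rightarrow> ('o, 'a, 'p, 'b) func \<Rightarrow> ('o, 'a, 'p, 'b) func \<Rightarrow> bool" where
  "naturally_isomorphic C D F F' \<longleftrightarrow>
     (\<exists>\<tau> \<in> nat_trans C D F F'. \<forall>X \<in> Ob C. \<tau> X \<in> isos D (FOb F X) (FOb F' X))"

definition equivalent_categories :: "('o, 'a) cat \<Rightarrow> ('p, 'b) cat \<Rightarrow> bool" where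
  "equivalent_categories C D \<longleftrightarrow>
     category C \<and> category D \<and>
     (\<exists>F F'. is_functor C D F \<and> is_functor D C F' \<and>
        naturally_isomorphic C C id_func (comp_func F' F) \<and>
        naturally_isomorphic D D (comp_func F F') id_func)"

definition functor_category ::
    "('o, 'a) cat \<Rightarrow> ('p, 'b) cat \<Rightarrow> (('o, 'a, 'p, 'b) func, 'o \<Rightarrow> 'b) cat" where
  "functor_category C D = \<lparr>
     Ob = {F. is_functor C D F},
     Hom = nat_trans C D,
     Id = (\<lambda>F. \<lambda>X \<in> Ob C. Id D (FOb F X)),
     Comp = (\<lambda>F F' F'' \<sigma> \<tau>. \<lambda>X \<in> Ob C. Comp D (FOb F X) (FOb F' X) (FOb F'' X) (\<sigma> X) (\<tau> X))\<rparr>"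

definition full_subcategory :: "('o, 'a) cat \<Rightarrow> ('o \<Rightarrow> bool) \<Rightarrow> ('o, 'a) cat" where
  "full_subcategory C P = C\<lparr>Ob := {X \<in> Ob C. P X}\<rparr>"


section \<open>Modules\<close>

text \<open>The locale \<open>module\<close> of HOL-Algebra insists on a commutative ring of scalars.\<close>

locale left_module = R?: ring R + M?: abelian_group M for R (structure) and M (structure) +
  assumes smult_closed:
      "\<lbrakk>a \<in> carrier R; x \<in> carrier M\<rbrakk> \<Longrightarrow> a \<odot>\<^bsub>M\<^esub> x \<in> carrier M"
    and smult_l_distr:
      "\<lbrakk>a \<in> carrier R; b \<in> carrier R; x \<in> carrier M\<rbrakk> \<Longrightarrow>
        (a \<oplus> b) \<odot>\<^bsub>M\<^esub> x = a \<odot>\<^bsub>M\<^esub> x \<oplus>\<^bsub>M\<^esub> b \<odot>\<^bsub>M\<^esub> x"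
    and smult_r_distr:
      "\<lbrakk>a \<in> carrier R; x \<in> carrier M; y \<in> carrier M\<rbrakk> \<Longrightarrow>
        a \<odot>\<^bsub>M\<^esub> (x \<oplus>\<^bsub>M\<^esub> y) = a \<odot>\<^bsub>M\<^esub> x \<oplus>\<^bsub>M\<^esub> a \<odot>\<^bsub>M\<^esub> y"
    and smult_assoc1:
      "\<lbrakk>a \<in> carrier R; b \<in> carrier R; x \<in> carrier M\<rbrakk> \<Longrightarrow>
        (a \<otimes> b) \<odot>\<^bsub>M\<^esub> x = a \<odot>\<^bsub>M\<^esub> (b \<odot>\<^bsub>M\<^esub> x)"
    and smult_one: "x \<in> carrier M \<Longrightarrow> \<one> \<odot>\<^bsub>M\<^esub> x = x"

lemma left_module_iff_module:
  assumes "cring R"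
  shows "left_module R M \<longleftrightarrow> module R M"
  using assms
  by (auto simp: left_module_def left_module_axioms_def module_def module_axioms_def cring_def)

text \<open>The linear maps are extensional, so that equality of morphisms is equality on the carrier.\<close>

definition linear_maps ::
    "('r, 'x) ring_scheme \<Rightarrow> ('r, 'v) module \<Rightarrow> ('r, 'w) module \<Rightarrow> ('v \<Rightarrow> 'w) set" where
  "linear_maps R M N = {f \<in> carrier M \<rightarrow>\<^sub>E carrier N.
     (\<forall>x \<in> carrier M. \<forall>y \<in> carrier M. f (x \<oplus>\<^bsub>M\<^esub> y) = f x \<oplus>\<^bsub>N\<^esub> f y) \<and>
     (\<forall>a \<in> carrier R. \<forall>x \<in> carrier M. f (a \<odot>\<^bsub>M\<^esub> x) = a \<odot>\<^bsub>N\<^esub> f x)}"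

text \<open>The category of left \<open>R\<close>-modules whose elements are drawn from the type \<open>'v\<close>,
  which plays the role of a universe; if \<open>'v\<close> is infinite, it has room for finite direct sums
  of such modules. If \<open>R\<close> is a field, this is the category of
  \<open>R\<close>-vector spaces.\<close>

definition module_category ::
    "('r, 'x) ring_scheme \<Rightarrow> (('r, 'v) module, 'v \<Rightarrow> 'v) cat" where
  "module_category R = \<lparr>
     Ob = {M. left_module R M},
     Hom = linear_maps R,
     Id = (\<lambda>M. \<lambda>x \<in> carrier M. x),
     Comp = (\<lambda>L M N g f. compose (carrier L) g f)\<rparr>"


section \<open>Normalised 3-cocycles\<close>

text \<open>The cocycle identity is the pentagon axiom for an associator
  \<open>(g \<bullet> h) \<bullet> k \<rightarrow> g \<bullet> (h \<bullet> k)\<close> equal to \<open>\<alpha> g h k\<close>; normalisation makes the units strict.\<close>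

definition normalised_3cocycle ::
    "('g, 'x) monoid_scheme \<Rightarrow> ('k, 'y) ring_scheme \<Rightarrow> ('g \<Rightarrow> 'g \<Rightarrow> 'g \<Rightarrow> 'k) \<Rightarrow> bool" where
  "normalised_3cocycle G K \<alpha> \<longleftrightarrow>
     (\<forall>g \<in> carrier G. \<forall>h \<in> carrier G. \<forall>k \<in> carrier G. \<alpha> g h k \<in> Units K) \<and>
     (\<forall>g \<in> carrier G. \<forall>h \<in> carrier G. \<forall>k \<in> carrier G. \<forall>l \<in> carrier G.
        \<alpha> h k l \<otimes>\<^bsub>K\<^esub> \<alpha> g (h \<otimes>\<^bsub>G\<^esub> k) l \<otimes>\<^bsub>K\<^esub> \<alpha> g h k =
        \<alpha> (g \<otimes>\<^bsub>G\<^esub> h) k l \<otimes>\<^bsub>K\<^esub> \<alpha> g h (k \<otimes>\<^bsub>G\<^esub> l)) \<and>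
     (\<forall>g \<in> carrier G. \<forall>h \<in> carrier G.
        \<alpha> \<one>\<^bsub>G\<^esub> g h = \<one>\<^bsub>K\<^esub> \<and> \<alpha> g \<one>\<^bsub>G\<^esub> h = \<one>\<^bsub>K\<^esub> \<and> \<alpha> g h \<one>\<^bsub>G\<^esub> = \<one>\<^bsub>K\<^esub>)"

abbreviation quotient :: "('k, 'y) ring_scheme \<Rightarrow> 'k \<Rightarrow> 'k \<Rightarrow> 'k" where
  "quotient K a b \<equiv> a \<otimes>\<^bsub>K\<^esub> inv\<^bsub>K\<^esub> b"


section \<open>The inertia groupoid of the skeletal 2-group classified by \<open>\<alpha>\<close>\<close>

text \<open>Unwound, a bifunctor from \<open>\<bullet>//\<int>\<close> to \<open>\<bullet>//\<G>\<close> is a pair \<open>(g, \<gamma>)\<close> and a pseudonatural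
  transformation is a pair \<open>(s, \<eta>)\<close>, as follows. Since every 2-morphism is a
  2-automorphism, distinct 1-morphisms stay distinct when the 2-morphisms are forgotten.\<close>

type_synonym ('g, 'k) inertia_ob = "'g \<times> (int \<Rightarrow> int \<Rightarrow> 'k)"
type_synonym ('g, 'k) inertia_ar = "'g \<times> (int \<Rightarrow> 'k)"

definition inertia_obs ::
    "('g, 'x) monoid_scheme \<Rightarrow> ('k, 'y) ring_scheme \<Rightarrow> ('g \<Rightarrow> 'g \<Rightarrow> 'g \<Rightarrow> 'k) \<Rightarrow>
     ('g, 'k) inertia_ob set" where
  "inertia_obs G K \<alpha> = {(g, \<gamma>). g \<in> carrier G \<and> (\<forall>m n. \<gamma> m n \<in> Units K) \<and>
     (\<forall>l m n. quotient K (\<gamma> (l + m) n \<otimes>\<^bsub>K\<^esub> \<gamma> l m) (\<gamma> l (m + n) \<otimes>\<^bsub>K\<^esub> \<gamma> m n) =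
        \<alpha> (g [^]\<^bsub>G\<^esub> l) (g [^]\<^bsub>G\<^esub> m) (g [^]\<^bsub>G\<^esub> n))}"

definition inertia_ars ::
    "('g, 'x) monoid_scheme \<Rightarrow> ('k, 'y) ring_scheme \<Rightarrow> ('g \<Rightarrow> 'g \<Rightarrow> 'g \<Rightarrow> 'k) \<Rightarrow>
     ('g, 'k) inertia_ob \<Rightarrow> ('g, 'k) inertia_ob \<Rightarrow> ('g, 'k) inertia_ar set" where
  "inertia_ars G K \<alpha> = (\<lambda>(g, \<gamma>) (f, \<phi>). {(s, \<eta>).
     s \<in> carrier G \<and> s \<otimes>\<^bsub>G\<^esub> g \<otimes>\<^bsub>G\<^esub> inv\<^bsub>G\<^esub> s = f \<and> (\<forall>n. \<eta> n \<in> Units K) \<and>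
     (\<forall>m n. quotient K (\<eta> n \<otimes>\<^bsub>K\<^esub> \<eta> m) (\<eta> (m + n)) =
        quotient K (\<gamma> m n) (\<phi> m n) \<otimes>\<^bsub>K\<^esub>
        quotient K (\<alpha> (f [^]\<^bsub>G\<^esub> m) (f [^]\<^bsub>G\<^esub> n) s \<otimes>\<^bsub>K\<^esub> \<alpha> s (g [^]\<^bsub>G\<^esub> m) (g [^]\<^bsub>G\<^esub> n))
          (\<alpha> (f [^]\<^bsub>G\<^esub> m) s (g [^]\<^bsub>G\<^esub> n)))})"

definition inertia_comp ::
    "('g, 'x) monoid_scheme \<Rightarrow> ('k, 'y) ring_scheme \<Rightarrow> ('g \<Rightarrow> 'g \<Rightarrow> 'g \<Rightarrow> 'k) \<Rightarrow>
     ('g, 'k) inertia_ob \<Rightarrow> ('g, 'k) inertia_ob \<Rightarrow> ('g, 'k) inertia_ob \<Rightarrow>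
     ('g, 'k) inertia_ar \<Rightarrow> ('g, 'k) inertia_ar \<Rightarrow> ('g, 'k) inertia_ar" where
  "inertia_comp G K \<alpha> = (\<lambda>(g, \<gamma>) (f, \<phi>) (k, \<kappa>) (t, \<zeta>) (s, \<eta>). (t \<otimes>\<^bsub>G\<^esub> s,
     \<lambda>n. \<eta> n \<otimes>\<^bsub>K\<^esub> \<zeta> n \<otimes>\<^bsub>K\<^esub>
       quotient K (\<alpha> t s (g [^]\<^bsub>G\<^esub> n) \<otimes>\<^bsub>K\<^esub> \<alpha> (k [^]\<^bsub>G\<^esub> n) t s) (\<alpha> t (f [^]\<^bsub>G\<^esub> n) s)))"

definition inertia_groupoid ::
    "('g, 'x) monoid_scheme \<Rightarrow> ('k, 'y) ring_scheme \<Rightarrow> ('g \<Rightarrow> 'g \<Rightarrow> 'g \<Rightarrow> 'k) \<Rightarrow>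
     (('g, 'k) inertia_ob, ('g, 'k) inertia_ar) cat" where
  "inertia_groupoid G K \<alpha> = \<lparr>
     Ob = inertia_obs G K \<alpha>,
     Hom = inertia_ars G K \<alpha>,
     Id = (\<lambda>_. (\<one>\<^bsub>G\<^esub>, \<lambda>_. \<one>\<^bsub>K\<^esub>)),
     Comp = inertia_comp G K \<alpha>\<rparr>"

definition central_action ::
    "('k, 'y) ring_scheme \<Rightarrow> 'k \<Rightarrow> ('g, 'k) inertia_ar \<Rightarrow> ('g, 'k) inertia_ar" where
  "central_action K a = (\<lambda>(s, \<eta>). (s, \<lambda>n. (a [^]\<^bsub>K\<^esub> n) \<otimes>\<^bsub>K\<^esub> \<eta> n))"

definition centre_acts_by_scalars ::
    "('g, 'x) monoid_scheme \<Rightarrow> ('k, 'y) ring_scheme \<Rightarrow> ('g \<Rightarrow> 'g \<Rightarrow> 'g \<Rightarrow> 'k) \<Rightarrow>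
     (('g, 'k) inertia_ob, ('g, 'k) inertia_ar, ('k, 'v) module, 'v \<Rightarrow> 'v) func \<Rightarrow> bool" where
  "centre_acts_by_scalars G K \<alpha> F \<longleftrightarrow>
     (\<forall>X \<in> inertia_obs G K \<alpha>. \<forall>Y \<in> inertia_obs G K \<alpha>. \<forall>u \<in> inertia_ars G K \<alpha> X Y.
      \<forall>a \<in> Units K. \<forall>v \<in> carrier (FOb F X).
        FAr F X Y (central_action K a u) v = a \<odot>\<^bsub>FOb F Y\<^esub> FAr F X Y u v)"

definition inertia_representations ::
    "('g, 'x) monoid_scheme \<Rightarrow> ('k, 'y) ring_scheme \<Rightarrow> ('g \<Rightarrow> 'g \<Rightarrow> 'g \<Rightarrow> 'k) \<Rightarrow>
     ((('g, 'k) inertia_ob, ('g, 'k) inertia_ar, ('k, 'v) module, 'v \<Rightarrow> 'v) func,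
      ('g, 'k) inertia_ob \<Rightarrow> 'v \<Rightarrow> 'v) cat" where
  "inertia_representations G K \<alpha> =
     full_subcategory (functor_category (inertia_groupoid G K \<alpha>) (module_category K))
       (centre_acts_by_scalars G K \<alpha>)"


section \<open>The twisted Drinfeld double\<close>

definition double_theta ::
    "('g, 'x) monoid_scheme \<Rightarrow> ('k, 'y) ring_scheme \<Rightarrow> ('g \<Rightarrow> 'g \<Rightarrow> 'g \<Rightarrow> 'k) \<Rightarrow>
     'g \<Rightarrow> 'g \<Rightarrow> 'g \<Rightarrow> 'k" where
  "double_theta G K \<alpha> g x y =
     quotient K
       (\<alpha> g x y \<otimes>\<^bsub>K\<^esub>
        \<alpha> x y (inv\<^bsub>G\<^esub> (x \<otimes>\<^bsub>G\<^esub> y) \<otimes>\<^bsub>G\<^esub> g \<otimes>\<^bsub>G\<^esub> (x \<otimes>\<^bsub>G\<^esub> y)))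
       (\<alpha> x (inv\<^bsub>G\<^esub> x \<otimes>\<^bsub>G\<^esub> g \<otimes>\<^bsub>G\<^esub> x) y)"

text \<open>An element of the double is its coordinate family in the basis \<open>\<delta>\<^sub>g x\<close>, indexed by the pairs
  \<open>(g, x)\<close>. The value \<open>double_basis_mult G K \<alpha> (g, x) (h, y) p\<close> is the coordinate at \<open>p\<close> of the
  product \<open>(\<delta>\<^sub>g x) (\<delta>\<^sub>h y)\<close>, and the multiplication is its bilinear extension.\<close>

definition double_basis_mult ::
    "('g, 'x) monoid_scheme \<Rightarrow> ('k, 'y) ring_scheme \<Rightarrow> ('g \<Rightarrow> 'g \<Rightarrow> 'g \<Rightarrow> 'k) \<Rightarrow>
     'g \<times> 'g \<Rightarrow> 'g \<times> 'g \<Rightarrow> 'g \<times> 'g \<Rightarrow> 'k" where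
  "double_basis_mult G K \<alpha> = (\<lambda>(g, x) (h, y) p.
     if g = x \<otimes>\<^bsub>G\<^esub> h \<otimes>\<^bsub>G\<^esub> inv\<^bsub>G\<^esub> x \<and> p = (g, x \<otimes>\<^bsub>G\<^esub> y)
     then double_theta G K \<alpha> g x y else \<zero>\<^bsub>K\<^esub>)"

definition twisted_double ::
    "('g, 'x) monoid_scheme \<Rightarrow> ('k, 'y) ring_scheme \<Rightarrow> ('g \<Rightarrow> 'g \<Rightarrow> 'g \<Rightarrow> 'k) \<Rightarrow>
     ('k, 'g \<times> 'g \<Rightarrow> 'k) module" where
  "twisted_double G K \<alpha> = (let B = carrier G \<times> carrier G in \<lparr>
     carrier = B \<rightarrow>\<^sub>E carrier K,
     mult = (\<lambda>a b. \<lambda>p \<in> B. \<Oplus>\<^bsub>K\<^esub>q \<in> B. \<Oplus>\<^bsub>K\<^esub>r \<in> B.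
       a q \<otimes>\<^bsub>K\<^esub> b r \<otimes>\<^bsub>K\<^esub> double_basis_mult G K \<alpha> q r p),
     one = (\<lambda>(g, x) \<in> B. if x = \<one>\<^bsub>G\<^esub> then \<one>\<^bsub>K\<^esub> else \<zero>\<^bsub>K\<^esub>),
     zero = (\<lambda>p \<in> B. \<zero>\<^bsub>K\<^esub>),
     add = (\<lambda>a b. \<lambda>p \<in> B. a p \<oplus>\<^bsub>K\<^esub> b p),
     smult = (\<lambda>c a. \<lambda>p \<in> B. c \<otimes>\<^bsub>K\<^esub> a p)\<rparr>)"

end

theory Submission
  imports Defs
begin

text \<open>Evaluating the cochain of an arrow \<open>(s, \<eta>) : (g, \<gamma>) \<rightarrow> (f, \<phi>)\<close> at \<open>1\<close> turns the composition of
  arrows into the product of the double: the factor \<open>\<alpha>(t,s,g) \<alpha>(k,t,s) / \<alpha>(t,f,s)\<close> is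
  \<open>\<theta>\<^sub>k(t, s)\<close>. Hence a module \<open>M\<close> gives the representation \<open>(g, \<gamma>) \<mapsto> \<delta>\<^sub>g M\<close> on which \<open>(s, \<eta>)\<close> acts by
  \<open>\<eta>(1) \<delta>\<^sub>f s\<close>. Since \<open>H\<^sup>2(\<int>)\<close> and \<open>H\<^sup>3(\<int>)\<close> with coefficients in \<open>k\<^sup>\<times>\<close> vanish, every \<open>g\<close> underlies an
  object, and an arrow over \<open>s\<close> exists and is unique for each prescribed value \<open>\<eta>(1)\<close>. This makes
  the functor fully faithful, and a representation is recovered from the module of tuples
  \<open>\<Oplus>\<^sub>g F(g, \<gamma>\<^sub>g)\<close>.\<close>

section \<open>Functor categories and module categories\<close>

text \<open>A representation lives on all pairs (g, \<gamma>), while a module sees only g. The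
  bridge is that any two objects over the same g are joined by exactly one arrow over the unit with
  value 1 at 1. As \<theta> is 1 as soon as one of its last two arguments is the unit, composing
  with such an arrow changes neither the group element of an arrow nor its value at 1. So these
  arrows identify the values of a representation at all objects over g, and a natural transformation
  is determined by its components at one chosen object over each g. The function \<theta> is the
  transgression of \<alpha> to the loop groupoid of G. Its cocycle identity is what makes both the
  composition of arrows and the product of the double associative. Arrows carry units of
  \<open>K\<close>, elements of the double arbitrary coefficients. The gap is closed by always
  splitting off the coefficient: an arrow with value a at 1 acts as a times the one with value 1, by
  the condition on the centre, and a coefficient in the double acts on a fibre as a scalar, with
  which every component of a natural transformation commutes.\<close>

lemma category_full_subcategory: "category C \<Longrightarrow> category (full_subcategory C P)"
  unfolding category_def full_subcategory_def by auto

lemma category_functor_category: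
  assumes "category C" and "category D"
  shows "category (functor_category C D)"
proof -
  interpret C: category C by fact
  interpret D: category D by fact
  have fn: "FOb F X \<in> Ob D" if "is_functor C D F" "X \<in> Ob C" for F X
    using that by (rule is_functor.FOb_in)
  have fa: "FAr F X Y f \<in> Hom D (FOb F X) (FOb F Y)"
    if "is_functor C D F" "X \<in> Ob C" "Y \<in> Ob C" "f \<in> Hom C X Y" for F X Y f
    using that by (rule is_functor.FAr_in)
  show ?thesis
  proof
    fix F assume "F \<in> Ob (functor_category C D)"
    then have F: "is_functor C D F" by (simp add: functor_category_def)
    show "Id (functor_category C D) F \<in> Hom (functor_category C D) F F"
      by (simp add: functor_category_def nat_trans_def fn[OF F] fa[OF F] D.Id_in D.Comp_Id_left D.Comp_Id_right)
  next
    fix F F' F'' \<tau> \<sigma>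
    assume "F \<in> Ob (functor_category C D)" "F' \<in> Ob (functor_category C D)"
      "F'' \<in> Ob (functor_category C D)"
      and "\<tau> \<in> Hom (functor_category C D) F F'" "\<sigma> \<in> Hom (functor_category C D) F' F''"
    then have F: "is_functor C D F" "is_functor C D F'" "is_functor C D F''"
      and t: "\<tau> \<in> nat_trans C D F F'" "\<sigma> \<in> nat_trans C D F' F''"
      by (simp_all add: functor_category_def)
    have tX: "\<tau> X \<in> Hom D (FOb F X) (FOb F' X)" "\<sigma> X \<in> Hom D (FOb F' X) (FOb F'' X)"
      if "X \<in> Ob C" for X
      using t that by (auto simp: nat_trans_def)
    have nt: "Comp D (FOb F X) (FOb F Y) (FOb F' Y) (\<tau> Y) (FAr F X Y f) =
        Comp D (FOb F X) (FOb F' X) (FOb F' Y) (FAr F' X Y f) (\<tau> X)"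
      "Comp D (FOb F' X) (FOb F' Y) (FOb F'' Y) (\<sigma> Y) (FAr F' X Y f) =
        Comp D (FOb F' X) (FOb F'' X) (FOb F'' Y) (FAr F'' X Y f) (\<sigma> X)"
      if "X \<in> Ob C" "Y \<in> Ob C" "f \<in> Hom C X Y" for X Y f
      using t that by (auto simp: nat_trans_def)
    have "Comp D (FOb F X) (FOb F Y) (FOb F'' Y)
          (Comp D (FOb F Y) (FOb F' Y) (FOb F'' Y) (\<sigma> Y) (\<tau> Y)) (FAr F X Y f) =
        Comp D (FOb F X) (FOb F'' X) (FOb F'' Y) (FAr F'' X Y f)
          (Comp D (FOb F X) (FOb F' X) (FOb F'' X) (\<sigma> X) (\<tau> X))"
      if X: "X \<in> Ob C" "Y \<in> Ob C" "f \<in> Hom C X Y" for X Y f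
    proof -
      note m = fn[OF F(1)] fn[OF F(2)] fn[OF F(3)] fa[OF F(1)] fa[OF F(2)] fa[OF F(3)] tX X
      have "Comp D (FOb F X) (FOb F Y) (FOb F'' Y)
          (Comp D (FOb F Y) (FOb F' Y) (FOb F'' Y) (\<sigma> Y) (\<tau> Y)) (FAr F X Y f) =
        Comp D (FOb F X) (FOb F' Y) (FOb F'' Y) (\<sigma> Y)
          (Comp D (FOb F X) (FOb F Y) (FOb F' Y) (\<tau> Y) (FAr F X Y f))"
        by (rule D.Comp_assoc[symmetric]) (simp_all add: m)
      also have "\<dots> = Comp D (FOb F X) (FOb F' X) (FOb F'' Y)
          (Comp D (FOb F' X) (FOb F' Y) (FOb F'' Y) (\<sigma> Y) (FAr F' X Y f)) (\<tau> X)"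
        unfolding nt(1)[OF X] by (rule D.Comp_assoc) (simp_all add: m)
      also have "\<dots> = Comp D (FOb F X) (FOb F'' X) (FOb F'' Y) (FAr F'' X Y f)
          (Comp D (FOb F X) (FOb F' X) (FOb F'' X) (\<sigma> X) (\<tau> X))"
        unfolding nt(2)[OF X] by (rule D.Comp_assoc[symmetric]) (simp_all add: m)
      finally show ?thesis .
    qed
    then show "Comp (functor_category C D) F F' F'' \<sigma> \<tau> \<in> Hom (functor_category C D) F F''"
      using D.Comp_in[OF fn[OF F(1)] fn[OF F(2)] fn[OF F(3)] tX]
      by (simp add: functor_category_def nat_trans_def)
  next
    fix F F' \<tau>
    assume "F \<in> Ob (functor_category C D)" "F' \<in> Ob (functor_category C D)"
      and "\<tau> \<in> Hom (functor_category C D) F F'"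
    then have F: "is_functor C D F" "is_functor C D F'"
      and t: "\<tau> \<in> (\<Pi>\<^sub>E X \<in> Ob C. Hom D (FOb F X) (FOb F' X))"
      by (simp_all add: functor_category_def nat_trans_def)
    show "Comp (functor_category C D) F F F' \<tau> (Id (functor_category C D) F) = \<tau>"
      "Comp (functor_category C D) F F' F' (Id (functor_category C D) F') \<tau> = \<tau>"
      using t by (auto simp: functor_category_def fn[OF F(1)] fn[OF F(2)] PiE_mem[OF t] D.Comp_Id_left
            D.Comp_Id_right PiE_arb[OF t] fun_eq_iff restrict_def)
  next
    fix F1 F2 F3 F4 \<tau> \<sigma> \<rho>
    assume "F1 \<in> Ob (functor_category C D)" "F2 \<in> Ob (functor_category C D)"
      "F3 \<in> Ob (functor_category C D)" "F4 \<in> Ob (functor_category C D)"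
      and "\<tau> \<in> Hom (functor_category C D) F1 F2" "\<sigma> \<in> Hom (functor_category C D) F2 F3"
      "\<rho> \<in> Hom (functor_category C D) F3 F4"
    then have F: "is_functor C D F1" "is_functor C D F2" "is_functor C D F3" "is_functor C D F4"
      and t: "\<And>X. X \<in> Ob C \<Longrightarrow> \<tau> X \<in> Hom D (FOb F1 X) (FOb F2 X)"
        "\<And>X. X \<in> Ob C \<Longrightarrow> \<sigma> X \<in> Hom D (FOb F2 X) (FOb F3 X)"
        "\<And>X. X \<in> Ob C \<Longrightarrow> \<rho> X \<in> Hom D (FOb F3 X) (FOb F4 X)"
      by (auto simp: functor_category_def nat_trans_def)
    have "Comp D (FOb F1 X) (FOb F3 X) (FOb F4 X) (\<rho> X) (Comp D (FOb F1 X) (FOb F2 X) (FOb F3 X) (\<sigma> X) (\<tau> X)) =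
      Comp D (FOb F1 X) (FOb F2 X) (FOb F4 X) (Comp D (FOb F2 X) (FOb F3 X) (FOb F4 X) (\<rho> X) (\<sigma> X)) (\<tau> X)"
      if X: "X \<in> Ob C" for X
      using D.Comp_assoc[OF fn[OF F(1) X] fn[OF F(2) X] fn[OF F(3) X] fn[OF F(4) X] t(1)[OF X] t(2)[OF X] t(3)[OF X]] .
    then show "Comp (functor_category C D) F1 F3 F4 \<rho> (Comp (functor_category C D) F1 F2 F3 \<sigma> \<tau>) =
      Comp (functor_category C D) F1 F2 F4 (Comp (functor_category C D) F2 F3 F4 \<rho> \<sigma>) \<tau>"
      by (simp add: functor_category_def fun_eq_iff restrict_def)
  qed
qed

lemma linear_mapsD:
  assumes "f \<in> linear_maps R M N"
  shows "x \<in> carrier M \<Longrightarrow> f x \<in> carrier N"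
    and "x \<in> carrier M \<Longrightarrow> y \<in> carrier M \<Longrightarrow> f (x \<oplus>\<^bsub>M\<^esub> y) = f x \<oplus>\<^bsub>N\<^esub> f y"
    and "a \<in> carrier R \<Longrightarrow> x \<in> carrier M \<Longrightarrow> f (a \<odot>\<^bsub>M\<^esub> x) = a \<odot>\<^bsub>N\<^esub> f x"
    and "x \<notin> carrier M \<Longrightarrow> f x = undefined"
  using assms by (auto simp: linear_maps_def PiE_def extensional_def)

lemma linear_mapsI:
  assumes "\<And>x. x \<in> carrier M \<Longrightarrow> f x \<in> carrier N"
    and "\<And>x y. x \<in> carrier M \<Longrightarrow> y \<in> carrier M \<Longrightarrow> f (x \<oplus>\<^bsub>M\<^esub> y) = f x \<oplus>\<^bsub>N\<^esub> f y"
    and "\<And>a x. a \<in> carrier R \<Longrightarrow> x \<in> carrier M \<Longrightarrow> f (a \<odot>\<^bsub>M\<^esub> x) = a \<odot>\<^bsub>N\<^esub> f x"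
    and "\<And>x. x \<notin> carrier M \<Longrightarrow> f x = undefined"
  shows "f \<in> linear_maps R M N"
  using assms by (auto simp: linear_maps_def PiE_def extensional_def)

lemma linear_maps_compose:
  assumes "f \<in> linear_maps R L M" and "g \<in> linear_maps R M N" and "left_module R L"
  shows "compose (carrier L) g f \<in> linear_maps R L N"
proof -
  interpret L: left_module R L by fact
  show ?thesis
    by (rule linear_mapsI)
      (simp_all add: compose_def linear_mapsD[OF assms(1)] linear_mapsD[OF assms(2)] L.smult_closed)
qed

lemma category_module_category:
  fixes R :: "('r, 'x) ring_scheme"
  shows "category (module_category R)"
proof
  fix M :: "('r, 'v) module" assume "M \<in> Ob (module_category R)"
  then interpret M: left_module R M by (simp add: module_category_def)
  show "Id (module_category R) M \<in> Hom (module_category R) M M"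
    by (auto simp: module_category_def M.smult_closed intro!: linear_mapsI)
next
  fix L M N :: "('r, 'v) module" and f g
  assume "L \<in> Ob (module_category R)" "f \<in> Hom (module_category R) L M" "g \<in> Hom (module_category R) M N"
  then show "Comp (module_category R) L M N g f \<in> Hom (module_category R) L N"
    by (simp add: module_category_def linear_maps_compose)
next
  fix M N :: "('r, 'v) module" and f assume "f \<in> Hom (module_category R) M N"
  then have f: "f \<in> linear_maps R M N" by (simp add: module_category_def)
  show "Comp (module_category R) M M N f (Id (module_category R) M) = f"
    "Comp (module_category R) M N N (Id (module_category R) N) f = f"
    using linear_mapsD(1,4)[OF f] by (simp_all add: module_category_def compose_def fun_eq_iff restrict_def)
next
  fix L M N P :: "('r, 'v) module" and f g h assume "f \<in> Hom (module_category R) L M"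
  then have f: "f \<in> linear_maps R L M" by (simp add: module_category_def)
  show "Comp (module_category R) L N P h (Comp (module_category R) L M N g f) =
    Comp (module_category R) L M P (Comp (module_category R) M N P h g) f"
    using linear_mapsD(1)[OF f] by (simp add: module_category_def compose_def fun_eq_iff restrict_def)
qed

text \<open>The quasi-inverse on an arrow \<open>u\<close> is the preimage of \<open>i\<^sub>Y \<circ> u \<circ> j\<^sub>X\<close>, where \<open>i\<^sub>X : X \<rightarrow> F (m X)\<close> is
  a chosen isomorphism with inverse \<open>j\<^sub>X\<close>.\<close>

lemma (in is_functor) equivalent_categories_if_fully_faithful:
  assumes full: "\<And>M N. M \<in> Ob C \<Longrightarrow> N \<in> Ob C \<Longrightarrow>
      bij_betw (FAr F M N) (Hom C M N) (Hom D (FOb F M) (FOb F N))"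
    and ess: "\<And>X. X \<in> Ob D \<Longrightarrow> \<exists>M \<in> Ob C. isos D X (FOb F M) \<noteq> {}"
  shows "equivalent_categories D C"
proof -
  define m where "m X = (SOME M. M \<in> Ob C \<and> isos D X (FOb F M) \<noteq> {})" for X
  define i where "i X = (SOME i. i \<in> isos D X (FOb F (m X)))" for X
  define j where "j X = (SOME j. j \<in> Hom D (FOb F (m X)) X \<and> Comp D X (FOb F (m X)) X j (i X) = Id D X \<and>
      Comp D (FOb F (m X)) X (FOb F (m X)) (i X) j = Id D (FOb F (m X)))" for X
  have m': "m X \<in> Ob C \<and> isos D X (FOb F (m X)) \<noteq> {}" if "X \<in> Ob D" for X
    unfolding m_def by (rule someI_ex) (use ess[OF that] in blast)
  have i': "i X \<in> isos D X (FOb F (m X))" if "X \<in> Ob D" for X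
    unfolding i_def by (rule someI_ex) (use m'[OF that] in blast)
  have j': "j X \<in> Hom D (FOb F (m X)) X \<and> Comp D X (FOb F (m X)) X (j X) (i X) = Id D X \<and>
      Comp D (FOb F (m X)) X (FOb F (m X)) (i X) (j X) = Id D (FOb F (m X))" if "X \<in> Ob D" for X
    unfolding j_def by (rule someI_ex) (use i'[OF that] in \<open>simp add: isos_def Bex_def\<close>)
  have m: "m X \<in> Ob C" and i: "i X \<in> Hom D X (FOb F (m X))" and j: "j X \<in> Hom D (FOb F (m X)) X"
    and ji: "Comp D X (FOb F (m X)) X (j X) (i X) = Id D X"
    and ij: "Comp D (FOb F (m X)) X (FOb F (m X)) (i X) (j X) = Id D (FOb F (m X))"
    if "X \<in> Ob D" for X
    using m'[OF that] i'[OF that] j'[OF that] by (simp_all add: isos_def)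
  define p where "p M N = inv_into (Hom C M N) (FAr F M N)" for M N
  have p_in: "p M N u \<in> Hom C M N" and Fp: "FAr F M N (p M N u) = u"
    if "M \<in> Ob C" "N \<in> Ob C" "u \<in> Hom D (FOb F M) (FOb F N)" for M N u
    using full[OF that(1,2)] that(3) unfolding p_def bij_betw_def
    by (simp_all add: inv_into_into f_inv_into_f)
  have Fcong: "f = g" if "M \<in> Ob C" "N \<in> Ob C" "f \<in> Hom C M N" "g \<in> Hom C M N" "FAr F M N f = FAr F M N g"
    for M N f g
    using full[OF that(1,2)] that(3-5) by (auto simp: bij_betw_def inj_on_def)
  define w where "w X Y u = Comp D (FOb F (m X)) X (FOb F (m Y)) (Comp D X Y (FOb F (m Y)) (i Y) u) (j X)"
    for X Y u
  note obs = m FOb_in i j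
  have w_in: "w X Y u \<in> Hom D (FOb F (m X)) (FOb F (m Y))"
    if "X \<in> Ob D" "Y \<in> Ob D" "u \<in> Hom D X Y" for X Y u
    unfolding w_def by (intro D.Comp_in[of _ X] D.Comp_in[of _ Y]) (simp_all add: obs that)
  have w_i: "Comp D X (FOb F (m X)) (FOb F (m Y)) (w X Y u) (i X) = Comp D X Y (FOb F (m Y)) (i Y) u"
    if "X \<in> Ob D" "Y \<in> Ob D" "u \<in> Hom D X Y" for X Y u
    unfolding w_def using that
    by (simp add: D.Comp_assoc[of X "FOb F (m X)" X "FOb F (m Y)", symmetric] obs ji
        D.Comp_Id_right D.Comp_in[of _ Y])
  have j_w: "Comp D (FOb F (m X)) (FOb F (m Y)) Y (j Y) (w X Y u) = Comp D (FOb F (m X)) X Y u (j X)"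
    if "X \<in> Ob D" "Y \<in> Ob D" "u \<in> Hom D X Y" for X Y u
    unfolding w_def using that
    by (subst D.Comp_assoc, simp_all add: obs D.Comp_in[of _ Y])
      (subst D.Comp_assoc, simp_all add: obs ji D.Comp_Id_left)
  define Q where "Q = \<lparr>FOb = m, FAr = (\<lambda>X Y u. p (m X) (m Y) (w X Y u))\<rparr>"
  \<comment> \<open>The functor laws of \<open>Q\<close> are equations between arrows of
    \<open>C\<close>; faithfulness, in the form \<open>Fcong\<close>, reduces them to equations for
    \<open>w\<close> in \<open>D\<close>.\<close>
  have Q: "is_functor D C Q"
  proof
    fix X assume X: "X \<in> Ob D"
    then show "FOb Q X \<in> Ob C" by (simp add: Q_def m)
    have "w X X (Id D X) = Id D (FOb F (m X))"
      using X by (simp add: w_def D.Comp_Id_right obs ij)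
    then show "FAr Q X X (Id D X) = Id C (FOb Q X)"
      using X by (auto simp: Q_def m C.Id_in D.Id_in FOb_in p_in Fp FAr_Id intro!: Fcong[of "m X" "m X"])
  next
    fix X Y u assume "X \<in> Ob D" "Y \<in> Ob D" "u \<in> Hom D X Y"
    then show "FAr Q X Y u \<in> Hom C (FOb Q X) (FOb Q Y)" by (simp add: Q_def m p_in w_in)
  next
    fix X Y Z u v assume X: "X \<in> Ob D" "Y \<in> Ob D" "Z \<in> Ob D" and u: "u \<in> Hom D X Y" "v \<in> Hom D Y Z"
    have "w X Z (Comp D X Y Z v u) = Comp D (FOb F (m X)) (FOb F (m Y)) (FOb F (m Z)) (w Y Z v) (w X Y u)"
    proof -
      have "Comp D (FOb F (m X)) (FOb F (m Y)) (FOb F (m Z)) (w Y Z v) (w X Y u) =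
         Comp D (FOb F (m X)) X (FOb F (m Z))
           (Comp D X (FOb F (m Y)) (FOb F (m Z)) (w Y Z v) (Comp D X Y (FOb F (m Y)) (i Y) u)) (j X)"
        unfolding w_def[of X Y] using X u
        by (subst D.Comp_assoc) (simp_all add: obs D.Comp_in[of X Y] w_in)
      also have "Comp D X (FOb F (m Y)) (FOb F (m Z)) (w Y Z v) (Comp D X Y (FOb F (m Y)) (i Y) u) =
          Comp D X Z (FOb F (m Z)) (i Z) (Comp D X Y Z v u)"
        using X u by (subst D.Comp_assoc) (simp_all add: obs w_in w_i D.Comp_assoc[of X Y Z])
      finally show ?thesis by (simp add: w_def)
    qed
    moreover have "Comp D X Y Z v u \<in> Hom D X Z" using X u by (simp add: D.Comp_in[of _ Y])
    then have "w X Z (Comp D X Y Z v u) \<in> Hom D (FOb F (m X)) (FOb F (m Z))" using X by (simp add: w_in)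
    ultimately show "FAr Q X Z (Comp D X Y Z v u) =
        Comp C (FOb Q X) (FOb Q Y) (FOb Q Z) (FAr Q Y Z v) (FAr Q X Y u)"
      using X u by (intro Fcong[of "m X" "m Z"])
        (simp_all add: Q_def m p_in w_in C.Comp_in[of _ "m Y"] Fp FAr_Comp)
  qed
  have F: "is_functor C D F" ..
  have n1: "naturally_isomorphic D D id_func (comp_func F Q)"
    unfolding naturally_isomorphic_def
  proof (intro bexI ballI)
    show "(\<lambda>X \<in> Ob D. i X) \<in> nat_trans D D id_func (comp_func F Q)"
      by (auto simp: nat_trans_def id_func_def comp_func_def Q_def i m w_in Fp w_i)
    show "(\<lambda>X \<in> Ob D. i X) X \<in> isos D (FOb id_func X) (FOb (comp_func F Q) X)" if "X \<in> Ob D" for X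
      using that by (auto simp: isos_def id_func_def comp_func_def Q_def i j ij ji intro!: bexI[of _ "j X"])
  qed
  have n2: "naturally_isomorphic C C (comp_func Q F) id_func"
    unfolding naturally_isomorphic_def
  proof (intro bexI ballI)
    \<comment> \<open>The counit at \<open>M\<close> is the preimage of \<open>j (FOb F M)\<close>.
      It need not be an identity, since \<open>m (FOb F M)\<close> is merely some object whose image
      is isomorphic to that of \<open>M\<close>. Naturality and invertibility are again tested after
      applying \<open>F\<close>.\<close>
    let ?i = "\<lambda>M. p M (m (FOb F M)) (i (FOb F M))" and ?j = "\<lambda>M. p (m (FOb F M)) M (j (FOb F M))"
    note pin = p_in[OF _ m[OF FOb_in] i[OF FOb_in]] p_in[OF m[OF FOb_in] _ j[OF FOb_in]]
      Fp[OF _ m[OF FOb_in] i[OF FOb_in]] Fp[OF m[OF FOb_in] _ j[OF FOb_in]]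
    have "Comp C (m (FOb F M)) (m (FOb F N)) N (?j N) (p (m (FOb F M)) (m (FOb F N)) (w (FOb F M) (FOb F N) (FAr F M N f))) =
        Comp C (m (FOb F M)) M N f (?j M)"
      if "M \<in> Ob C" "N \<in> Ob C" "f \<in> Hom C M N" for M N f
      using that
      by (intro Fcong[of "m (FOb F M)" N] C.Comp_in[of _ M] C.Comp_in[of _ "m (FOb F N)"])
        (simp_all add: FAr_Comp m FOb_in pin p_in w_in FAr_in Fp j_w)
    then show "(\<lambda>M \<in> Ob C. ?j M) \<in> nat_trans C C (comp_func Q F) id_func"
      by (auto simp: nat_trans_def id_func_def comp_func_def Q_def pin m FOb_in)
    show "(\<lambda>M \<in> Ob C. ?j M) M \<in> isos C (FOb (comp_func Q F) M) (FOb id_func M)" if "M \<in> Ob C" for M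
    proof -
      have "Comp C (m (FOb F M)) M (m (FOb F M)) (?i M) (?j M) = Id C (m (FOb F M))"
        using that by (intro Fcong[of "m (FOb F M)" "m (FOb F M)"] C.Comp_in[of _ M])
          (simp_all add: m FOb_in C.Id_in FAr_Comp pin FAr_Id ij ji)
      moreover have "Comp C M (m (FOb F M)) M (?j M) (?i M) = Id C M"
        using that by (intro Fcong[of M M] C.Comp_in[of _ "m (FOb F M)"])
          (simp_all add: m FOb_in C.Id_in FAr_Comp pin FAr_Id ij ji)
      ultimately show ?thesis
        using that by (auto simp: isos_def id_func_def comp_func_def Q_def pin intro!: bexI[of _ "?i M"])
    qed
  qed
  show ?thesis
    unfolding equivalent_categories_def
    using C.category_axioms D.category_axioms Q F n1 n2 by blast
qed

section \<open>Cochains on the integers\<close>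

text \<open>Stating the step as an equivalence covers both directions of the integers at once. In
  the cochain lemmas below the equivalence comes for free: each side is multiplied by a group
  element and cancelled again.\<close>

lemma int_step_induct:
  fixes P :: "int \<Rightarrow> bool"
  assumes "P 0" and "\<And>n. P (n + 1) \<longleftrightarrow> P n"
  shows "P n"
proof (induction n rule: int_induct[of _ 0])
  case (step2 i)
  then show ?case using assms(2)[of "i - 1"] by simp
qed (use assms in auto)

text \<open>In a group the recursion can also be solved backwards, so a single value determines a
  sequence on all integers.\<close>

lemma (in comm_group) int_recursion:
  fixes b :: "int \<Rightarrow> 'a"
  assumes "\<And>n. b n \<in> carrier G" and "u \<in> carrier G"
  obtains p where "\<And>n. p n \<in> carrier G" and "p 0 = u" and "\<And>n. p (n + 1) = p n \<otimes> b n"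
proof -
  define f where "f = rec_nat u (\<lambda>k x. x \<otimes> b (int k))"
  \<comment> \<open>\<open>f' k\<close> is the value at \<open>- int k\<close>: passing from there
    to \<open>- int k - 1\<close> divides by \<open>b (- int k - 1)\<close>.\<close>
  define f' where "f' = rec_nat u (\<lambda>k x. x \<otimes> inv (b (- int k - 1)))"
  define p where "p n = (if n \<ge> 0 then f (nat n) else f' (nat (- n)))" for n
  have f: "f k \<in> carrier G" "f' k \<in> carrier G" for k
    by (induction k) (simp_all add: f_def f'_def assms)
  have step: "f (Suc k) = f k \<otimes> b (int k)" "f' k = f' (Suc k) \<otimes> b (- int k - 1)" for k
    using f(2)[of k] assms(1) by (simp_all add: f_def f'_def m_assoc)
  show thesis
  proof
    show "p n \<in> carrier G" "p 0 = u" for n by (simp_all add: p_def f) (simp add: f_def)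
    show "p (n + 1) = p n \<otimes> b n" for n
    proof (cases "n \<ge> 0")
      case True
      then show ?thesis using step(1)[of "nat n"] by (simp add: p_def nat_add_distrib)
    next
      case False
      define k where "k = nat (- n - 1)"
      have n: "n = - int k - 1" using False by (simp add: k_def)
      \<comment> \<open>For \<open>k = 0\<close> the argument \<open>n + 1\<close> is 0, where
        \<open>p\<close> is given by \<open>f\<close> and not by \<open>f'\<close>; both start at
        \<open>u\<close>.\<close>
      have "p (n + 1) = f' k" by (cases k) (simp_all add: n p_def f_def f'_def nat_add_distrib)
      moreover have "p n = f' (Suc k)" by (simp add: n p_def nat_add_distrib)
      ultimately show ?thesis using step(2)[of k] n by simp
    qed
  qed
qed

text \<open>The equation at the pair (n, 1) with \<eta>(1) = a forces \<eta>(n + 1) = \<eta>(n) a /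
  c(n, 1), and the one at (0, 0) forces \<eta>(0) = c(0, 0). The remaining equations follow by
  induction on n, the cocycle identity at (m, n, 1) giving the step. Prescribing \<eta>(1) is
  possible because the solutions form a torsor under the homomorphisms from the integers.\<close>

lemma (in comm_group) int_2cocycle_trivial:
  fixes c :: "int \<Rightarrow> int \<Rightarrow> 'a"
  assumes c: "\<And>m n. c m n \<in> carrier G"
    and cocycle: "\<And>m n l. c m n \<otimes> c (m + n) l = c m (n + l) \<otimes> c n l"
    and a: "a \<in> carrier G"
  shows "\<exists>\<eta>. (\<forall>n. \<eta> n \<in> carrier G) \<and> \<eta> 1 = a \<and> (\<forall>m n. \<eta> n \<otimes> \<eta> m = \<eta> (m + n) \<otimes> c m n)"
proof -
  obtain \<eta> where \<eta>: "\<And>n. \<eta> n \<in> carrier G" "\<eta> 0 = c 0 0"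
    and rec: "\<And>n. \<eta> (n + 1) = \<eta> n \<otimes> (a \<otimes> inv c n 1)"
    using int_recursion[of "\<lambda>n. a \<otimes> inv c n 1" "c 0 0"] c a by auto
  have step: "\<eta> (n + 1) \<otimes> c n 1 = \<eta> n \<otimes> a" for n
    using c \<eta>(1) a by (simp add: rec m_assoc)
  \<comment> \<open>\<open>c\<close> is not assumed to be normalised. That a 2-cocycle is constant
    when an argument is 0 yields the case n = 0 of the induction and the value of \<eta> at
    1.\<close>
  have c0: "c m 0 = c 0 0" "c 0 1 = c 0 0" for m
    using cocycle[of m 0 0] cocycle[of 0 0 1] c by (simp_all add: m_comm)
  have "\<forall>m. \<eta> n \<otimes> \<eta> m = \<eta> (m + n) \<otimes> c m n" for n
  proof (induction n rule: int_step_induct)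
    case 1
    show ?case
    proof
      fix m show "\<eta> 0 \<otimes> \<eta> m = \<eta> (m + 0) \<otimes> c m 0"
        using \<eta> c by (simp add: c0(1)[of m] m_comm)
    qed
  next
    case (2 n)
    have "\<eta> (n + 1) \<otimes> \<eta> m = \<eta> (m + (n + 1)) \<otimes> c m (n + 1) \<longleftrightarrow>
        \<eta> n \<otimes> \<eta> m = \<eta> (m + n) \<otimes> c m n" for m
    proof -
      have "\<eta> (n + 1) \<otimes> \<eta> m \<otimes> c n 1 = \<eta> n \<otimes> \<eta> m \<otimes> a"
        using step[of n] \<eta> c a by (metis (no_types, lifting) m_assoc m_comm m_closed)
      moreover have "\<eta> (m + (n + 1)) \<otimes> c m (n + 1) \<otimes> c n 1 = \<eta> (m + n) \<otimes> c m n \<otimes> a"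
      proof -
        have "\<eta> (m + (n + 1)) \<otimes> c m (n + 1) \<otimes> c n 1 = \<eta> (m + n + 1) \<otimes> (c m (n + 1) \<otimes> c n 1)"
          using \<eta> c by (simp add: m_assoc add.assoc)
        also have "\<dots> = \<eta> (m + n + 1) \<otimes> c (m + n) 1 \<otimes> c m n"
          unfolding cocycle[symmetric] using \<eta> c by (simp add: m_ac)
        finally show ?thesis using \<eta> c a by (simp add: step) (simp add: m_ac)
      qed
      ultimately show ?thesis using \<eta> c a by (metis (no_types, lifting) right_cancel m_closed)
    qed
    then show ?case by blast
  qed
  moreover have "\<eta> 1 = a" using step[of 0] \<eta> c a by (simp add: c0(2) m_comm)
  ultimately show ?thesis using \<eta> by blast
qed

text \<open>Two solutions differ by a homomorphism from the integers, which is determined by its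
  value at 1. The induction says this without forming the quotient.\<close>

lemma (in comm_group) int_1cochain_unique:
  fixes c :: "int \<Rightarrow> int \<Rightarrow> 'a"
  assumes c: "\<And>m n. c m n \<in> carrier G"
    and \<eta>: "\<And>n. \<eta> n \<in> carrier G" "\<And>m n. \<eta> n \<otimes> \<eta> m = \<eta> (m + n) \<otimes> c m n"
    and \<eta>': "\<And>n. \<eta>' n \<in> carrier G" "\<And>m n. \<eta>' n \<otimes> \<eta>' m = \<eta>' (m + n) \<otimes> c m n"
    and "\<eta> 1 = \<eta>' 1"
  shows "\<eta> = \<eta>'"
proof
  fix n show "\<eta> n = \<eta>' n"
  proof (induction n rule: int_step_induct)
    case 1
    show ?case using \<eta>(2)[of 0 0] \<eta>'(2)[of 0 0] \<eta>(1) \<eta>'(1) c by simp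
  next
    case (2 n)
    have "\<eta> n \<otimes> \<eta> 1 = \<eta> (n + 1) \<otimes> c n 1" "\<eta>' n \<otimes> \<eta>' 1 = \<eta>' (n + 1) \<otimes> c n 1"
      using \<eta>(2)[of 1 n] \<eta>'(2)[of 1 n] \<eta>(1) \<eta>'(1) by (simp_all add: m_comm)
    then show ?case using \<eta>(1) \<eta>'(1) c assms(6) by (metis right_cancel)
  qed
qed

text \<open>The ansatz \<open>\<gamma> m 1 = \<one>\<close> turns the case \<open>n = 1\<close> of the equation into the recursion
  \<open>\<gamma> l (m + 1) = \<gamma> l m / a l m 1\<close>.\<close>

lemma (in comm_group) int_3cocycle_trivial:
  fixes a :: "int \<Rightarrow> int \<Rightarrow> int \<Rightarrow> 'a"
  assumes a: "\<And>l m n. a l m n \<in> carrier G"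
    and cocycle: "\<And>l m n k. a m n k \<otimes> a l (m + n) k \<otimes> a l m n = a (l + m) n k \<otimes> a l m (n + k)"
    and a0: "\<And>l m. a l m 0 = \<one>"
  shows "\<exists>\<gamma>. (\<forall>m n. \<gamma> m n \<in> carrier G) \<and>
    (\<forall>l m n. \<gamma> (l + m) n \<otimes> \<gamma> l m = a l m n \<otimes> (\<gamma> l (m + n) \<otimes> \<gamma> m n))"
proof -
  \<comment> \<open>One recursion in the second variable for each \<open>l\<close>. The start value
    \<open>\<one>\<close> at 0 makes the case n = 0 of the claim hold, where \<open>a l m 0\<close>
    is \<open>\<one>\<close>.\<close>
  have "\<exists>p. (\<forall>n. p n \<in> carrier G) \<and> p 0 = \<one> \<and> (\<forall>n. p (n + 1) = p n \<otimes> inv a l n 1)" for l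
    using int_recursion[of "\<lambda>n. inv a l n 1" \<one>] a by (metis inv_closed one_closed)
  then obtain \<gamma> where \<gamma>: "\<And>l n. \<gamma> l n \<in> carrier G" "\<And>l. \<gamma> l 0 = \<one>"
    and rec: "\<And>l n. \<gamma> l (n + 1) = \<gamma> l n \<otimes> inv a l n 1"
    by metis
  have step: "\<gamma> l (n + 1) \<otimes> a l n 1 = \<gamma> l n" for l n
    using a \<gamma>(1) by (simp add: rec m_assoc)
  have "\<forall>l m. \<gamma> (l + m) n \<otimes> \<gamma> l m = a l m n \<otimes> (\<gamma> l (m + n) \<otimes> \<gamma> m n)" for n
  proof (induction n rule: int_step_induct)
    case 1
    show ?case using \<gamma> by (simp add: a0)
  next
    case (2 n)
    have "\<gamma> (l + m) (n + 1) \<otimes> \<gamma> l m = a l m (n + 1) \<otimes> (\<gamma> l (m + (n + 1)) \<otimes> \<gamma> m (n + 1)) \<longleftrightarrow>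
        \<gamma> (l + m) n \<otimes> \<gamma> l m = a l m n \<otimes> (\<gamma> l (m + n) \<otimes> \<gamma> m n)" for l m
    proof -
      have "\<gamma> (l + m) (n + 1) \<otimes> \<gamma> l m \<otimes> a (l + m) n 1 = (\<gamma> (l + m) (n + 1) \<otimes> a (l + m) n 1) \<otimes> \<gamma> l m"
        using \<gamma>(1) a by (simp add: m_ac)
      then have 1: "\<gamma> (l + m) (n + 1) \<otimes> \<gamma> l m \<otimes> a (l + m) n 1 = \<gamma> (l + m) n \<otimes> \<gamma> l m"
        by (simp only: step)
      \<comment> \<open>The cocycle identity at (l, m, n, 1) replaces the two values of
        \<open>a\<close> by three, each of which is absorbed by \<open>step\<close> or is the factor
        wanted at n.\<close>
      have "a l m (n + 1) \<otimes> (\<gamma> l (m + (n + 1)) \<otimes> \<gamma> m (n + 1)) \<otimes> a (l + m) n 1 =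
          (a (l + m) n 1 \<otimes> a l m (n + 1)) \<otimes> (\<gamma> l (m + (n + 1)) \<otimes> \<gamma> m (n + 1))"
        using \<gamma>(1) a by (simp add: m_ac)
      also have "\<dots> = a l m n \<otimes> ((\<gamma> l (m + n + 1) \<otimes> a l (m + n) 1) \<otimes> (\<gamma> m (n + 1) \<otimes> a m n 1))"
        unfolding cocycle[symmetric] using \<gamma>(1) a by (simp add: m_ac add.assoc)
      also have "\<dots> = a l m n \<otimes> (\<gamma> l (m + n) \<otimes> \<gamma> m n)" by (simp only: step)
      finally show ?thesis using 1 \<gamma>(1) a by (metis (no_types, lifting) right_cancel m_closed)
    qed
    then show ?case by blast
  qed
  then show ?thesis using \<gamma> by blast
qed

section \<open>Sums and modules\<close>

lemma additive_zero:
  assumes "abelian_group M" and "abelian_group N"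
    and "\<And>x. x \<in> carrier M \<Longrightarrow> f x \<in> carrier N"
    and "\<And>x y. x \<in> carrier M \<Longrightarrow> y \<in> carrier M \<Longrightarrow> f (x \<oplus>\<^bsub>M\<^esub> y) = f x \<oplus>\<^bsub>N\<^esub> f y"
  shows "f \<zero>\<^bsub>M\<^esub> = \<zero>\<^bsub>N\<^esub>"
proof -
  interpret M: abelian_group M by fact
  interpret N: abelian_group N by fact
  have "f \<zero>\<^bsub>M\<^esub> \<oplus>\<^bsub>N\<^esub> f \<zero>\<^bsub>M\<^esub> = f \<zero>\<^bsub>M\<^esub>"
    using assms(4)[of "\<zero>\<^bsub>M\<^esub>" "\<zero>\<^bsub>M\<^esub>"] by simp
  then show ?thesis using assms(3)[of "\<zero>\<^bsub>M\<^esub>"] by simp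
qed

lemma additive_finsum:
  assumes "abelian_group M" and "abelian_group N"
    and "\<And>x. x \<in> carrier M \<Longrightarrow> f x \<in> carrier N"
    and "\<And>x y. x \<in> carrier M \<Longrightarrow> y \<in> carrier M \<Longrightarrow> f (x \<oplus>\<^bsub>M\<^esub> y) = f x \<oplus>\<^bsub>N\<^esub> f y"
    and "g \<in> S \<rightarrow> carrier M"
  shows "f (\<Oplus>\<^bsub>M\<^esub>i\<in>S. g i) = (\<Oplus>\<^bsub>N\<^esub>i\<in>S. f (g i))"
proof -
  interpret M: abelian_group M by fact
  interpret N: abelian_group N by fact
  have zero: "f \<zero>\<^bsub>M\<^esub> = \<zero>\<^bsub>N\<^esub>" using assms(1-4) by (rule additive_zero)
  show ?thesis
  proof (cases "finite S")
    case True
    then show ?thesis using assms(5)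
    proof induction
      case (insert i S)
      then have "g i \<in> carrier M" "g \<in> S \<rightarrow> carrier M" by auto
      with insert show ?case
        by (simp add: assms(3,4) Pi_def)
    qed (simp add: zero)
  \<comment> \<open>Over an infinite index set \<open>finsum\<close> is zero by convention, on both
    sides.\<close>
  qed (simp add: zero M.finsum_infinite N.finsum_infinite)
qed

lemma (in abelian_monoid) finsum_swap:
  assumes "finite A" and "finite B" and "\<And>i j. i \<in> A \<Longrightarrow> j \<in> B \<Longrightarrow> f i j \<in> carrier G"
  shows "(\<Oplus>i\<in>A. \<Oplus>j\<in>B. f i j) = (\<Oplus>j\<in>B. \<Oplus>i\<in>A. f i j)"
  using assms(1,3)
proof induction
  case empty
  show ?case by (simp add: finsum_zero)
next
  case (insert i A)
  have "(\<Oplus>i\<in>insert i A. \<Oplus>j\<in>B. f i j) = (\<Oplus>j\<in>B. f i j) \<oplus> (\<Oplus>j\<in>B. \<Oplus>i\<in>A. f i j)"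
    using insert by simp
  also have "\<dots> = (\<Oplus>j\<in>B. f i j \<oplus> (\<Oplus>i\<in>A. f i j))"
    using insert by (intro finsum_addf[symmetric]) auto
  also have "\<dots> = (\<Oplus>j\<in>B. \<Oplus>i\<in>insert i A. f i j)"
    using insert by (intro finsum_cong') auto
  finally show ?case .
qed

lemma (in abelian_monoid) finsum_single:
  assumes "finite A" and "i \<in> A" and "f i \<in> carrier G" and "\<And>j. j \<in> A \<Longrightarrow> j \<noteq> i \<Longrightarrow> f j = \<zero>"
  shows "(\<Oplus>j\<in>A. f j) = f i"
proof -
  have "(\<Oplus>j\<in>A. f j) = (\<Oplus>j\<in>A. if i = j then f j else \<zero>)"
    using assms by (intro finsum_cong') auto
  also have "\<dots> = f i"
  proof -
    have "(\<Oplus>j\<in>A. if i = j then f i else \<zero>) = f i"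
      using finsum_singleton[OF assms(2,1), of "\<lambda>_. f i"] assms(3) by simp
    moreover have "(\<lambda>j. if i = j then f j else \<zero>) = (\<lambda>j. if i = j then f i else \<zero>)" by auto
    ultimately show ?thesis by simp
  qed
  finally show ?thesis .
qed

context left_module begin

lemma smult_zero_left: "x \<in> carrier M \<Longrightarrow> \<zero>\<^bsub>R\<^esub> \<odot>\<^bsub>M\<^esub> x = \<zero>\<^bsub>M\<^esub>"
  using additive_zero[OF R.abelian_group_axioms M.abelian_group_axioms, of "\<lambda>a. a \<odot>\<^bsub>M\<^esub> x"]
  by (simp add: smult_closed smult_l_distr)

lemma smult_zero_right: "a \<in> carrier R \<Longrightarrow> a \<odot>\<^bsub>M\<^esub> \<zero>\<^bsub>M\<^esub> = \<zero>\<^bsub>M\<^esub>"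
  using additive_zero[OF M.abelian_group_axioms M.abelian_group_axioms, of "\<lambda>x. a \<odot>\<^bsub>M\<^esub> x"]
  by (simp add: smult_closed smult_r_distr)

lemma smult_finsum_left:
  "x \<in> carrier M \<Longrightarrow> f \<in> S \<rightarrow> carrier R \<Longrightarrow> (\<Oplus>\<^bsub>R\<^esub>i\<in>S. f i) \<odot>\<^bsub>M\<^esub> x = (\<Oplus>\<^bsub>M\<^esub>i\<in>S. f i \<odot>\<^bsub>M\<^esub> x)"
  using additive_finsum[OF R.abelian_group_axioms M.abelian_group_axioms, of "\<lambda>a. a \<odot>\<^bsub>M\<^esub> x" f S]
  by (simp add: smult_closed smult_l_distr)

lemma smult_finsum_right:
  "a \<in> carrier R \<Longrightarrow> f \<in> S \<rightarrow> carrier M \<Longrightarrow> a \<odot>\<^bsub>M\<^esub> (\<Oplus>\<^bsub>M\<^esub>i\<in>S. f i) = (\<Oplus>\<^bsub>M\<^esub>i\<in>S. a \<odot>\<^bsub>M\<^esub> f i)"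
  using additive_finsum[OF M.abelian_group_axioms M.abelian_group_axioms, of "\<lambda>x. a \<odot>\<^bsub>M\<^esub> x" f S]
  by (simp add: smult_closed smult_r_distr)

end

section \<open>Encoding finite tuples in an infinite type\<close>

lemma inj_pairing_exists:
  assumes "infinite (UNIV :: 'v set)"
  shows "\<exists>f :: 'v \<times> 'v \<Rightarrow> 'v. inj f"
  using card_of_ordIso[THEN iffD2, OF card_of_Times_same_infinite[OF assms]]
  by (auto simp: bij_betw_def)

text \<open>A tuple is coded one index at a time: its value at the new index is paired with the code
  of its restriction to the other indices.\<close>

lemma inj_tuples_exists:
  assumes "infinite (UNIV :: 'v set)" and "finite A"
  shows "\<exists>f :: ('a \<Rightarrow> 'v) \<Rightarrow> 'v. inj_on f (A \<rightarrow>\<^sub>E UNIV)"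
  using assms(2)
proof induction
  case empty
  show ?case by (auto simp: inj_on_def)
next
  case (insert a A)
  then obtain f :: "('a \<Rightarrow> 'v) \<Rightarrow> 'v" where f: "inj_on f (A \<rightarrow>\<^sub>E UNIV)" by blast
  obtain p :: "'v \<times> 'v \<Rightarrow> 'v" where p: "inj p" using inj_pairing_exists[OF assms(1)] by blast
  have "inj_on (\<lambda>h. p (h a, f (restrict h A))) (insert a A \<rightarrow>\<^sub>E UNIV)"
  proof (rule inj_onI)
    fix h k assume hk: "h \<in> insert a A \<rightarrow>\<^sub>E UNIV" "k \<in> insert a A \<rightarrow>\<^sub>E UNIV"
      and eq: "p (h a, f (restrict h A)) = p (k a, f (restrict k A))"
    from eq p have a: "h a = k a" and "f (restrict h A) = f (restrict k A)" by (auto dest: injD)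
    then have "restrict h A = restrict k A" using inj_onD[OF f] by simp
    then have "h x = k x" if "x \<in> A" for x using that by (metis restrict_apply')
    then show "h = k" using hk a by (intro PiE_ext[OF hk]) auto
  qed
  then show ?case by blast
qed

text \<open>A module over the double has to live in the type of the given representation, so the tuples
  are encoded as elements of that infinite type.\<close>

definition transport_module :: "('v \<Rightarrow> 'w) \<Rightarrow> ('r, 'v) module \<Rightarrow> ('r, 'w) module" where
  "transport_module f M = (let h = inv_into (carrier M) f in
    \<lparr>carrier = f ` carrier M, mult = undefined, one = undefined, zero = f (zero M),
     add = (\<lambda>x y. f (add M (h x) (h y))), smult = (\<lambda>a x. f (smult M a (h x)))\<rparr>)"

lemma transport_module_simps:
  "carrier (transport_module f M) = f ` carrier M"
  "zero (transport_module f M) = f (zero M)"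
  "inj_on f (carrier M) \<Longrightarrow> x \<in> carrier M \<Longrightarrow> y \<in> carrier M \<Longrightarrow>
     add (transport_module f M) (f x) (f y) = f (add M x y)"
  "inj_on f (carrier M) \<Longrightarrow> x \<in> carrier M \<Longrightarrow> smult (transport_module f M) a (f x) = f (smult M a x)"
  by (simp_all add: transport_module_def Let_def)

lemma left_module_transport:
  assumes "left_module R M" and f: "inj_on f (carrier M)"
  shows "left_module R (transport_module f M)"
proof -
  interpret left_module R M by fact
  have "abelian_group (transport_module f M)"
  proof (rule abelian_groupI)
    fix x assume "x \<in> carrier (transport_module f M)"
    then obtain x' where x': "x = f x'" "x' \<in> carrier M" by (auto simp: transport_module_simps)
    then show "\<exists>y \<in> carrier (transport_module f M). y \<oplus>\<^bsub>transport_module f M\<^esub> x = \<zero>\<^bsub>transport_module f M\<^esub>"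
      by (intro bexI[of _ "f (\<ominus>\<^bsub>M\<^esub> x')"]) (simp_all add: transport_module_simps f M.l_neg)
  qed (auto simp: transport_module_simps f M.a_ac)
  then show ?thesis
    using R.ring_axioms
    by (intro left_module.intro left_module_axioms.intro)
      (auto simp: transport_module_simps f smult_closed smult_l_distr smult_r_distr smult_assoc1 smult_one)
qed

section \<open>Cocycle identities\<close>

locale twisted_group = K?: field K + G: group G
    for K :: "('k, 'y) ring_scheme" (structure) and G :: "('g, 'x) monoid_scheme" +
  fixes \<alpha> :: "'g \<Rightarrow> 'g \<Rightarrow> 'g \<Rightarrow> 'k"
  assumes finite_G: "finite (carrier G)" and cocycle: "normalised_3cocycle G K \<alpha>"
begin

abbreviation gmult (infixl "\<cdot>" 70) where "x \<cdot> y \<equiv> x \<otimes>\<^bsub>G\<^esub> y"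
abbreviation e where "e \<equiv> \<one>\<^bsub>G\<^esub>"
abbreviation conj where "conj x g \<equiv> inv\<^bsub>G\<^esub> x \<cdot> g \<cdot> x"
abbreviation \<theta> where "\<theta> \<equiv> double_theta G K \<alpha>"

lemma alpha_unit [simp]:
  "g \<in> carrier G \<Longrightarrow> h \<in> carrier G \<Longrightarrow> k \<in> carrier G \<Longrightarrow> \<alpha> g h k \<in> Units K"
  using cocycle by (simp add: normalised_3cocycle_def)

lemma alpha_closed [simp]:
  "g \<in> carrier G \<Longrightarrow> h \<in> carrier G \<Longrightarrow> k \<in> carrier G \<Longrightarrow> \<alpha> g h k \<in> carrier K"
  by (simp add: Units_closed)

lemma alpha_pentagon:
  "g \<in> carrier G \<Longrightarrow> h \<in> carrier G \<Longrightarrow> k \<in> carrier G \<Longrightarrow> l \<in> carrier G \<Longrightarrow>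
    \<alpha> h k l \<otimes> \<alpha> g (h \<cdot> k) l \<otimes> \<alpha> g h k = \<alpha> (g \<cdot> h) k l \<otimes> \<alpha> g h (k \<cdot> l)"
  using cocycle by (simp add: normalised_3cocycle_def)

lemma alpha_one [simp]:
  "g \<in> carrier G \<Longrightarrow> h \<in> carrier G \<Longrightarrow> \<alpha> e g h = \<one>"
  "g \<in> carrier G \<Longrightarrow> h \<in> carrier G \<Longrightarrow> \<alpha> g e h = \<one>"
  "g \<in> carrier G \<Longrightarrow> h \<in> carrier G \<Longrightarrow> \<alpha> g h e = \<one>"
  using cocycle by (simp_all add: normalised_3cocycle_def)

text \<open>Used as a rewrite rule inside instances of the pentagon: it moves a group element past a
  loop, so that the arguments produced by neighbouring pentagons coincide.\<close>

lemma mult_conj: "x \<in> carrier G \<Longrightarrow> g \<in> carrier G \<Longrightarrow> x \<cdot> conj x g = g \<cdot> x"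
  by (simp add: G.m_assoc[symmetric])

lemma conj_conj: "x \<in> carrier G \<Longrightarrow> y \<in> carrier G \<Longrightarrow> g \<in> carrier G \<Longrightarrow> conj y (conj x g) = conj (x \<cdot> y) g"
  by (simp add: G.m_assoc G.inv_mult_group)

lemma conj_eq_iff:
  "x \<in> carrier G \<Longrightarrow> g \<in> carrier G \<Longrightarrow> h \<in> carrier G \<Longrightarrow> x \<cdot> h \<cdot> inv\<^bsub>G\<^esub> x = g \<longleftrightarrow> h = conj x g"
  by (metis G.inv_closed G.inv_solve_left G.inv_solve_right G.m_assoc G.m_closed)

lemma conj_mult:
  "x \<in> carrier G \<Longrightarrow> g \<in> carrier G \<Longrightarrow> h \<in> carrier G \<Longrightarrow> conj x (g \<cdot> h) = conj x g \<cdot> conj x h"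
  using mult_conj[of x h] by (simp add: G.m_assoc)

lemma conj_int_pow:
  fixes n :: int
  assumes "x \<in> carrier G" "g \<in> carrier G"
  shows "conj x g [^]\<^bsub>G\<^esub> n = conj x (g [^]\<^bsub>G\<^esub> n)"
  using hom_int_pow[of "\<lambda>g. conj x g" G G g n] assms
  by (simp add: G.is_group hom_def conj_mult)

lemma quotient_eq_iff:
  "a \<in> carrier K \<Longrightarrow> b \<in> Units K \<Longrightarrow> c \<in> carrier K \<Longrightarrow> quotient K a b = c \<longleftrightarrow> a = c \<otimes> b"
  by (metis K.Units_closed K.Units_inv_closed K.Units_l_inv K.Units_r_inv K.m_assoc K.r_one)

text \<open>Keeps the large cochain computations free of inverses. Known identities are multiplied
  into one equation p = q, oriented so that the factors of b occur in p, those of a occur in q, and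
  all others occur on both sides. Then p \<otimes> a and q \<otimes> b are products of the same
  factors, which rewriting modulo associativity and commutativity confirms, and a = b
  results.\<close>

lemma cancel_equal_factors:
  assumes "p = q" and "p \<in> Units K" and "a \<in> carrier K" and "b \<in> carrier K" and "p \<otimes> a = q \<otimes> b"
  shows "a = b"
  using assms by simp

lemma theta_unit [simp]:
  "g \<in> carrier G \<Longrightarrow> x \<in> carrier G \<Longrightarrow> y \<in> carrier G \<Longrightarrow> \<theta> g x y \<in> Units K"
  by (simp add: double_theta_def)

lemma theta_closed [simp]:
  "g \<in> carrier G \<Longrightarrow> x \<in> carrier G \<Longrightarrow> y \<in> carrier G \<Longrightarrow> \<theta> g x y \<in> carrier K"
  by (simp add: Units_closed)

text \<open>The defining quotient with its denominator cleared. The conjugates enter as variables,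
  so that they can keep short names in the products below.\<close>

lemma theta_eq:
  assumes "x \<in> carrier G" "y \<in> carrier G" "g \<in> carrier G" "h = conj x g" "k = conj (x \<cdot> y) g"
  shows "\<theta> g x y \<otimes> \<alpha> x h y = \<alpha> g x y \<otimes> \<alpha> x y k"
  by (rule sym, rule quotient_eq_iff[THEN iffD1]) (simp_all add: double_theta_def assms)

lemma theta_one:
  assumes "g \<in> carrier G" "x \<in> carrier G"
  shows "\<theta> g e x = \<one>" and "\<theta> g x e = \<one>"
  using assms by (simp_all add: double_theta_def)

text \<open>Product of the pentagons at \<open>(g, x, y, z)\<close>, \<open>(x, g\<^sub>1, y, z)\<close>, \<open>(x, y, g\<^sub>2, z)\<close> and
  \<open>(x, y, z, g\<^sub>3)\<close> with alternating signs.\<close>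

lemma theta_cocycle:
  assumes A: "g \<in> carrier G" "x \<in> carrier G" "y \<in> carrier G" "z \<in> carrier G"
  shows "\<theta> g x y \<otimes> \<theta> g (x \<cdot> y) z = \<theta> g x (y \<cdot> z) \<otimes> \<theta> (conj x g) y z"
proof -
  define g1 g2 g3 where "g1 = conj x g" and "g2 = conj y g1" and "g3 = conj z g2"
  have B: "g1 \<in> carrier G" "g2 \<in> carrier G" "g3 \<in> carrier G"
    using A by (simp_all add: g1_def g2_def g3_def)
  have c: "x \<cdot> g1 = g \<cdot> x" "y \<cdot> g2 = g1 \<cdot> y" "z \<cdot> g3 = g2 \<cdot> z"
    using A B(1,2) by (simp_all only: g1_def g2_def g3_def mult_conj)
  have d: "g2 = conj (x \<cdot> y) g" "g3 = conj (x \<cdot> y \<cdot> z) g" "g3 = conj (x \<cdot> (y \<cdot> z)) g" "g3 = conj (y \<cdot> z) g1"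
    using A by (simp_all only: g1_def g2_def g3_def conj_conj G.m_closed G.inv_closed) (simp_all add: G.m_assoc)
  have t: "\<theta> g x y \<otimes> \<alpha> x g1 y = \<alpha> g x y \<otimes> \<alpha> x y g2"
    "\<theta> g (x \<cdot> y) z \<otimes> \<alpha> (x \<cdot> y) g2 z = \<alpha> g (x \<cdot> y) z \<otimes> \<alpha> (x \<cdot> y) z g3"
    "\<theta> g x (y \<cdot> z) \<otimes> \<alpha> x g1 (y \<cdot> z) = \<alpha> g x (y \<cdot> z) \<otimes> \<alpha> x (y \<cdot> z) g3"
    "\<theta> g1 y z \<otimes> \<alpha> y g2 z = \<alpha> g1 y z \<otimes> \<alpha> y z g3"
    using theta_eq[OF A(2,3,1) g1_def d(1)] theta_eq[OF _ A(4,1) d(1,2)]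
      theta_eq[OF A(2) _ A(1) g1_def d(3)] theta_eq[OF A(3,4) B(1) g2_def d(4)] A
    by simp_all
  note P = alpha_pentagon[OF A] alpha_pentagon[OF A(2) B(1) A(3,4), unfolded c]
    alpha_pentagon[OF A(2,3) B(2) A(4), unfolded c] alpha_pentagon[OF A(2-4) B(3), unfolded c]
  \<comment> \<open>The first four factors are the defining equations of the four values of
    \<theta>, those from the right-hand side of the claim being reversed; the other four are the
    pentagons.\<close>
  have "(\<theta> g x y \<otimes> \<alpha> x g1 y) \<otimes> (\<theta> g (x \<cdot> y) z \<otimes> \<alpha> (x \<cdot> y) g2 z) \<otimes>
      (\<alpha> g x (y \<cdot> z) \<otimes> \<alpha> x (y \<cdot> z) g3) \<otimes> (\<alpha> g1 y z \<otimes> \<alpha> y z g3) \<otimes>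
      (\<alpha> x y z \<otimes> \<alpha> g (x \<cdot> y) z \<otimes> \<alpha> g x y) \<otimes> (\<alpha> (g \<cdot> x) y z \<otimes> \<alpha> x g1 (y \<cdot> z)) \<otimes>
      (\<alpha> y g2 z \<otimes> \<alpha> x (g1 \<cdot> y) z \<otimes> \<alpha> x y g2) \<otimes> (\<alpha> (x \<cdot> y) z g3 \<otimes> \<alpha> x y (g2 \<cdot> z)) =
    (\<alpha> g x y \<otimes> \<alpha> x y g2) \<otimes> (\<alpha> g (x \<cdot> y) z \<otimes> \<alpha> (x \<cdot> y) z g3) \<otimes>
      (\<theta> g x (y \<cdot> z) \<otimes> \<alpha> x g1 (y \<cdot> z)) \<otimes> (\<theta> g1 y z \<otimes> \<alpha> y g2 z) \<otimes>
      (\<alpha> (g \<cdot> x) y z \<otimes> \<alpha> g x (y \<cdot> z)) \<otimes> (\<alpha> g1 y z \<otimes> \<alpha> x (g1 \<cdot> y) z \<otimes> \<alpha> x g1 y) \<otimes>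
      (\<alpha> (x \<cdot> y) g2 z \<otimes> \<alpha> x y (g2 \<cdot> z)) \<otimes> (\<alpha> y z g3 \<otimes> \<alpha> x (y \<cdot> z) g3 \<otimes> \<alpha> x y z)"
    by (simp only: t P)
  then have "\<theta> g x (y \<cdot> z) \<otimes> \<theta> g1 y z = \<theta> g x y \<otimes> \<theta> g (x \<cdot> y) z"
    by (rule cancel_equal_factors) (use A B in \<open>simp_all\<close>, simp_all add: m_ac)
  then show ?thesis by (simp add: g1_def)
qed


text \<open>The \<alpha>-factor in the equation of an arrow over s, for a and b powers of the target
  element; the powers of the source are their conjugates. Its three values of \<alpha> are the ways
  to insert s into (a, b), just as those of \<theta> insert g into (x, y).\<close>

definition psi where
  "psi s a b = quotient K (\<alpha> a b s \<otimes> \<alpha> s (conj s a) (conj s b)) (\<alpha> a s (conj s b))"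

lemma psi_unit [simp]:
  "s \<in> carrier G \<Longrightarrow> a \<in> carrier G \<Longrightarrow> b \<in> carrier G \<Longrightarrow> psi s a b \<in> Units K"
  by (simp add: psi_def)

lemma psi_closed [simp]:
  "s \<in> carrier G \<Longrightarrow> a \<in> carrier G \<Longrightarrow> b \<in> carrier G \<Longrightarrow> psi s a b \<in> carrier K"
  by (simp add: Units_closed)

lemma psi_eq:
  assumes "s \<in> carrier G" "a \<in> carrier G" "b \<in> carrier G" "a' = conj s a" "b' = conj s b"
  shows "psi s a b \<otimes> \<alpha> a s b' = \<alpha> a b s \<otimes> \<alpha> s a' b'"
  by (rule sym, rule quotient_eq_iff[THEN iffD1]) (simp_all add: psi_def assms)

lemma psi_one: "a \<in> carrier G \<Longrightarrow> b \<in> carrier G \<Longrightarrow> psi e a b = \<one>"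
  by (simp add: psi_def)

text \<open>Conjugation by s changes \<alpha> by the coboundary of \<open>psi s\<close>. This is the
  alternating product of the four pentagons in which s moves through (a, b, c): at (a, b, c, s), (a,
  b, s, c'), (a, s, b', c') and (s, a', b', c').\<close>

lemma psi_cocycle:
  assumes A: "s \<in> carrier G" "a \<in> carrier G" "b \<in> carrier G" "c \<in> carrier G"
  shows "psi s a b \<otimes> psi s (a \<cdot> b) c \<otimes> \<alpha> (conj s a) (conj s b) (conj s c) =
    psi s a (b \<cdot> c) \<otimes> psi s b c \<otimes> \<alpha> a b c"
proof -
  define a' b' c' where "a' = conj s a" and "b' = conj s b" and "c' = conj s c"
  have B: "a' \<in> carrier G" "b' \<in> carrier G" "c' \<in> carrier G"
    using A by (simp_all add: a'_def b'_def c'_def)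
  have d: "a' \<cdot> b' = conj s (a \<cdot> b)" "b' \<cdot> c' = conj s (b \<cdot> c)"
    using A by (simp_all only: a'_def b'_def c'_def conj_mult)
  have m: "s \<cdot> a' = a \<cdot> s" "s \<cdot> b' = b \<cdot> s" "s \<cdot> c' = c \<cdot> s"
    using A by (simp_all only: a'_def b'_def c'_def mult_conj)
  have t: "psi s a b \<otimes> \<alpha> a s b' = \<alpha> a b s \<otimes> \<alpha> s a' b'"
    "psi s (a \<cdot> b) c \<otimes> \<alpha> (a \<cdot> b) s c' = \<alpha> (a \<cdot> b) c s \<otimes> \<alpha> s (a' \<cdot> b') c'"
    "psi s a (b \<cdot> c) \<otimes> \<alpha> a s (b' \<cdot> c') = \<alpha> a (b \<cdot> c) s \<otimes> \<alpha> s a' (b' \<cdot> c')"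
    "psi s b c \<otimes> \<alpha> b s c' = \<alpha> b c s \<otimes> \<alpha> s b' c'"
    using psi_eq[OF A(1,2,3) a'_def b'_def] psi_eq[OF A(1) _ A(4) d(1) c'_def]
      psi_eq[OF A(1,2) _ a'_def d(2)] psi_eq[OF A(1,3,4) b'_def c'_def] A
    by simp_all
  note P = alpha_pentagon[OF A(2-4,1), unfolded m] alpha_pentagon[OF A(2,3,1) B(3), unfolded m]
    alpha_pentagon[OF A(2,1) B(2,3), unfolded m] alpha_pentagon[OF A(1) B, unfolded m]
  have "(psi s a b \<otimes> \<alpha> a s b') \<otimes> (psi s (a \<cdot> b) c \<otimes> \<alpha> (a \<cdot> b) s c') \<otimes>
      (\<alpha> a (b \<cdot> c) s \<otimes> \<alpha> s a' (b' \<cdot> c')) \<otimes> (\<alpha> b c s \<otimes> \<alpha> s b' c') \<otimes>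
      (\<alpha> (a \<cdot> b) c s \<otimes> \<alpha> a b (c \<cdot> s)) \<otimes> (\<alpha> b s c' \<otimes> \<alpha> a (b \<cdot> s) c' \<otimes> \<alpha> a b s) \<otimes>
      (\<alpha> (a \<cdot> s) b' c' \<otimes> \<alpha> a s (b' \<cdot> c')) \<otimes> (\<alpha> a' b' c' \<otimes> \<alpha> s (a' \<cdot> b') c' \<otimes> \<alpha> s a' b') =
    (\<alpha> a b s \<otimes> \<alpha> s a' b') \<otimes> (\<alpha> (a \<cdot> b) c s \<otimes> \<alpha> s (a' \<cdot> b') c') \<otimes>
      (psi s a (b \<cdot> c) \<otimes> \<alpha> a s (b' \<cdot> c')) \<otimes> (psi s b c \<otimes> \<alpha> b s c') \<otimes>
      (\<alpha> b c s \<otimes> \<alpha> a (b \<cdot> c) s \<otimes> \<alpha> a b c) \<otimes> (\<alpha> (a \<cdot> b) s c' \<otimes> \<alpha> a b (c \<cdot> s)) \<otimes>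
      (\<alpha> s b' c' \<otimes> \<alpha> a (b \<cdot> s) c' \<otimes> \<alpha> a s b') \<otimes> (\<alpha> (a \<cdot> s) b' c' \<otimes> \<alpha> s a' (b' \<cdot> c'))"
    by (simp only: t P)
  then have "psi s a (b \<cdot> c) \<otimes> psi s b c \<otimes> \<alpha> a b c = psi s a b \<otimes> psi s (a \<cdot> b) c \<otimes> \<alpha> a' b' c'"
    by (rule cancel_equal_factors) (use A B in \<open>simp_all\<close>, simp_all add: m_ac)
  then show ?thesis by (simp add: a'_def b'_def c'_def)
qed

text \<open>The six pentagons are those of the shuffles of \<open>(a, b)\<close> with \<open>(t, s)\<close>.\<close>

lemma psi_theta:
  assumes A: "t \<in> carrier G" "s \<in> carrier G" "a \<in> carrier G" "b \<in> carrier G"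
  shows "psi (t \<cdot> s) a b \<otimes> \<theta> (a \<cdot> b) t s =
    psi s (conj t a) (conj t b) \<otimes> psi t a b \<otimes> \<theta> a t s \<otimes> \<theta> b t s"
proof -
  define a' b' a'' b'' where "a' = conj t a" and "b' = conj t b" and "a'' = conj s a'" and "b'' = conj s b'"
  have B: "a' \<in> carrier G" "b' \<in> carrier G"
    using A by (simp_all add: a'_def b'_def)
  then have B'': "a'' \<in> carrier G" "b'' \<in> carrier G"
    using A by (simp_all add: a''_def b''_def)
  have m: "t \<cdot> a' = a \<cdot> t" "t \<cdot> b' = b \<cdot> t" "s \<cdot> a'' = a' \<cdot> s" "s \<cdot> b'' = b' \<cdot> s"
    using A B by (simp_all only: a'_def b'_def a''_def b''_def mult_conj)
  have ts: "a'' = conj (t \<cdot> s) a" "b'' = conj (t \<cdot> s) b"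
    using A by (simp_all only: a''_def b''_def a'_def b'_def conj_conj)
  have ab: "a' \<cdot> b' = conj t (a \<cdot> b)" "a'' \<cdot> b'' = conj (t \<cdot> s) (a \<cdot> b)"
    using A by (simp_all only: ts a'_def b'_def conj_mult G.m_closed)
  have T: "psi (t \<cdot> s) a b \<otimes> \<alpha> a (t \<cdot> s) b'' = \<alpha> a b (t \<cdot> s) \<otimes> \<alpha> (t \<cdot> s) a'' b''"
    "\<theta> (a \<cdot> b) t s \<otimes> \<alpha> t (a' \<cdot> b') s = \<alpha> (a \<cdot> b) t s \<otimes> \<alpha> t s (a'' \<cdot> b'')"
    "psi s a' b' \<otimes> \<alpha> a' s b'' = \<alpha> a' b' s \<otimes> \<alpha> s a'' b''"
    "psi t a b \<otimes> \<alpha> a t b' = \<alpha> a b t \<otimes> \<alpha> t a' b'"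
    "\<theta> a t s \<otimes> \<alpha> t a' s = \<alpha> a t s \<otimes> \<alpha> t s a''"
    "\<theta> b t s \<otimes> \<alpha> t b' s = \<alpha> b t s \<otimes> \<alpha> t s b''"
    using psi_eq[OF _ A(3,4) ts] theta_eq[OF A(1,2) _ ab] psi_eq[OF A(2) B a''_def b''_def]
      psi_eq[OF A(1,3,4) a'_def b'_def] theta_eq[OF A(1,2,3) a'_def ts(1)]
      theta_eq[OF A(1,2,4) b'_def ts(2)] A
    by simp_all
  note P = alpha_pentagon[OF A(3,4,1,2), unfolded m] alpha_pentagon[OF A(3,1) B(2) A(2), unfolded m]
    alpha_pentagon[OF A(1) B A(2), unfolded m] alpha_pentagon[OF A(3,1,2) B''(2), unfolded m]
    alpha_pentagon[OF A(1) B(1) A(2) B''(2), unfolded m] alpha_pentagon[OF A(1,2) B'', unfolded m]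
  have "((psi (t \<cdot> s) a b \<otimes> \<alpha> a (t \<cdot> s) b'') \<otimes> (\<theta> (a \<cdot> b) t s \<otimes> \<alpha> t (a' \<cdot> b') s)) \<otimes>
      ((\<alpha> a' b' s \<otimes> \<alpha> s a'' b'') \<otimes> (\<alpha> a b t \<otimes> \<alpha> t a' b') \<otimes>
       (\<alpha> a t s \<otimes> \<alpha> t s a'') \<otimes> (\<alpha> b t s \<otimes> \<alpha> t s b'')) \<otimes>
      ((\<alpha> (a \<cdot> b) t s \<otimes> \<alpha> a b (t \<cdot> s)) \<otimes> (\<alpha> t b' s \<otimes> \<alpha> a (b \<cdot> t) s \<otimes> \<alpha> a t b') \<otimes>
       (\<alpha> (a \<cdot> t) b' s \<otimes> \<alpha> t a' (b' \<cdot> s)) \<otimes> (\<alpha> (a \<cdot> t) s b'' \<otimes> \<alpha> a t (b' \<cdot> s)) \<otimes>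
       (\<alpha> a' s b'' \<otimes> \<alpha> t (a' \<cdot> s) b'' \<otimes> \<alpha> t a' s) \<otimes> (\<alpha> (t \<cdot> s) a'' b'' \<otimes> \<alpha> t s (a'' \<cdot> b''))) =
    ((\<alpha> a b (t \<cdot> s) \<otimes> \<alpha> (t \<cdot> s) a'' b'') \<otimes> (\<alpha> (a \<cdot> b) t s \<otimes> \<alpha> t s (a'' \<cdot> b''))) \<otimes>
      ((psi s a' b' \<otimes> \<alpha> a' s b'') \<otimes> (psi t a b \<otimes> \<alpha> a t b') \<otimes>
       (\<theta> a t s \<otimes> \<alpha> t a' s) \<otimes> (\<theta> b t s \<otimes> \<alpha> t b' s)) \<otimes>
      ((\<alpha> b t s \<otimes> \<alpha> a (b \<cdot> t) s \<otimes> \<alpha> a b t) \<otimes> (\<alpha> (a \<cdot> t) b' s \<otimes> \<alpha> a t (b' \<cdot> s)) \<otimes>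
       (\<alpha> a' b' s \<otimes> \<alpha> t (a' \<cdot> b') s \<otimes> \<alpha> t a' b') \<otimes> (\<alpha> t s b'' \<otimes> \<alpha> a (t \<cdot> s) b'' \<otimes> \<alpha> a t s) \<otimes>
       (\<alpha> (a \<cdot> t) s b'' \<otimes> \<alpha> t a' (b' \<cdot> s)) \<otimes> (\<alpha> s a'' b'' \<otimes> \<alpha> t (a' \<cdot> s) b'' \<otimes> \<alpha> t s a''))"
    by (simp only: T P)
  then have "psi s a' b' \<otimes> psi t a b \<otimes> \<theta> a t s \<otimes> \<theta> b t s = psi (t \<cdot> s) a b \<otimes> \<theta> (a \<cdot> b) t s"
    by (rule cancel_equal_factors) (use A B B'' in \<open>simp_all\<close>, simp_all add: m_ac)
  then show ?thesis by (simp add: a'_def b'_def)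
qed

section \<open>Arrows of the inertia groupoid\<close>

abbreviation obs where "obs \<equiv> inertia_obs G K \<alpha>"
abbreviation ars where "ars \<equiv> inertia_ars G K \<alpha>"

lemma quotient_eq_quotient_iff:
  assumes "a \<in> Units K" "b \<in> Units K" "c \<in> Units K" "d \<in> Units K" "p \<in> Units K"
  shows "quotient K a b = quotient K c d \<otimes> p \<longleftrightarrow> a \<otimes> d = b \<otimes> (c \<otimes> p)"
proof -
  note u = assms assms[THEN Units_closed]
  have "quotient K a b = quotient K c d \<otimes> p \<longleftrightarrow> a = (quotient K c d \<otimes> p) \<otimes> b"
    using u by (intro quotient_eq_iff) simp_all
  also have "(quotient K c d \<otimes> p) \<otimes> b = quotient K (b \<otimes> (c \<otimes> p)) d"
    using u by (simp add: m_ac)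
  also have "a = \<dots> \<longleftrightarrow> quotient K (b \<otimes> (c \<otimes> p)) d = a" by auto
  also have "\<dots> \<longleftrightarrow> b \<otimes> (c \<otimes> p) = a \<otimes> d"
    using u by (intro quotient_eq_iff) simp_all
  finally show ?thesis by auto
qed

lemma obs_iff:
  "X \<in> obs \<longleftrightarrow> fst X \<in> carrier G \<and> (\<forall>m n. snd X m n \<in> Units K) \<and>
    (\<forall>l m n. snd X (l + m) n \<otimes> snd X l m =
      \<alpha> (fst X [^]\<^bsub>G\<^esub> l) (fst X [^]\<^bsub>G\<^esub> m) (fst X [^]\<^bsub>G\<^esub> n) \<otimes> (snd X l (m + n) \<otimes> snd X m n))"
proof -
  obtain g \<gamma> where X: "X = (g, \<gamma>)" by (cases X)
  have "quotient K (\<gamma> (l + m) n \<otimes> \<gamma> l m) (\<gamma> l (m + n) \<otimes> \<gamma> m n) = \<alpha> (g [^]\<^bsub>G\<^esub> l) (g [^]\<^bsub>G\<^esub> m) (g [^]\<^bsub>G\<^esub> n) \<longleftrightarrow>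
      \<gamma> (l + m) n \<otimes> \<gamma> l m = \<alpha> (g [^]\<^bsub>G\<^esub> l) (g [^]\<^bsub>G\<^esub> m) (g [^]\<^bsub>G\<^esub> n) \<otimes> (\<gamma> l (m + n) \<otimes> \<gamma> m n)"
    if "g \<in> carrier G" "\<And>m n. \<gamma> m n \<in> Units K" for l m n
    using that by (intro quotient_eq_iff) (simp_all add: Units_closed)
  then show ?thesis by (auto simp: X inertia_obs_def)
qed

lemma obsD:
  assumes "X \<in> obs"
  shows obs_fst: "fst X \<in> carrier G" and obs_unit: "snd X m n \<in> Units K" and obs_closed: "snd X m n \<in> carrier K"
  using assms by (simp_all add: obs_iff Units_closed)

text \<open>The working form of the hom-sets: no division, and the source together with all its
  powers is expressed by conjugating the target, which is the form in which \<open>psi\<close> and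
  \<theta> take their arguments.\<close>

lemma ars_iff:
  assumes X: "X \<in> obs" and Y: "Y \<in> obs"
  shows "u \<in> ars X Y \<longleftrightarrow> fst u \<in> carrier G \<and> fst X = conj (fst u) (fst Y) \<and> (\<forall>n. snd u n \<in> Units K) \<and>
    (\<forall>m n. snd u n \<otimes> snd u m \<otimes> snd Y m n =
      snd u (m + n) \<otimes> (snd X m n \<otimes> psi (fst u) (fst Y [^]\<^bsub>G\<^esub> m) (fst Y [^]\<^bsub>G\<^esub> n)))"
proof -
  obtain g \<gamma> f \<phi> s \<eta> where XYu: "X = (g, \<gamma>)" "Y = (f, \<phi>)" "u = (s, \<eta>)"
    by (cases X; cases Y; cases u)
  have gf: "g \<in> carrier G" "f \<in> carrier G" and U: "\<gamma> m n \<in> Units K" "\<phi> m n \<in> Units K" for m n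
    using obsD[OF X] obsD[OF Y] by (simp_all add: XYu)
  have "quotient K (\<eta> n \<otimes> \<eta> m) (\<eta> (m + n)) = quotient K (\<gamma> m n) (\<phi> m n) \<otimes>
        quotient K (\<alpha> (f [^]\<^bsub>G\<^esub> m) (f [^]\<^bsub>G\<^esub> n) s \<otimes> \<alpha> s (g [^]\<^bsub>G\<^esub> m) (g [^]\<^bsub>G\<^esub> n))
          (\<alpha> (f [^]\<^bsub>G\<^esub> m) s (g [^]\<^bsub>G\<^esub> n)) \<longleftrightarrow>
      \<eta> n \<otimes> \<eta> m \<otimes> \<phi> m n = \<eta> (m + n) \<otimes> (\<gamma> m n \<otimes> psi s (f [^]\<^bsub>G\<^esub> m) (f [^]\<^bsub>G\<^esub> n))"
    if "s \<in> carrier G" "g = conj s f" "\<And>n. \<eta> n \<in> Units K" for m n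
  proof -
    have "quotient K (\<alpha> (f [^]\<^bsub>G\<^esub> m) (f [^]\<^bsub>G\<^esub> n) s \<otimes> \<alpha> s (g [^]\<^bsub>G\<^esub> m) (g [^]\<^bsub>G\<^esub> n))
          (\<alpha> (f [^]\<^bsub>G\<^esub> m) s (g [^]\<^bsub>G\<^esub> n)) = psi s (f [^]\<^bsub>G\<^esub> m) (f [^]\<^bsub>G\<^esub> n)"
      using that(1) gf by (simp add: that(2) psi_def conj_int_pow)
    then show ?thesis using that U gf by (simp add: quotient_eq_quotient_iff)
  qed
  moreover have "s \<cdot> g \<cdot> inv\<^bsub>G\<^esub> s = f \<longleftrightarrow> g = conj s f" if "s \<in> carrier G"
    using conj_eq_iff[OF that gf(2,1)] .
  ultimately show ?thesis by (auto simp: XYu inertia_ars_def)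
qed

lemma arsD:
  assumes "u \<in> ars X Y" "X \<in> obs" "Y \<in> obs"
  shows ars_fst: "fst u \<in> carrier G" and ars_source: "fst X = conj (fst u) (fst Y)"
    and ars_unit: "snd u n \<in> Units K" and ars_closed: "snd u n \<in> carrier K"
    and ars_eq: "snd u n \<otimes> snd u m \<otimes> snd Y m n =
      snd u (m + n) \<otimes> (snd X m n \<otimes> psi (fst u) (fst Y [^]\<^bsub>G\<^esub> m) (fst Y [^]\<^bsub>G\<^esub> n))"
  using assms(1) by (auto simp: ars_iff[OF assms(2,3)] Units_closed)

text \<open>The \<alpha>-factor of a composite is a value of \<theta> at every n, not only at 1,
  with the n-th power of the last object's element in place of the element itself: the powers of the
  two other elements are conjugates of it.\<close>

lemma inertia_comp_eq:
  assumes "X \<in> obs" "Y \<in> obs" "Z \<in> obs" "u \<in> ars X Y" "v \<in> ars Y Z"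
  shows "inertia_comp G K \<alpha> X Y Z v u =
    (fst v \<cdot> fst u, \<lambda>n. snd u n \<otimes> snd v n \<otimes> \<theta> (fst Z [^]\<^bsub>G\<^esub> n) (fst v) (fst u))"
proof -
  note c = obs_fst[OF assms(1)] obs_fst[OF assms(2)] obs_fst[OF assms(3)]
    ars_fst[OF assms(4,1,2)] ars_fst[OF assms(5,2,3)]
  have "fst Y [^]\<^bsub>G\<^esub> n = conj (fst v) (fst Z [^]\<^bsub>G\<^esub> n)"
    "fst X [^]\<^bsub>G\<^esub> n = conj (fst v \<cdot> fst u) (fst Z [^]\<^bsub>G\<^esub> n)" for n :: int
    using c by (simp_all only: ars_source[OF assms(4,1,2)] ars_source[OF assms(5,2,3)] conj_int_pow
        conj_conj G.m_closed G.inv_closed G.int_pow_closed)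
  then show ?thesis
    using c by (simp add: inertia_comp_def case_prod_beta double_theta_def m_comm)
qed

text \<open>The product of the equations of \<open>u\<close> and \<open>v\<close> contains the
  values of \<open>psi s\<close> and \<open>psi t\<close>. The identity \<open>psi_theta\<close>
  exchanges them for \<open>psi (t \<cdot> s)\<close>, at the price of precisely the
  \<theta>-factors that occur in the composite.\<close>

lemma inertia_comp_in:
  assumes "X \<in> obs" "Y \<in> obs" "Z \<in> obs" "u \<in> ars X Y" "v \<in> ars Y Z"
  shows "inertia_comp G K \<alpha> X Y Z v u \<in> ars X Z"
proof -
  define s t k where "s = fst u" and "t = fst v" and "k = fst Z"
  note c = obs_fst[OF assms(1)] obs_fst[OF assms(2)] obs_fst[OF assms(3), folded k_def]
    ars_fst[OF assms(4,1,2), folded s_def] ars_fst[OF assms(5,2,3), folded t_def]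
  note U = ars_unit[OF assms(4,1,2)] ars_unit[OF assms(5,2,3)] obs_unit[OF assms(1)] obs_unit[OF assms(2)] obs_unit[OF assms(3)]
  note U' = U[THEN Units_closed]
  have Yk: "fst Y = conj t k" and Xs: "fst X = conj s (fst Y)"
    using ars_source[OF assms(5,2,3)] ars_source[OF assms(4,1,2)] by (simp_all add: s_def t_def k_def)
  have Y: "fst Y [^]\<^bsub>G\<^esub> n = conj t (k [^]\<^bsub>G\<^esub> n)" for n :: int
    unfolding Yk using c by (simp only: conj_int_pow)
  have X: "fst X = conj (t \<cdot> s) k"
    unfolding Xs Yk using c by (simp only: conj_conj)
  have "snd u n \<otimes> snd v n \<otimes> \<theta> (k [^]\<^bsub>G\<^esub> n) t s \<otimes> (snd u m \<otimes> snd v m \<otimes> \<theta> (k [^]\<^bsub>G\<^esub> m) t s) \<otimes> snd Z m n =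
      snd u (m + n) \<otimes> snd v (m + n) \<otimes> \<theta> (k [^]\<^bsub>G\<^esub> (m + n)) t s \<otimes>
        (snd X m n \<otimes> psi (t \<cdot> s) (k [^]\<^bsub>G\<^esub> m) (k [^]\<^bsub>G\<^esub> n))" for m n
  proof -
    let ?a = "k [^]\<^bsub>G\<^esub> m" and ?b = "k [^]\<^bsub>G\<^esub> n"
    have k: "?a \<in> carrier G" "?b \<in> carrier G" "k [^]\<^bsub>G\<^esub> (m + n) = ?a \<cdot> ?b" "fst Y [^]\<^bsub>G\<^esub> m \<in> carrier G" "fst Y [^]\<^bsub>G\<^esub> n \<in> carrier G"
      using c by (simp_all add: G.int_pow_mult)
    have "(snd u (m + n) \<otimes> (snd X m n \<otimes> psi s (fst Y [^]\<^bsub>G\<^esub> m) (fst Y [^]\<^bsub>G\<^esub> n))) \<otimes>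
        (snd v (m + n) \<otimes> (snd Y m n \<otimes> psi t ?a ?b)) \<otimes>
        (psi (t \<cdot> s) ?a ?b \<otimes> \<theta> (?a \<cdot> ?b) t s) =
      (snd u n \<otimes> snd u m \<otimes> snd Y m n) \<otimes> (snd v n \<otimes> snd v m \<otimes> snd Z m n) \<otimes>
        (psi s (fst Y [^]\<^bsub>G\<^esub> m) (fst Y [^]\<^bsub>G\<^esub> n) \<otimes> psi t ?a ?b \<otimes> \<theta> ?a t s \<otimes> \<theta> ?b t s)"
      using ars_eq[OF assms(4,1,2), of n m, folded s_def] ars_eq[OF assms(5,2,3), of n m, folded t_def k_def]
        psi_theta[OF c(5,4) k(1,2)]
      by (simp only: Y)
    then show ?thesis
      unfolding k(3)
      by (rule cancel_equal_factors) (use c k U U' in \<open>simp_all\<close>, simp_all add: m_ac)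
  qed
  then show ?thesis
    using c U X by (simp add: inertia_comp_eq[OF assms] ars_iff[OF assms(1,3)] s_def t_def k_def)
qed

lemma inertia_id_in: "X \<in> obs \<Longrightarrow> (e, \<lambda>_. \<one>) \<in> ars X X"
  by (simp add: ars_iff obsD psi_one)

lemma category_inertia_groupoid: "category (inertia_groupoid G K \<alpha>)"
proof
  fix W X Y Z u v w
  assume "W \<in> Ob (inertia_groupoid G K \<alpha>)" "X \<in> Ob (inertia_groupoid G K \<alpha>)"
    "Y \<in> Ob (inertia_groupoid G K \<alpha>)" "Z \<in> Ob (inertia_groupoid G K \<alpha>)"
    and "u \<in> Hom (inertia_groupoid G K \<alpha>) W X" "v \<in> Hom (inertia_groupoid G K \<alpha>) X Y"
    "w \<in> Hom (inertia_groupoid G K \<alpha>) Y Z"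
  then have o: "W \<in> obs" "X \<in> obs" "Y \<in> obs" "Z \<in> obs"
    and a: "u \<in> ars W X" "v \<in> ars X Y" "w \<in> ars Y Z"
    by (simp_all add: inertia_groupoid_def)
  define s t r k where "s = fst u" and "t = fst v" and "r = fst w" and "k = fst Z"
  note c = obs_fst[OF o(3)] obs_fst[OF o(4), folded k_def]
    ars_fst[OF a(1) o(1,2), folded s_def] ars_fst[OF a(2) o(2,3), folded t_def]
    ars_fst[OF a(3) o(3,4), folded r_def]
  have Y: "fst Y [^]\<^bsub>G\<^esub> n = conj r (k [^]\<^bsub>G\<^esub> n)" for n :: int
    unfolding ars_source[OF a(3) o(3,4), folded r_def k_def] using c by (simp only: conj_int_pow)
  \<comment> \<open>Associativity at n is the cocycle identity of \<theta> at the n-th power of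
    \<open>k\<close>.\<close>
  have "snd u n \<otimes> snd v n \<otimes> \<theta> (fst Y [^]\<^bsub>G\<^esub> n) t s \<otimes> snd w n \<otimes> \<theta> (k [^]\<^bsub>G\<^esub> n) r (t \<cdot> s) =
      snd u n \<otimes> (snd v n \<otimes> snd w n \<otimes> \<theta> (k [^]\<^bsub>G\<^esub> n) r t) \<otimes> \<theta> (k [^]\<^bsub>G\<^esub> n) (r \<cdot> t) s" for n
  proof -
    have k: "k [^]\<^bsub>G\<^esub> n \<in> carrier G" "fst Y [^]\<^bsub>G\<^esub> n \<in> carrier G" using c by simp_all
    note cl = ars_closed[OF a(1) o(1,2)] ars_closed[OF a(2) o(2,3)] ars_closed[OF a(3) o(3,4)]
    have "snd u n \<otimes> snd v n \<otimes> \<theta> (fst Y [^]\<^bsub>G\<^esub> n) t s \<otimes> snd w n \<otimes> \<theta> (k [^]\<^bsub>G\<^esub> n) r (t \<cdot> s) =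
        snd u n \<otimes> snd v n \<otimes> snd w n \<otimes> (\<theta> (k [^]\<^bsub>G\<^esub> n) r (t \<cdot> s) \<otimes> \<theta> (fst Y [^]\<^bsub>G\<^esub> n) t s)"
      using c k cl by (simp add: m_ac)
    also have "\<dots> = snd u n \<otimes> snd v n \<otimes> snd w n \<otimes> (\<theta> (k [^]\<^bsub>G\<^esub> n) r t \<otimes> \<theta> (k [^]\<^bsub>G\<^esub> n) (r \<cdot> t) s)"
      by (simp only: Y theta_cocycle[OF k(1) c(5,4,3)])
    finally show ?thesis using c k cl by (simp add: m_ac)
  qed
  moreover have "inertia_comp G K \<alpha> W Y Z w (inertia_comp G K \<alpha> W X Y v u) =
      (r \<cdot> (t \<cdot> s), \<lambda>n. snd u n \<otimes> snd v n \<otimes> \<theta> (fst Y [^]\<^bsub>G\<^esub> n) t s \<otimes> snd w n \<otimes> \<theta> (k [^]\<^bsub>G\<^esub> n) r (t \<cdot> s))"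
    using inertia_comp_in[OF o(1-3) a(1,2)] o a
    by (simp add: inertia_comp_eq s_def t_def r_def k_def)
  moreover have "inertia_comp G K \<alpha> W X Z (inertia_comp G K \<alpha> X Y Z w v) u =
      (r \<cdot> t \<cdot> s, \<lambda>n. snd u n \<otimes> (snd v n \<otimes> snd w n \<otimes> \<theta> (k [^]\<^bsub>G\<^esub> n) r t) \<otimes> \<theta> (k [^]\<^bsub>G\<^esub> n) (r \<cdot> t) s)"
    using inertia_comp_in[OF o(2-4) a(2,3)] o a
    by (simp add: inertia_comp_eq s_def t_def r_def k_def)
  ultimately show "Comp (inertia_groupoid G K \<alpha>) W Y Z w (Comp (inertia_groupoid G K \<alpha>) W X Y v u) =
      Comp (inertia_groupoid G K \<alpha>) W X Z (Comp (inertia_groupoid G K \<alpha>) X Y Z w v) u"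
    using c by (simp add: inertia_groupoid_def G.m_assoc)
next
  fix X Y u assume "X \<in> Ob (inertia_groupoid G K \<alpha>)" "Y \<in> Ob (inertia_groupoid G K \<alpha>)"
    "u \<in> Hom (inertia_groupoid G K \<alpha>) X Y"
  then have XY: "X \<in> obs" "Y \<in> obs" and u: "u \<in> ars X Y" by (simp_all add: inertia_groupoid_def)
  show "Comp (inertia_groupoid G K \<alpha>) X X Y u (Id (inertia_groupoid G K \<alpha>) X) = u"
    "Comp (inertia_groupoid G K \<alpha>) X Y Y (Id (inertia_groupoid G K \<alpha>) Y) u = u"
    using inertia_id_in[OF XY(1)] inertia_id_in[OF XY(2)] XY u arsD[OF u XY] obs_fst[OF XY(2)]
    by (simp_all add: inertia_groupoid_def inertia_comp_eq theta_one)
qed (auto simp: inertia_groupoid_def inertia_comp_in inertia_id_in)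

section \<open>Existence of objects; existence and uniqueness of arrows\<close>

lemma inertia_ob_exists:
  assumes g: "g \<in> carrier G"
  shows "\<exists>\<gamma>. (g, \<gamma>) \<in> obs"
proof -
  interpret U: comm_group "units_of K" by (rule units_comm_group)
  have c: "g [^]\<^bsub>G\<^esub> n \<in> carrier G" for n :: int using g by simp
  define a where "a l m n = \<alpha> (g [^]\<^bsub>G\<^esub> l) (g [^]\<^bsub>G\<^esub> m) (g [^]\<^bsub>G\<^esub> n)" for l m n :: int
  have "\<exists>\<gamma>. (\<forall>m n. \<gamma> m n \<in> Units K) \<and>
      (\<forall>l m n. \<gamma> (l + m) n \<otimes> \<gamma> l m = a l m n \<otimes> (\<gamma> l (m + n) \<otimes> \<gamma> m n))"
    \<comment> \<open>Along the powers of \<open>g\<close> the cocycle \<alpha> becomes a normalised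
      3-cocycle on the integers; the trivialisation is found in the unit group
      \<open>units_of K\<close>.\<close>
    by (rule U.int_3cocycle_trivial[of a, unfolded units_of_carrier units_of_mult units_of_one])
      (simp_all add: a_def G.int_pow_mult g alpha_pentagon)
  with g show ?thesis by (auto simp: obs_iff a_def)
qed

text \<open>Brings the arrow equation into the shape in which \<eta> has a given 2-cochain as
  coboundary, as the lemmas on integer cochains require.\<close>

lemma ars_coefficient:
  assumes X: "X \<in> obs" and Y: "Y \<in> obs" and s: "s \<in> carrier G" "fst X = conj s (fst Y)"
  shows "(s, \<eta>) \<in> ars X Y \<longleftrightarrow> (\<forall>n. \<eta> n \<in> Units K) \<and> (\<forall>m n. \<eta> n \<otimes> \<eta> m =
    \<eta> (m + n) \<otimes> quotient K (snd X m n \<otimes> psi s (fst Y [^]\<^bsub>G\<^esub> m) (fst Y [^]\<^bsub>G\<^esub> n)) (snd Y m n))"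
proof -
  have "\<eta> n \<otimes> \<eta> m \<otimes> snd Y m n =
        \<eta> (m + n) \<otimes> (snd X m n \<otimes> psi s (fst Y [^]\<^bsub>G\<^esub> m) (fst Y [^]\<^bsub>G\<^esub> n)) \<longleftrightarrow>
      \<eta> n \<otimes> \<eta> m = \<eta> (m + n) \<otimes> quotient K (snd X m n \<otimes> psi s (fst Y [^]\<^bsub>G\<^esub> m) (fst Y [^]\<^bsub>G\<^esub> n)) (snd Y m n)"
    if "\<And>n. \<eta> n \<in> Units K" for m n
    using quotient_eq_iff[of "\<eta> (m + n) \<otimes> (snd X m n \<otimes> psi s (fst Y [^]\<^bsub>G\<^esub> m) (fst Y [^]\<^bsub>G\<^esub> n))" "snd Y m n" "\<eta> n \<otimes> \<eta> m"]
      that obsD[OF X] obsD[OF Y] s(1) by (auto simp: m_assoc Units_closed)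
  then show ?thesis using s by (auto simp: ars_iff[OF X Y])
qed

lemma ars_unique:
  assumes "X \<in> obs" "Y \<in> obs" "u \<in> ars X Y" "v \<in> ars X Y" "fst u = fst v" "snd u 1 = snd v 1"
  shows "u = v"
proof -
  interpret U: comm_group "units_of K" by (rule units_comm_group)
  obtain s \<eta> \<eta>' where uv: "u = (s, \<eta>)" "v = (s, \<eta>')" using assms(5) by (cases u; cases v) auto
  note s = ars_fst[OF assms(3,1,2)] ars_source[OF assms(3,1,2)]
  have "\<eta> = \<eta>'"
    using assms(3,4,6) s unfolding uv
    by (intro U.int_1cochain_unique[where c = "\<lambda>m n. quotient K (snd X m n \<otimes> psi s (fst Y [^]\<^bsub>G\<^esub> m) (fst Y [^]\<^bsub>G\<^esub> n)) (snd Y m n)"])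
      (simp_all add: ars_coefficient[OF assms(1,2)] units_of_carrier units_of_mult uv
        obs_unit[OF assms(1)] obs_unit[OF assms(2)] obs_fst[OF assms(2)])
  then show ?thesis by (simp add: uv)
qed

text \<open>The 2-cochain that \<eta> has to trivialise is \<gamma> times \<open>psi s\<close>
  divided by \<phi>. The coboundaries of \<gamma> and \<phi> are \<alpha> along the powers of the
  source and of the target, and by \<open>psi_cocycle\<close> the coboundary of \<open>psi s\<close>
  compensates their difference. So it is a 2-cocycle on the integers, hence trivial with any
  prescribed value \<eta>(1).\<close>

lemma ars_exists:
  assumes X: "X \<in> obs" and Y: "Y \<in> obs" and s: "s \<in> carrier G" "fst X = conj s (fst Y)" and a: "a \<in> Units K"
  shows "\<exists>\<eta>. (s, \<eta>) \<in> ars X Y \<and> \<eta> 1 = a"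
proof -
  interpret U: comm_group "units_of K" by (rule units_comm_group)
  define p where "p m n = psi s (fst Y [^]\<^bsub>G\<^esub> m) (fst Y [^]\<^bsub>G\<^esub> n)" for m n :: int
  define c where "c m n = quotient K (snd X m n \<otimes> p m n) (snd Y m n)" for m n
  have p: "p m n \<in> Units K" for m n by (simp add: p_def s obs_fst[OF Y])
  note U = obs_unit[OF X] obs_unit[OF Y] p
  note U' = U[THEN Units_closed]
  have c: "c m n \<in> Units K" and c_eq: "c m n \<otimes> snd Y m n = snd X m n \<otimes> p m n" for m n
    using U U' by (simp_all add: c_def m_assoc)
  have "c m n \<otimes> c (m + n) l = c m (n + l) \<otimes> c n l" for m n l
  proof -
    define x y where "x = \<alpha> (fst X [^]\<^bsub>G\<^esub> m) (fst X [^]\<^bsub>G\<^esub> n) (fst X [^]\<^bsub>G\<^esub> l)"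
      and "y = \<alpha> (fst Y [^]\<^bsub>G\<^esub> m) (fst Y [^]\<^bsub>G\<^esub> n) (fst Y [^]\<^bsub>G\<^esub> l)"
    have f: "fst Y [^]\<^bsub>G\<^esub> i \<in> carrier G" and g: "fst X [^]\<^bsub>G\<^esub> i = conj s (fst Y [^]\<^bsub>G\<^esub> i)" for i :: int
      using s obs_fst[OF Y] by (simp_all only: G.int_pow_closed conj_int_pow)
    have xy: "x \<in> Units K" "y \<in> Units K"
      using obs_fst[OF X] f by (simp_all add: x_def y_def)
    have 1: "snd X (m + n) l \<otimes> snd X m n = x \<otimes> (snd X m (n + l) \<otimes> snd X n l)"
      "snd Y (m + n) l \<otimes> snd Y m n = y \<otimes> (snd Y m (n + l) \<otimes> snd Y n l)"
      using X Y by (simp_all add: obs_iff x_def y_def)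
    have 2: "p m n \<otimes> p (m + n) l \<otimes> x = p m (n + l) \<otimes> p n l \<otimes> y"
      using psi_cocycle[OF s(1) f f f, of m n l] obs_fst[OF Y]
      by (simp add: p_def x_def y_def g G.int_pow_mult)
    have "(c m n \<otimes> snd Y m n) \<otimes> (c (m + n) l \<otimes> snd Y (m + n) l) \<otimes>
        (snd X m (n + l) \<otimes> p m (n + l)) \<otimes> (snd X n l \<otimes> p n l) \<otimes>
        (y \<otimes> (snd Y m (n + l) \<otimes> snd Y n l)) \<otimes> (snd X (m + n) l \<otimes> snd X m n) \<otimes>
        (p m n \<otimes> p (m + n) l \<otimes> x) =
      (snd X m n \<otimes> p m n) \<otimes> (snd X (m + n) l \<otimes> p (m + n) l) \<otimes>
        (c m (n + l) \<otimes> snd Y m (n + l)) \<otimes> (c n l \<otimes> snd Y n l) \<otimes>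
        (snd Y (m + n) l \<otimes> snd Y m n) \<otimes> (x \<otimes> (snd X m (n + l) \<otimes> snd X n l)) \<otimes>
        (p m (n + l) \<otimes> p n l \<otimes> y)"
      by (simp only: c_eq 1 2)
    then have "c m (n + l) \<otimes> c n l = c m n \<otimes> c (m + n) l"
      by (rule cancel_equal_factors)
        (use xy c U U' xy[THEN Units_closed] c[THEN Units_closed] in \<open>simp_all\<close>, simp_all add: m_ac)
    then show ?thesis ..
  qed
  then have "\<exists>\<eta>. (\<forall>n. \<eta> n \<in> Units K) \<and> \<eta> 1 = a \<and> (\<forall>m n. \<eta> n \<otimes> \<eta> m = \<eta> (m + n) \<otimes> c m n)"
    by (intro U.int_2cocycle_trivial[of c a, unfolded units_of_carrier units_of_mult] c a)
  then show ?thesis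
    by (auto simp: ars_coefficient[OF X Y s] c_def p_def)
qed

text \<open>Coordinates on the hom-sets: an arrow is named by its group element and its value at 1.
  The choice is immaterial by \<open>ars_unique\<close>.\<close>

definition arrow where
  "arrow X Y s a = (s, SOME \<eta>. (s, \<eta>) \<in> ars X Y \<and> \<eta> 1 = a)"

lemma arrow_in:
  assumes "X \<in> obs" "Y \<in> obs" "s \<in> carrier G" "fst X = conj s (fst Y)" "a \<in> Units K"
  shows "arrow X Y s a \<in> ars X Y" and "fst (arrow X Y s a) = s" and "snd (arrow X Y s a) 1 = a"
  using someI_ex[OF ars_exists[OF assms]] by (simp_all add: arrow_def)

lemma arrow_eqI:
  assumes "X \<in> obs" "Y \<in> obs" "u \<in> ars X Y" "fst u = s" "snd u 1 = a"
  shows "u = arrow X Y s a"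
  using assms ars_fst[OF assms(3,1,2)] ars_source[OF assms(3,1,2)] ars_unit[OF assms(3,1,2)]
  by (intro ars_unique[OF assms(1-3)]) (auto simp: arrow_in)

text \<open>In these coordinates composition is the product rule for multiples of basis elements of
  the double; compare \<open>basis_elem_mult\<close>.\<close>

lemma arrow_comp:
  assumes "X \<in> obs" "Y \<in> obs" "Z \<in> obs" "s \<in> carrier G" "fst X = conj s (fst Y)" "a \<in> Units K"
    and "t \<in> carrier G" "fst Y = conj t (fst Z)" "b \<in> Units K"
  shows "inertia_comp G K \<alpha> X Y Z (arrow Y Z t b) (arrow X Y s a) = arrow X Z (t \<cdot> s) (a \<otimes> b \<otimes> \<theta> (fst Z) t s)"
proof -
  note i = arrow_in[OF assms(1,2,4-6)] arrow_in[OF assms(2,3,7-9)]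
  show ?thesis
    by (intro arrow_eqI assms inertia_comp_in[where Y = Y] i)
      (simp_all add: inertia_comp_eq[OF assms(1-3) i(1,4)] i(2,3,5,6) obs_fst[OF assms(3)])
qed

lemma arrow_id: "X \<in> obs \<Longrightarrow> (e, \<lambda>_. \<one>) = arrow X X e \<one>"
  by (rule arrow_eqI) (simp_all add: inertia_id_in)

section \<open>The central action in terms of values at 1\<close>

lemma units_int_pow: "a \<in> Units K \<Longrightarrow> a [^]\<^bsub>units_of K\<^esub> n = a [^] (n :: int)"
proof -
  assume a: "a \<in> Units K"
  interpret U: comm_group "units_of K" by (rule units_comm_group)
  have "a [^]\<^bsub>units_of K\<^esub> k \<in> Units K" for k :: nat
    using U.nat_pow_closed[of a k] a by (simp add: units_of_carrier)
  then show ?thesis using a by (simp only: int_pow_def2 units_of_pow units_of_inv split: if_split)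
qed

text \<open>The power map of \<open>a\<close> is a homomorphism from the integers, so multiplying
  \<eta> by it leaves its coboundary unchanged.\<close>

lemma central_action_in:
  assumes "X \<in> obs" "Y \<in> obs" "u \<in> ars X Y" "a \<in> Units K"
  shows "central_action K a u \<in> ars X Y"
proof -
  interpret U: comm_group "units_of K" by (rule units_comm_group)
  have a: "a [^] n \<in> Units K" and a_add: "a [^] (m + n) = a [^] m \<otimes> a [^] n" for m n :: int
    using U.int_pow_closed[of a n] U.int_pow_mult[of a m n] assms(4)
    by (simp_all add: units_int_pow units_of_carrier units_of_mult)
  note a' = a[THEN Units_closed]
  note cl = obs_closed[OF assms(1)] obs_closed[OF assms(2)] obs_fst[OF assms(2)] ars_fst[OF assms(3,1,2)]
    ars_closed[OF assms(3,1,2)]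
  have "a [^] n \<otimes> snd u n \<otimes> (a [^] m \<otimes> snd u m) \<otimes> snd Y m n =
      a [^] (m + n) \<otimes> snd u (m + n) \<otimes> (snd X m n \<otimes> psi (fst u) (fst Y [^]\<^bsub>G\<^esub> m) (fst Y [^]\<^bsub>G\<^esub> n))" for m n :: int
  proof -
    have "a [^] n \<otimes> snd u n \<otimes> (a [^] m \<otimes> snd u m) \<otimes> snd Y m n =
        a [^] n \<otimes> a [^] m \<otimes> (snd u n \<otimes> snd u m \<otimes> snd Y m n)"
      using cl a' by (simp add: m_ac)
    then show ?thesis unfolding ars_eq[OF assms(3,1,2)] using cl a' by (simp add: a_add m_ac)
  qed
  then show ?thesis
    using arsD[OF assms(3,1,2)] a by (simp add: ars_iff[OF assms(1,2)] central_action_def case_prod_beta)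
qed

lemma central_action_one: "a \<in> Units K \<Longrightarrow> snd (central_action K a u) 1 = a \<otimes> snd u 1"
  by (simp add: central_action_def case_prod_beta int_pow_def2 Units_closed)

lemma central_action_arrow:
  assumes "X \<in> obs" "Y \<in> obs" "s \<in> carrier G" "fst X = conj s (fst Y)" "a \<in> Units K" "b \<in> Units K"
  shows "central_action K b (arrow X Y s a) = arrow X Y s (b \<otimes> a)"
  using arrow_in[OF assms(1-5)] assms
  by (intro arrow_eqI) (simp_all add: central_action_in central_action_one, simp add: central_action_def case_prod_beta)

section \<open>The twisted double is a ring\<close>

abbreviation D where "D \<equiv> twisted_double G K \<alpha>"
abbreviation B where "B \<equiv> carrier G \<times> carrier G"

lemma double_simps:
  "carrier D = B \<rightarrow>\<^sub>E carrier K"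
  "\<zero>\<^bsub>D\<^esub> = (\<lambda>p \<in> B. \<zero>)"
  "a \<oplus>\<^bsub>D\<^esub> b = (\<lambda>p \<in> B. a p \<oplus> b p)"
  "\<one>\<^bsub>D\<^esub> = (\<lambda>(g, x) \<in> B. if x = e then \<one> else \<zero>)"
  "a \<otimes>\<^bsub>D\<^esub> b = (\<lambda>p \<in> B. \<Oplus>q \<in> B. \<Oplus>r \<in> B. a q \<otimes> b r \<otimes> double_basis_mult G K \<alpha> q r p)"
  by (simp_all add: twisted_double_def Let_def)

lemma finite_B: "finite B"
  using finite_G by simp

text \<open>Read with the left factor and the output coordinate fixed, the product rule has at most
  one right factor that contributes. This collapses the double sum in the product.\<close>

lemma basis_mult_eq:
  assumes "g \<in> carrier G" "x \<in> carrier G" "h \<in> carrier G" "y \<in> carrier G" "z \<in> carrier G"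
  shows "double_basis_mult G K \<alpha> (f, x) (h, y) (g, z) =
    (if f = g \<and> (h, y) = (conj x g, inv\<^bsub>G\<^esub> x \<cdot> z) then \<theta> g x y else \<zero>)"
proof -
  have "z = x \<cdot> y \<longleftrightarrow> y = inv\<^bsub>G\<^esub> x \<cdot> z"
    using assms by (metis G.inv_solve_left)
  moreover have "g = x \<cdot> h \<cdot> inv\<^bsub>G\<^esub> x \<longleftrightarrow> h = conj x g"
    using conj_eq_iff[OF assms(2,1,3)] by auto
  ultimately show ?thesis by (auto simp: double_basis_mult_def)
qed

lemma basis_mult_closed:
  "p \<in> B \<Longrightarrow> q \<in> B \<Longrightarrow> r \<in> B \<Longrightarrow> double_basis_mult G K \<alpha> p q r \<in> carrier K"
  by (auto simp: double_basis_mult_def)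

lemma double_mult_closed: "a \<in> carrier D \<Longrightarrow> b \<in> carrier D \<Longrightarrow> a \<otimes>\<^bsub>D\<^esub> b \<in> carrier D"
  by (auto simp: double_simps PiE_mem basis_mult_closed intro!: finsum_closed m_closed)

text \<open>Only left factors with first index g contribute, and each determines its right factor.
  What remains is a sum over the factorisations of z, indexed by the first factor x.\<close>

lemma double_mult_apply:
  assumes a: "a \<in> carrier D" and b: "b \<in> carrier D" and gz: "g \<in> carrier G" "z \<in> carrier G"
  shows "(a \<otimes>\<^bsub>D\<^esub> b) (g, z) =
    (\<Oplus>x\<in>carrier G. a (g, x) \<otimes> b (conj x g, inv\<^bsub>G\<^esub> x \<cdot> z) \<otimes> \<theta> g x (inv\<^bsub>G\<^esub> x \<cdot> z))"
proof -
  define F where "F x = a (g, x) \<otimes> b (conj x g, inv\<^bsub>G\<^esub> x \<cdot> z) \<otimes> \<theta> g x (inv\<^bsub>G\<^esub> x \<cdot> z)" for x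
  have ab: "a (h, x) \<in> carrier K" "b (h, x) \<in> carrier K" if "h \<in> carrier G" "x \<in> carrier G" for h x
    using a b that by (auto simp: double_simps)
  have F: "F x \<in> carrier K" if "x \<in> carrier G" for x
    using that gz by (simp add: F_def ab)
  have inner: "(\<Oplus>r \<in> B. a q \<otimes> b r \<otimes> double_basis_mult G K \<alpha> q r (g, z)) = (if fst q = g then F (snd q) else \<zero>)"
    if "q \<in> B" for q
  proof -
    obtain f x where q: "q = (f, x)" by (cases q)
    have fx: "f \<in> carrier G" "x \<in> carrier G" using that by (auto simp: q)
    have "(\<Oplus>r \<in> B. a q \<otimes> b r \<otimes> double_basis_mult G K \<alpha> q r (g, z)) =
        a q \<otimes> b (conj x g, inv\<^bsub>G\<^esub> x \<cdot> z) \<otimes> double_basis_mult G K \<alpha> q (conj x g, inv\<^bsub>G\<^esub> x \<cdot> z) (g, z)"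
      using fx gz by (intro finsum_single) (auto simp: q finite_G basis_mult_eq ab split: if_splits)
    also have "\<dots> = (if fst q = g then F (snd q) else \<zero>)"
      using fx gz by (auto simp: q F_def basis_mult_eq ab)
    finally show ?thesis .
  qed
  have "(a \<otimes>\<^bsub>D\<^esub> b) (g, z) = (\<Oplus>q \<in> B. if fst q = g then F (snd q) else \<zero>)"
    using gz inner F by (auto simp: double_simps intro!: finsum_cong')
  also have "\<dots> = (\<Oplus>q \<in> (\<lambda>x. (g, x)) ` carrier G. F (snd q))"
    using gz F by (intro add.finprod_mono_neutral_cong_right finite_B) auto
  also have "\<dots> = (\<Oplus>x \<in> carrier G. F x)"
    using F by (subst finsum_reindex) (auto simp: inj_on_def)
  finally show ?thesis by (simp add: F_def)
qed

text \<open>A left translation permutes \<open>G\<close>. The substitution serves to index the inner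
  sum of an iterated product by the product of the first two factors instead of the second
  factor.\<close>

lemma finsum_translate:
  assumes "abelian_monoid M" and "x \<in> carrier G" and "F \<in> carrier G \<rightarrow> carrier M"
  shows "(\<Oplus>\<^bsub>M\<^esub>w\<in>carrier G. F w) = (\<Oplus>\<^bsub>M\<^esub>y\<in>carrier G. F (inv\<^bsub>G\<^esub> x \<cdot> y))"
proof -
  interpret M: abelian_monoid M by fact
  have im: "(\<lambda>y. inv\<^bsub>G\<^esub> x \<cdot> y) ` carrier G = carrier G"
    using assms(2) by (intro G.surj_const_mult) simp
  have "(\<Oplus>\<^bsub>M\<^esub>w\<in>(\<lambda>y. inv\<^bsub>G\<^esub> x \<cdot> y) ` carrier G. F w) = (\<Oplus>\<^bsub>M\<^esub>y\<in>carrier G. F (inv\<^bsub>G\<^esub> x \<cdot> y))"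
    using assms by (intro M.finsum_reindex) (simp_all add: im G.inj_on_cmult)
  then show ?thesis by (simp add: im)
qed

lemma double_eqI:
  assumes "a \<in> carrier D" "b \<in> carrier D"
    and "\<And>g z. g \<in> carrier G \<Longrightarrow> z \<in> carrier G \<Longrightarrow> a (g, z) = b (g, z)"
  shows "a = b"
  by (rule PiE_ext[of a B "\<lambda>_. carrier K"]) (use assms in \<open>auto simp: double_simps\<close>)

lemma double_apply_closed [simp]:
  "a \<in> carrier D \<Longrightarrow> g \<in> carrier G \<Longrightarrow> x \<in> carrier G \<Longrightarrow> a (g, x) \<in> carrier K"
  by (auto simp: double_simps)

lemma double_zero_apply: "g \<in> carrier G \<Longrightarrow> z \<in> carrier G \<Longrightarrow> \<zero>\<^bsub>D\<^esub> (g, z) = \<zero>"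
  and double_add_apply: "g \<in> carrier G \<Longrightarrow> z \<in> carrier G \<Longrightarrow> (a \<oplus>\<^bsub>D\<^esub> b) (g, z) = a (g, z) \<oplus> b (g, z)"
  and double_one_apply: "g \<in> carrier G \<Longrightarrow> z \<in> carrier G \<Longrightarrow> \<one>\<^bsub>D\<^esub> (g, z) = (if z = e then \<one> else \<zero>)"
  by (simp_all add: double_simps)

lemma double_closed:
  "\<zero>\<^bsub>D\<^esub> \<in> carrier D" "\<one>\<^bsub>D\<^esub> \<in> carrier D"
  "a \<in> carrier D \<Longrightarrow> b \<in> carrier D \<Longrightarrow> a \<oplus>\<^bsub>D\<^esub> b \<in> carrier D"
  by (auto simp: double_simps PiE_mem)

lemma abelian_group_double: "abelian_group D"
proof (rule abelian_groupI)
  fix a assume a: "a \<in> carrier D"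
  define b where "b = (\<lambda>p \<in> B. \<ominus> a p)"
  have b: "b \<in> carrier D" using a by (auto simp: b_def double_simps PiE_mem)
  show "\<exists>b \<in> carrier D. b \<oplus>\<^bsub>D\<^esub> a = \<zero>\<^bsub>D\<^esub>"
    using a b by (intro bexI[OF _ b] double_eqI)
      (simp_all add: double_closed double_add_apply double_zero_apply, simp add: b_def l_neg)
  show "\<zero>\<^bsub>D\<^esub> \<oplus>\<^bsub>D\<^esub> a = a"
    using a by (intro double_eqI) (simp_all add: double_closed double_add_apply double_zero_apply)
next
  fix a b c assume "a \<in> carrier D" "b \<in> carrier D" "c \<in> carrier D"
  then show "(a \<oplus>\<^bsub>D\<^esub> b) \<oplus>\<^bsub>D\<^esub> c = a \<oplus>\<^bsub>D\<^esub> (b \<oplus>\<^bsub>D\<^esub> c)"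
    by (intro double_eqI) (simp_all add: double_closed double_add_apply a_assoc)
next
  fix a b assume "a \<in> carrier D" "b \<in> carrier D"
  then show "a \<oplus>\<^bsub>D\<^esub> b = b \<oplus>\<^bsub>D\<^esub> a"
    by (intro double_eqI) (simp_all add: double_closed double_add_apply a_comm)
qed (simp_all add: double_closed)

text \<open>At (g, z) both sides become sums over x, the first factor, and y, the product of the
  first two. The left bracketing has these indices already, the right one after the substitution of
  x^{-1} y for the second factor. The summands then agree by \<open>theta_cocycle\<close> with
  middle argument x^{-1} y.\<close>

lemma double_assoc:
  assumes a: "a \<in> carrier D" and b: "b \<in> carrier D" and c: "c \<in> carrier D"
  shows "a \<otimes>\<^bsub>D\<^esub> b \<otimes>\<^bsub>D\<^esub> c = a \<otimes>\<^bsub>D\<^esub> (b \<otimes>\<^bsub>D\<^esub> c)"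
proof (rule double_eqI)
  fix g z assume gz: "g \<in> carrier G" "z \<in> carrier G"
  define F where "F x y = a (g, x) \<otimes> b (conj x g, inv\<^bsub>G\<^esub> x \<cdot> y) \<otimes> c (conj y g, inv\<^bsub>G\<^esub> y \<cdot> z) \<otimes>
      (\<theta> g x (inv\<^bsub>G\<^esub> x \<cdot> y) \<otimes> \<theta> g y (inv\<^bsub>G\<^esub> y \<cdot> z))" for x y
  have F: "F x y \<in> carrier K" if "x \<in> carrier G" "y \<in> carrier G" for x y
    using that gz a b c by (simp add: F_def)
  have "(a \<otimes>\<^bsub>D\<^esub> b \<otimes>\<^bsub>D\<^esub> c) (g, z) = (\<Oplus>y\<in>carrier G. \<Oplus>x\<in>carrier G. F x y)"
    unfolding double_mult_apply[OF double_mult_closed[OF a b] c gz]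
  proof (intro finsum_cong' refl)
    fix y assume y: "y \<in> carrier G"
    show "(a \<otimes>\<^bsub>D\<^esub> b) (g, y) \<otimes> c (conj y g, inv\<^bsub>G\<^esub> y \<cdot> z) \<otimes> \<theta> g y (inv\<^bsub>G\<^esub> y \<cdot> z) = (\<Oplus>x\<in>carrier G. F x y)"
      unfolding double_mult_apply[OF a b gz(1) y] using y gz a b c
      by (simp add: m_assoc[of _ "c _"] finsum_ldistr finite_G Pi_def)
        (auto intro!: finsum_cong' simp: F_def m_ac)
  qed (auto simp: F)
  also have "\<dots> = (\<Oplus>x\<in>carrier G. \<Oplus>y\<in>carrier G. F x y)"
    by (intro finsum_swap finite_G F)
  also have "\<dots> = (a \<otimes>\<^bsub>D\<^esub> (b \<otimes>\<^bsub>D\<^esub> c)) (g, z)"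
    unfolding double_mult_apply[OF a double_mult_closed[OF b c] gz]
  proof (intro finsum_cong' refl)
    fix x assume x: "x \<in> carrier G"
    let ?g = "conj x g" and ?z = "inv\<^bsub>G\<^esub> x \<cdot> z"
    have cl: "?g \<in> carrier G" "?z \<in> carrier G" using x gz by simp_all
    have "(b \<otimes>\<^bsub>D\<^esub> c) (?g, ?z) =
        (\<Oplus>w\<in>carrier G. b (?g, w) \<otimes> c (conj w ?g, inv\<^bsub>G\<^esub> w \<cdot> ?z) \<otimes> \<theta> ?g w (inv\<^bsub>G\<^esub> w \<cdot> ?z))"
      by (rule double_mult_apply[OF b c cl])
    also have "\<dots> = (\<Oplus>y\<in>carrier G. b (?g, inv\<^bsub>G\<^esub> x \<cdot> y) \<otimes> c (conj (inv\<^bsub>G\<^esub> x \<cdot> y) ?g, inv\<^bsub>G\<^esub> (inv\<^bsub>G\<^esub> x \<cdot> y) \<cdot> ?z) \<otimes>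
        \<theta> ?g (inv\<^bsub>G\<^esub> x \<cdot> y) (inv\<^bsub>G\<^esub> (inv\<^bsub>G\<^esub> x \<cdot> y) \<cdot> ?z))"
      using x cl b c by (intro finsum_translate) (auto intro: abelian_monoid_axioms)
    also have "\<dots> = (\<Oplus>y\<in>carrier G. b (?g, inv\<^bsub>G\<^esub> x \<cdot> y) \<otimes> c (conj y g, inv\<^bsub>G\<^esub> y \<cdot> z) \<otimes>
        \<theta> ?g (inv\<^bsub>G\<^esub> x \<cdot> y) (inv\<^bsub>G\<^esub> y \<cdot> z))"
    proof (intro finsum_cong' refl)
      fix y assume y: "y \<in> carrier G"
      have "conj (inv\<^bsub>G\<^esub> x \<cdot> y) ?g = conj y g" "inv\<^bsub>G\<^esub> (inv\<^bsub>G\<^esub> x \<cdot> y) \<cdot> ?z = inv\<^bsub>G\<^esub> y \<cdot> z"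
        using x y gz by (simp_all add: G.inv_mult_group G.m_assoc G.inv_solve_left' flip: G.m_assoc[of x "inv\<^bsub>G\<^esub> x"])
      then show "b (?g, inv\<^bsub>G\<^esub> x \<cdot> y) \<otimes> c (conj (inv\<^bsub>G\<^esub> x \<cdot> y) ?g, inv\<^bsub>G\<^esub> (inv\<^bsub>G\<^esub> x \<cdot> y) \<cdot> ?z) \<otimes>
          \<theta> ?g (inv\<^bsub>G\<^esub> x \<cdot> y) (inv\<^bsub>G\<^esub> (inv\<^bsub>G\<^esub> x \<cdot> y) \<cdot> ?z) =
        b (?g, inv\<^bsub>G\<^esub> x \<cdot> y) \<otimes> c (conj y g, inv\<^bsub>G\<^esub> y \<cdot> z) \<otimes> \<theta> ?g (inv\<^bsub>G\<^esub> x \<cdot> y) (inv\<^bsub>G\<^esub> y \<cdot> z)"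
        by simp
    qed (use x gz cl b c in auto)
    finally have bc: "(b \<otimes>\<^bsub>D\<^esub> c) (?g, ?z) = \<dots>" .
    have T: "\<theta> g x (inv\<^bsub>G\<^esub> x \<cdot> y) \<otimes> \<theta> g y (inv\<^bsub>G\<^esub> y \<cdot> z) = \<theta> g x (inv\<^bsub>G\<^esub> x \<cdot> z) \<otimes> \<theta> ?g (inv\<^bsub>G\<^esub> x \<cdot> y) (inv\<^bsub>G\<^esub> y \<cdot> z)"
      if y: "y \<in> carrier G" for y
    proof -
      have "x \<cdot> (inv\<^bsub>G\<^esub> x \<cdot> y) = y" "inv\<^bsub>G\<^esub> x \<cdot> y \<cdot> (inv\<^bsub>G\<^esub> y \<cdot> z) = inv\<^bsub>G\<^esub> x \<cdot> z"
        using x y gz by (simp_all add: G.m_assoc[symmetric]) (simp add: G.m_assoc)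
      then show ?thesis
        using theta_cocycle[OF gz(1) x, of "inv\<^bsub>G\<^esub> x \<cdot> y" "inv\<^bsub>G\<^esub> y \<cdot> z"] x y gz by simp
    qed
    have F': "F x y = a (g, x) \<otimes> b (?g, inv\<^bsub>G\<^esub> x \<cdot> y) \<otimes> c (conj y g, inv\<^bsub>G\<^esub> y \<cdot> z) \<otimes>
        (\<theta> g x ?z \<otimes> \<theta> ?g (inv\<^bsub>G\<^esub> x \<cdot> y) (inv\<^bsub>G\<^esub> y \<cdot> z))" if "y \<in> carrier G" for y
      by (simp add: F_def T[OF that])
    show "(\<Oplus>y\<in>carrier G. F x y) = a (g, x) \<otimes> (b \<otimes>\<^bsub>D\<^esub> c) (?g, ?z) \<otimes> \<theta> g x ?z"
      unfolding bc using x gz cl a b c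
      by (simp add: finsum_ldistr finsum_rdistr finite_G Pi_def)
        (auto intro!: finsum_cong' simp: F' m_ac)
  qed (use gz a b c in \<open>auto simp: double_mult_closed\<close>)
  finally show "(a \<otimes>\<^bsub>D\<^esub> b \<otimes>\<^bsub>D\<^esub> c) (g, z) = (a \<otimes>\<^bsub>D\<^esub> (b \<otimes>\<^bsub>D\<^esub> c)) (g, z)" .
qed (use a b c in \<open>simp_all add: double_mult_closed\<close>)

lemma ring_double: "ring D"
proof (rule ringI)
  show "abelian_group D" by (rule abelian_group_double)
  show "Group.monoid D"
  proof (rule monoidI)
    fix a assume a: "a \<in> carrier D"
    show "\<one>\<^bsub>D\<^esub> \<otimes>\<^bsub>D\<^esub> a = a"
    proof (rule double_eqI)
      fix g z assume gz: "g \<in> carrier G" "z \<in> carrier G"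
      then show "(\<one>\<^bsub>D\<^esub> \<otimes>\<^bsub>D\<^esub> a) (g, z) = a (g, z)"
        using a unfolding double_mult_apply[OF double_closed(2) a gz]
        by (subst finsum_single[where i = e]) (simp_all add: finite_G double_one_apply theta_one)
    qed (use a in \<open>simp_all add: double_mult_closed double_closed\<close>)
    show "a \<otimes>\<^bsub>D\<^esub> \<one>\<^bsub>D\<^esub> = a"
    proof (rule double_eqI)
      fix g z assume gz: "g \<in> carrier G" "z \<in> carrier G"
      have "inv\<^bsub>G\<^esub> x \<cdot> z = e \<longleftrightarrow> x = z" if "x \<in> carrier G" for x
        using that gz by (metis G.inv_closed G.inv_equality G.inv_inv G.l_inv)
      then show "(a \<otimes>\<^bsub>D\<^esub> \<one>\<^bsub>D\<^esub>) (g, z) = a (g, z)"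
        using a gz unfolding double_mult_apply[OF a double_closed(2) gz]
        by (subst finsum_single[where i = z]) (simp_all add: finite_G double_one_apply theta_one)
    qed (use a in \<open>simp_all add: double_mult_closed double_closed\<close>)
  qed (simp_all add: double_mult_closed double_closed double_assoc)
next
  fix a b c assume a: "a \<in> carrier D" and b: "b \<in> carrier D" and c: "c \<in> carrier D"
  note cl = double_mult_closed double_closed
  show "(a \<oplus>\<^bsub>D\<^esub> b) \<otimes>\<^bsub>D\<^esub> c = a \<otimes>\<^bsub>D\<^esub> c \<oplus>\<^bsub>D\<^esub> b \<otimes>\<^bsub>D\<^esub> c"
  proof (rule double_eqI)
    fix g z assume gz: "g \<in> carrier G" "z \<in> carrier G"
    have "((a \<oplus>\<^bsub>D\<^esub> b) \<otimes>\<^bsub>D\<^esub> c) (g, z) =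
        (\<Oplus>x\<in>carrier G. a (g, x) \<otimes> c (conj x g, inv\<^bsub>G\<^esub> x \<cdot> z) \<otimes> \<theta> g x (inv\<^bsub>G\<^esub> x \<cdot> z) \<oplus>
          b (g, x) \<otimes> c (conj x g, inv\<^bsub>G\<^esub> x \<cdot> z) \<otimes> \<theta> g x (inv\<^bsub>G\<^esub> x \<cdot> z))"
      unfolding double_mult_apply[OF double_closed(3)[OF a b] c gz]
      by (intro finsum_cong' refl) (use a b c gz in \<open>auto simp: double_add_apply l_distr\<close>)
    then show "((a \<oplus>\<^bsub>D\<^esub> b) \<otimes>\<^bsub>D\<^esub> c) (g, z) = (a \<otimes>\<^bsub>D\<^esub> c \<oplus>\<^bsub>D\<^esub> b \<otimes>\<^bsub>D\<^esub> c) (g, z)"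
      using a b c gz by (simp add: double_add_apply double_mult_apply Pi_def)
  qed (use a b c in \<open>simp_all add: cl\<close>)
  show "c \<otimes>\<^bsub>D\<^esub> (a \<oplus>\<^bsub>D\<^esub> b) = c \<otimes>\<^bsub>D\<^esub> a \<oplus>\<^bsub>D\<^esub> c \<otimes>\<^bsub>D\<^esub> b"
  proof (rule double_eqI)
    fix g z assume gz: "g \<in> carrier G" "z \<in> carrier G"
    have "(c \<otimes>\<^bsub>D\<^esub> (a \<oplus>\<^bsub>D\<^esub> b)) (g, z) =
        (\<Oplus>x\<in>carrier G. c (g, x) \<otimes> a (conj x g, inv\<^bsub>G\<^esub> x \<cdot> z) \<otimes> \<theta> g x (inv\<^bsub>G\<^esub> x \<cdot> z) \<oplus>
          c (g, x) \<otimes> b (conj x g, inv\<^bsub>G\<^esub> x \<cdot> z) \<otimes> \<theta> g x (inv\<^bsub>G\<^esub> x \<cdot> z))"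
      unfolding double_mult_apply[OF c double_closed(3)[OF a b] gz]
      by (intro finsum_cong' refl) (use a b c gz in \<open>auto simp: double_add_apply l_distr r_distr\<close>)
    then show "(c \<otimes>\<^bsub>D\<^esub> (a \<oplus>\<^bsub>D\<^esub> b)) (g, z) = (c \<otimes>\<^bsub>D\<^esub> a \<oplus>\<^bsub>D\<^esub> c \<otimes>\<^bsub>D\<^esub> b) (g, z)"
      using a b c gz by (simp add: double_add_apply double_mult_apply Pi_def)
  qed (use a b c in \<open>simp_all add: cl\<close>)
qed

section \<open>Modules over the double as representations\<close>

text \<open>A multiple of a basis vector. The coefficient is an argument because a module over
  \<open>D\<close> has no separate multiplication by \<open>K\<close>: scalars act through the
  double.\<close>

definition basis_elem where "basis_elem p c = (\<lambda>q \<in> B. if q = p then c else \<zero>)"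

lemma basis_elem_closed [simp]: "c \<in> carrier K \<Longrightarrow> basis_elem p c \<in> carrier D"
  by (auto simp: basis_elem_def double_simps)

lemma basis_elem_apply: "q \<in> B \<Longrightarrow> basis_elem p c q = (if q = p then c else \<zero>)"
  by (auto simp: basis_elem_def)

lemma basis_elem_add: "c \<in> carrier K \<Longrightarrow> d \<in> carrier K \<Longrightarrow> basis_elem p (c \<oplus> d) = basis_elem p c \<oplus>\<^bsub>D\<^esub> basis_elem p d"
  by (auto simp: basis_elem_def double_simps)

lemma basis_elem_zero: "basis_elem p \<zero> = \<zero>\<^bsub>D\<^esub>"
  by (auto simp: basis_elem_def double_simps)

lemma basis_elem_mult:
  assumes gx: "g \<in> carrier G" "x \<in> carrier G" and hy: "h \<in> carrier G" "y \<in> carrier G"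
    and cd: "c \<in> carrier K" "d \<in> carrier K"
  shows "basis_elem (g, x) c \<otimes>\<^bsub>D\<^esub> basis_elem (h, y) d =
    (if h = conj x g then basis_elem (g, x \<cdot> y) (c \<otimes> d \<otimes> \<theta> g x y) else \<zero>\<^bsub>D\<^esub>)" (is "_ = ?r")
proof (rule double_eqI)
  fix f z assume fz: "f \<in> carrier G" "z \<in> carrier G"
  have z: "inv\<^bsub>G\<^esub> x \<cdot> z = y \<longleftrightarrow> z = x \<cdot> y"
    using gx hy fz by (metis G.inv_solve_left)
  have "(basis_elem (g, x) c \<otimes>\<^bsub>D\<^esub> basis_elem (h, y) d) (f, z) =
      basis_elem (g, x) c (f, x) \<otimes> basis_elem (h, y) d (conj x f, inv\<^bsub>G\<^esub> x \<cdot> z) \<otimes> \<theta> f x (inv\<^bsub>G\<^esub> x \<cdot> z)"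
    unfolding double_mult_apply[OF basis_elem_closed[OF cd(1)] basis_elem_closed[OF cd(2)] fz]
    by (rule finsum_single) (use gx hy fz cd finite_G in \<open>auto simp: basis_elem_apply\<close>)
  also have "\<dots> = ?r (f, z)"
    using gx hy fz cd z by (auto simp: basis_elem_apply double_zero_apply)
  finally show "(basis_elem (g, x) c \<otimes>\<^bsub>D\<^esub> basis_elem (h, y) d) (f, z) = ?r (f, z)" .
qed (use assms in \<open>auto simp: double_mult_closed double_closed\<close>)

lemma double_finsum_apply:
  assumes "f \<in> S \<rightarrow> carrier D" and "q \<in> B"
  shows "(\<Oplus>\<^bsub>D\<^esub>i\<in>S. f i) q = (\<Oplus>i\<in>S. f i q)"
  using assms
  by (intro additive_finsum[of D K "\<lambda>a. a q"])
    (auto simp: abelian_group_double abelian_group_axioms double_simps)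

lemma double_basis_sum:
  assumes "a \<in> carrier D"
  shows "(\<Oplus>\<^bsub>D\<^esub>p\<in>B. basis_elem p (a p)) = a"
proof (rule double_eqI)
  interpret D: ring D by (rule ring_double)
  have a: "a p \<in> carrier K" if "p \<in> B" for p using assms that by auto
  then show "(\<Oplus>\<^bsub>D\<^esub>p\<in>B. basis_elem p (a p)) \<in> carrier D" by (intro D.finsum_closed) auto
  fix g z assume gz: "g \<in> carrier G" "z \<in> carrier G"
  have "(\<Oplus>\<^bsub>D\<^esub>p\<in>B. basis_elem p (a p)) (g, z) = (\<Oplus>p\<in>B. basis_elem p (a p) (g, z))"
    by (rule double_finsum_apply) (use a gz in auto)
  also have "\<dots> = basis_elem (g, z) (a (g, z)) (g, z)"
    by (rule finsum_single) (use a gz finite_B in \<open>auto simp: basis_elem_apply\<close>)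
  finally show "(\<Oplus>\<^bsub>D\<^esub>p\<in>B. basis_elem p (a p)) (g, z) = a (g, z)"
    using gz by (simp add: basis_elem_apply)
qed (use assms in simp)

text \<open>Decomposes the unit into the idempotents at the pairs (g, e). They are orthogonal by
  \<open>basis_elem_mult\<close>, so every module splits into its fibres.\<close>

lemma double_one_sum: "(\<Oplus>\<^bsub>D\<^esub>g\<in>carrier G. basis_elem (g, e) \<one>) = \<one>\<^bsub>D\<^esub>"
proof (rule double_eqI)
  interpret D: ring D by (rule ring_double)
  show "(\<Oplus>\<^bsub>D\<^esub>g\<in>carrier G. basis_elem (g, e) \<one>) \<in> carrier D" by (intro D.finsum_closed) auto
  fix g z assume gz: "g \<in> carrier G" "z \<in> carrier G"
  have "(\<Oplus>\<^bsub>D\<^esub>g\<in>carrier G. basis_elem (g, e) \<one>) (g, z) = (\<Oplus>h\<in>carrier G. basis_elem (h, e) \<one> (g, z))"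
    by (rule double_finsum_apply) (use gz in auto)
  also have "\<dots> = basis_elem (g, e) \<one> (g, z)"
    by (rule finsum_single) (use gz finite_G in \<open>auto simp: basis_elem_apply\<close>)
  finally show "(\<Oplus>\<^bsub>D\<^esub>g\<in>carrier G. basis_elem (g, e) \<one>) (g, z) = \<one>\<^bsub>D\<^esub> (g, z)"
    using gz by (auto simp: basis_elem_apply double_one_apply)
qed (simp add: double_closed)

section \<open>The action of basis elements, and the fibres of a module\<close>

definition act where "act M g x c m = basis_elem (g, x) c \<odot>\<^bsub>M\<^esub> m"

text \<open>The image of an idempotent, described as its set of fixed points. The scalars of
  \<open>K\<close> act through multiples of that idempotent.\<close>

definition fibre :: "('g \<times> 'g \<Rightarrow> 'k, 'v) module \<Rightarrow> 'g \<Rightarrow> ('k, 'v) module" where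
  "fibre M g = \<lparr>carrier = {m \<in> carrier M. act M g e \<one> m = m}, mult = mult M, one = one M,
     zero = zero M, add = add M, smult = act M g e\<rparr>"

definition fibre_func :: "('g \<times> 'g \<Rightarrow> 'k, 'v) module \<Rightarrow>
    (('g, 'k) inertia_ob, ('g, 'k) inertia_ar, ('k, 'v) module, 'v \<Rightarrow> 'v) func" where
  "fibre_func M = \<lparr>FOb = (\<lambda>X. fibre M (fst X)),
     FAr = (\<lambda>X Y u. \<lambda>m \<in> carrier (fibre M (fst X)). act M (fst Y) (fst u) (snd u 1) m)\<rparr>"

lemma fibre_simps:
  "m \<in> carrier (fibre M g) \<longleftrightarrow> m \<in> carrier M \<and> act M g e \<one> m = m"
  "zero (fibre M g) = zero M" "add (fibre M g) = add M" "smult (fibre M g) = act M g e"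
  by (simp_all add: fibre_def)

context
  fixes M :: "('g \<times> 'g \<Rightarrow> 'k, 'v) module"
  assumes M: "left_module D M"
begin

interpretation M: left_module D M by (rule M)

lemma act_closed [simp]: "c \<in> carrier K \<Longrightarrow> m \<in> carrier M \<Longrightarrow> act M g x c m \<in> carrier M"
  by (simp add: act_def M.smult_closed)

lemma act_act:
  assumes "g \<in> carrier G" "x \<in> carrier G" "h \<in> carrier G" "y \<in> carrier G"
    "c \<in> carrier K" "d \<in> carrier K" "m \<in> carrier M"
  shows "act M g x c (act M h y d m) =
    (if h = conj x g then act M g (x \<cdot> y) (c \<otimes> d \<otimes> \<theta> g x y) m else \<zero>\<^bsub>M\<^esub>)"
proof -
  have "act M g x c (act M h y d m) = (basis_elem (g, x) c \<otimes>\<^bsub>D\<^esub> basis_elem (h, y) d) \<odot>\<^bsub>M\<^esub> m"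
    using assms by (simp add: act_def M.smult_assoc1)
  then show ?thesis using assms by (simp add: basis_elem_mult act_def M.smult_zero_left)
qed

lemma act_add_right: "c \<in> carrier K \<Longrightarrow> m \<in> carrier M \<Longrightarrow> n \<in> carrier M \<Longrightarrow>
    act M g x c (m \<oplus>\<^bsub>M\<^esub> n) = act M g x c m \<oplus>\<^bsub>M\<^esub> act M g x c n"
  by (simp add: act_def M.smult_r_distr)

lemma act_add_left: "c \<in> carrier K \<Longrightarrow> d \<in> carrier K \<Longrightarrow> m \<in> carrier M \<Longrightarrow>
    act M g x (c \<oplus> d) m = act M g x c m \<oplus>\<^bsub>M\<^esub> act M g x d m"
  by (simp add: act_def basis_elem_add M.smult_l_distr)

lemma act_zero: "m \<in> carrier M \<Longrightarrow> act M g x \<zero> m = \<zero>\<^bsub>M\<^esub>"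
  "c \<in> carrier K \<Longrightarrow> act M g x c \<zero>\<^bsub>M\<^esub> = \<zero>\<^bsub>M\<^esub>"
  by (simp_all add: act_def basis_elem_zero M.smult_zero_left M.smult_zero_right)

lemma act_finsum: "c \<in> carrier K \<Longrightarrow> f \<in> S \<rightarrow> carrier M \<Longrightarrow>
    act M g x c (\<Oplus>\<^bsub>M\<^esub>i\<in>S. f i) = (\<Oplus>\<^bsub>M\<^esub>i\<in>S. act M g x c (f i))"
  by (simp add: act_def M.smult_finsum_right)

lemma act_sum: "m \<in> carrier M \<Longrightarrow> (\<Oplus>\<^bsub>M\<^esub>g\<in>carrier G. act M g e \<one> m) = m"
  unfolding act_def
  by (subst M.smult_finsum_left[symmetric]) (auto simp: double_one_sum M.smult_one)

lemma smult_sum: "a \<in> carrier D \<Longrightarrow> m \<in> carrier M \<Longrightarrow> a \<odot>\<^bsub>M\<^esub> m = (\<Oplus>\<^bsub>M\<^esub>p\<in>B. act M (fst p) (snd p) (a p) m)"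
  using M.smult_finsum_left[of m "\<lambda>p. basis_elem p (a p)" B]
  by (simp add: double_basis_sum act_def Pi_def)

lemma act_in_fibre:
  assumes "g \<in> carrier G" "x \<in> carrier G" "c \<in> carrier K" "m \<in> carrier M"
  shows "act M g x c m \<in> carrier (fibre M g)"
  using assms by (simp add: fibre_simps act_act theta_one)

lemma left_module_fibre:
  assumes g: "g \<in> carrier G"
  shows "left_module K (fibre M g)"
proof -
  have "abelian_group (fibre M g)"
  proof (rule abelian_groupI)
    fix m assume m: "m \<in> carrier (fibre M g)"
    then have "m \<in> carrier M" by (simp add: fibre_simps)
    \<comment> \<open>The additive inverse is taken to be the multiple by
      \<open>\<ominus> \<one>\<close>, which lies in the fibre by
      \<open>act_in_fibre\<close>.\<close>
    then have "act M g e (\<ominus> \<one>) m \<oplus>\<^bsub>M\<^esub> act M g e \<one> m = \<zero>\<^bsub>M\<^esub>"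
      by (simp add: act_zero l_neg flip: act_add_left)
    then show "\<exists>n \<in> carrier (fibre M g). n \<oplus>\<^bsub>fibre M g\<^esub> m = \<zero>\<^bsub>fibre M g\<^esub>"
      using m g act_in_fibre[of g e "\<ominus> \<one>" m] by (auto simp: fibre_simps)
  qed (auto simp: fibre_simps act_add_right act_zero M.M.a_assoc intro: M.M.a_comm)
  then show ?thesis
    using g by (intro left_module.intro left_module_axioms.intro ring_axioms)
      (auto simp: fibre_simps act_act act_add_left act_add_right theta_one)
qed

lemma is_functor_fibre_func: "is_functor (inertia_groupoid G K \<alpha>) (module_category K) (fibre_func M)"
proof (intro is_functor.intro is_functor_axioms.intro category_inertia_groupoid category_module_category)
  fix X assume "X \<in> Ob (inertia_groupoid G K \<alpha>)"
  then have X: "X \<in> obs" by (simp add: inertia_groupoid_def)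
  show "FOb (fibre_func M) X \<in> Ob (module_category K)"
    by (simp add: fibre_func_def module_category_def left_module_fibre obs_fst[OF X])
  show "FAr (fibre_func M) X X (Id (inertia_groupoid G K \<alpha>) X) = Id (module_category K) (FOb (fibre_func M) X)"
    by (auto simp: fibre_func_def module_category_def inertia_groupoid_def fibre_simps)
next
  fix X Y u assume "X \<in> Ob (inertia_groupoid G K \<alpha>)" "Y \<in> Ob (inertia_groupoid G K \<alpha>)"
    "u \<in> Hom (inertia_groupoid G K \<alpha>) X Y"
  then have XY: "X \<in> obs" "Y \<in> obs" and u: "u \<in> ars X Y" by (simp_all add: inertia_groupoid_def)
  note c = obs_fst[OF XY(2)] ars_fst[OF u XY] ars_closed[OF u XY]
  \<comment> \<open>Linearity over \<open>K\<close>: the scalars of the two fibres act through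
    different idempotents, but in both products the factor \<theta> has a unit among its arguments
    and equals 1.\<close>
  have "act M (fst Y) (fst u) (snd u 1) (act M (fst X) e a m) = act M (fst Y) e a (act M (fst Y) (fst u) (snd u 1) m)"
    if "a \<in> carrier K" "m \<in> carrier M" for a m
    using that c by (simp add: ars_source[OF u XY] act_act theta_one m_comm)
  moreover have "m \<in> carrier M" if "m \<in> carrier (fibre M g)" for m g
    using that by (simp add: fibre_simps)
  ultimately show "FAr (fibre_func M) X Y u \<in> Hom (module_category K) (FOb (fibre_func M) X) (FOb (fibre_func M) Y)"
    using c left_module.smult_closed[OF left_module_fibre[OF obs_fst[OF XY(1)]]]
      abelian_groupE(1)[OF left_module.axioms(2)[OF left_module_fibre[OF obs_fst[OF XY(1)]]]]
    by (auto simp: fibre_func_def module_category_def act_in_fibre act_add_right fibre_simps(2-4)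
        intro!: linear_mapsI)
next
  fix X Y Z u v assume "X \<in> Ob (inertia_groupoid G K \<alpha>)" "Y \<in> Ob (inertia_groupoid G K \<alpha>)"
    "Z \<in> Ob (inertia_groupoid G K \<alpha>)" "u \<in> Hom (inertia_groupoid G K \<alpha>) X Y" "v \<in> Hom (inertia_groupoid G K \<alpha>) Y Z"
  then have o: "X \<in> obs" "Y \<in> obs" "Z \<in> obs" and u: "u \<in> ars X Y" and v: "v \<in> ars Y Z"
    by (simp_all add: inertia_groupoid_def)
  note c = obs_fst[OF o(3)] obs_fst[OF o(2)] ars_fst[OF u o(1,2)] ars_closed[OF u o(1,2)] ars_fst[OF v o(2,3)] ars_closed[OF v o(2,3)]
  \<comment> \<open>The value at 1 of the composite arrow carries exactly the factor \<theta> that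
    \<open>act_act\<close> produces; the vanishing case there does not arise, since the source of
    \<open>v\<close> is the conjugate in question.\<close>
  have "act M (fst Z) (fst v \<cdot> fst u) (snd u 1 \<otimes> snd v 1 \<otimes> \<theta> (fst Z) (fst v) (fst u)) m =
      act M (fst Z) (fst v) (snd v 1) (act M (fst Y) (fst u) (snd u 1) m)" if "m \<in> carrier M" for m
    using that c by (simp add: act_act ars_source[OF v o(2,3)] m_comm[of "snd u 1"])
  then show "FAr (fibre_func M) X Z (Comp (inertia_groupoid G K \<alpha>) X Y Z v u) =
    Comp (module_category K) (FOb (fibre_func M) X) (FOb (fibre_func M) Y) (FOb (fibre_func M) Z)
      (FAr (fibre_func M) Y Z v) (FAr (fibre_func M) X Y u)"
    using c act_in_fibre
    by (auto simp: fibre_func_def module_category_def inertia_groupoid_def inertia_comp_eq[OF o u v]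
        compose_def fun_eq_iff restrict_def fibre_simps)
qed

lemma centre_acts_fibre_func: "centre_acts_by_scalars G K \<alpha> (fibre_func M)"
  unfolding centre_acts_by_scalars_def
proof (intro ballI)
  fix X Y u a m
  assume o: "X \<in> obs" "Y \<in> obs" and u: "u \<in> ars X Y" and a: "a \<in> Units K" and m: "m \<in> carrier (FOb (fibre_func M) X)"
  have "fst (central_action K a u) = fst u" by (simp add: central_action_def case_prod_beta)
  then show "FAr (fibre_func M) X Y (central_action K a u) m = a \<odot>\<^bsub>FOb (fibre_func M) Y\<^esub> FAr (fibre_func M) X Y u m"
    using m a obs_fst[OF o(2)] ars_fst[OF u o] ars_closed[OF u o]
    by (simp add: fibre_func_def central_action_one fibre_simps act_act theta_one Units_closed)
qed

end

section \<open>The functor from modules to representations, and its full faithfulness\<close>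

abbreviation "InRep \<equiv> inertia_representations G K \<alpha>"

definition double_func where
  "double_func = \<lparr>FOb = fibre_func, FAr = (\<lambda>M N f. \<lambda>X \<in> obs. restrict f (carrier (fibre M (fst X))))\<rparr>"

definition base_ob where "base_ob g = (g, SOME \<gamma>. (g, \<gamma>) \<in> obs)"

lemma base_ob_in: "g \<in> carrier G \<Longrightarrow> base_ob g \<in> obs" and fst_base_ob [simp]: "fst (base_ob g) = g"
  using someI_ex[OF inertia_ob_exists] by (simp_all add: base_ob_def)

lemma linear_maps_act:
  assumes "f \<in> linear_maps D M N" "left_module D M" "c \<in> carrier K" "m \<in> carrier M"
  shows "f (act M g x c m) = act N g x c (f m)"
  unfolding act_def using linear_mapsD(3)[OF assms(1) basis_elem_closed[OF assms(3)] assms(4)] .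

lemma linear_maps_fibre:
  assumes "f \<in> linear_maps D M N" "left_module D M" "m \<in> carrier (fibre M g)"
  shows "f m \<in> carrier (fibre N g)"
  using linear_maps_act[OF assms(1,2) one_closed, of m g e] assms(3) linear_mapsD(1)[OF assms(1)]
  by (simp add: fibre_simps)

text \<open>Every element of the double is the sum of its multiples of basis elements, and an
  additive map commutes with finite sums; so linearity need only be tested on
  \<open>act\<close>.\<close>

lemma linear_mapsI_act:
  fixes M N :: "('g \<times> 'g \<Rightarrow> 'k, 'v) module"
  assumes M: "left_module D M" and N: "left_module D N"
    and "\<And>m. m \<in> carrier M \<Longrightarrow> f m \<in> carrier N"
    and "\<And>m n. m \<in> carrier M \<Longrightarrow> n \<in> carrier M \<Longrightarrow> f (m \<oplus>\<^bsub>M\<^esub> n) = f m \<oplus>\<^bsub>N\<^esub> f n"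
    and act: "\<And>g x c m. g \<in> carrier G \<Longrightarrow> x \<in> carrier G \<Longrightarrow> c \<in> carrier K \<Longrightarrow> m \<in> carrier M \<Longrightarrow>
      f (act M g x c m) = act N g x c (f m)"
    and "\<And>m. m \<notin> carrier M \<Longrightarrow> f m = undefined"
  shows "f \<in> linear_maps D M N"
proof (rule linear_mapsI)
  interpret M: left_module D M by fact
  interpret N: left_module D N by fact
  fix a m assume a: "a \<in> carrier D" and m: "m \<in> carrier M"
  have "f (\<Oplus>\<^bsub>M\<^esub>p\<in>B. act M (fst p) (snd p) (a p) m) = (\<Oplus>\<^bsub>N\<^esub>p\<in>B. f (act M (fst p) (snd p) (a p) m))"
    using a m by (intro additive_finsum assms(3,4) M.M.abelian_group_axioms N.M.abelian_group_axioms) (auto simp: act_closed[OF M])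
  also have "\<dots> = (\<Oplus>\<^bsub>N\<^esub>p\<in>B. act N (fst p) (snd p) (a p) (f m))"
    using a m assms(3) by (intro N.M.finsum_cong') (auto simp: act act_closed[OF N])
  finally show "f (a \<odot>\<^bsub>M\<^esub> m) = a \<odot>\<^bsub>N\<^esub> f m"
    by (simp add: smult_sum[OF M a m] smult_sum[OF N a assms(3)[OF m]])
qed (use assms in auto)

lemma fibre_func_in_InRep: "left_module D M \<Longrightarrow> fibre_func M \<in> Ob InRep"
  by (simp add: inertia_representations_def full_subcategory_def functor_category_def
      is_functor_fibre_func centre_acts_fibre_func)

lemma category_InRep: "category (InRep :: ((('g, 'k) inertia_ob, ('g, 'k) inertia_ar, ('k, 'v) module, 'v \<Rightarrow> 'v) func,
      ('g, 'k) inertia_ob \<Rightarrow> 'v \<Rightarrow> 'v) cat)"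
  unfolding inertia_representations_def
  by (intro category_full_subcategory category_functor_category category_inertia_groupoid category_module_category)

lemma InRep_simps:
  "Hom InRep F F' = nat_trans (inertia_groupoid G K \<alpha>) (module_category K) F F'"
  "Id InRep F = (\<lambda>X \<in> obs. \<lambda>v \<in> carrier (FOb F X). v)"
  "Comp InRep F F' F'' \<sigma> \<tau> = (\<lambda>X \<in> obs. compose (carrier (FOb F X)) (\<sigma> X) (\<tau> X))"
  by (simp_all add: inertia_representations_def full_subcategory_def functor_category_def
      inertia_groupoid_def module_category_def)

lemma nat_trans_iff:
  "\<tau> \<in> nat_trans (inertia_groupoid G K \<alpha>) (module_category K) F F' \<longleftrightarrow>
    \<tau> \<in> extensional obs \<and> (\<forall>X \<in> obs. \<tau> X \<in> linear_maps K (FOb F X) (FOb F' X)) \<and>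
    (\<forall>X \<in> obs. \<forall>Y \<in> obs. \<forall>u \<in> ars X Y.
      compose (carrier (FOb F X)) (\<tau> Y) (FAr F X Y u) = compose (carrier (FOb F X)) (FAr F' X Y u) (\<tau> X))"
  by (auto simp: nat_trans_def inertia_groupoid_def module_category_def PiE_def Pi_def)

lemma double_func_arrow:
  assumes M: "left_module D M" and f: "f \<in> linear_maps D M N"
  shows "FAr double_func M N f \<in> Hom InRep (fibre_func M) (fibre_func N)"
proof -
  have carr: "m \<in> carrier M" if "m \<in> carrier (fibre M g)" for m g using that by (simp add: fibre_simps)
  have "restrict f (carrier (fibre M g)) \<in> linear_maps K (fibre M g) (fibre N g)" if g: "g \<in> carrier G" for g
    using left_module.smult_closed[OF left_module_fibre[OF M g]]
      abelian_groupE(1)[OF left_module.axioms(2)[OF left_module_fibre[OF M g]]]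
    by (intro linear_mapsI)
      (simp_all add: linear_maps_fibre[OF f M] fibre_simps(2-4) linear_mapsD(2)[OF f] linear_maps_act[OF f M] carr)
  moreover have "compose (carrier (fibre M (fst X))) (restrict f (carrier (fibre M (fst Y)))) (FAr (fibre_func M) X Y u) =
      compose (carrier (fibre M (fst X))) (FAr (fibre_func N) X Y u) (restrict f (carrier (fibre M (fst X))))"
    if "X \<in> obs" "Y \<in> obs" "u \<in> ars X Y" for X Y u
    using that obs_fst[OF that(2)] ars_fst[OF that(3,1,2)] ars_closed[OF that(3,1,2)] act_in_fibre[OF M]
    by (auto simp: compose_def fibre_func_def fun_eq_iff restrict_def linear_maps_act[OF f M] carr linear_maps_fibre[OF f M])
  ultimately show ?thesis
    by (simp add: InRep_simps nat_trans_iff double_func_def fibre_func_def obs_fst)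
qed

lemma is_functor_double_func:
  "is_functor (module_category D) InRep (double_func :: (('g \<times> 'g \<Rightarrow> 'k, 'v) module, 'v \<Rightarrow> 'v, _, _) func)"
proof (intro is_functor.intro is_functor_axioms.intro category_InRep category_module_category)
  fix M :: "('g \<times> 'g \<Rightarrow> 'k, 'v) module" assume "M \<in> Ob (module_category D)"
  then have M: "left_module D M" by (simp add: module_category_def)
  show "FOb double_func M \<in> Ob InRep"
    using fibre_func_in_InRep[OF M] by (simp add: double_func_def)
  show "FAr double_func M M (Id (module_category D) M) = Id InRep (FOb double_func M)"
    by (auto simp: InRep_simps double_func_def fibre_func_def module_category_def fibre_simps fun_eq_iff restrict_def)
next
  fix M N :: "('g \<times> 'g \<Rightarrow> 'k, 'v) module" and f
  assume "M \<in> Ob (module_category D)" "f \<in> Hom (module_category D) M N"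
  then have M: "left_module D M" and f: "f \<in> linear_maps D M N" by (simp_all add: module_category_def)
  show "FAr double_func M N f \<in> Hom InRep (FOb double_func M) (FOb double_func N)"
    using double_func_arrow[OF M f] by (simp add: double_func_def)
next
  fix L M N :: "('g \<times> 'g \<Rightarrow> 'k, 'v) module" and f h
  assume "L \<in> Ob (module_category D)" "f \<in> Hom (module_category D) L M"
  then have L: "left_module D L" and f: "f \<in> linear_maps D L M" by (simp_all add: module_category_def)
  show "FAr double_func L N (Comp (module_category D) L M N h f) =
      Comp InRep (FOb double_func L) (FOb double_func M) (FOb double_func N) (FAr double_func M N h) (FAr double_func L M f)"
    using linear_maps_fibre[OF f L]
    by (auto simp: InRep_simps double_func_def fibre_func_def module_category_def fibre_simps(1) fun_eq_iff restrict_def compose_def)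
qed

text \<open>A module element is the sum of its components in the fibres. On the fibre over g two
  maps with the same image agree, because some object lies over g at which the images can be
  compared.\<close>

lemma double_func_inj:
  fixes M N :: "('g \<times> 'g \<Rightarrow> 'k, 'v) module"
  assumes M: "left_module D M" and N: "left_module D N"
    and f: "f \<in> linear_maps D M N" and h: "h \<in> linear_maps D M N"
    and eq: "FAr double_func M N f = FAr double_func M N h"
  shows "f = h"
proof
  interpret M: left_module D M by fact
  interpret N: left_module D N by fact
  fix m show "f m = h m"
  proof (cases "m \<in> carrier M")
    case True
    have "f (act M g e \<one> m) = h (act M g e \<one> m)" if g: "g \<in> carrier G" for g
    proof -
      have "restrict f (carrier (fibre M g)) = restrict h (carrier (fibre M g))"
        using fun_cong[OF eq, of "base_ob g"] base_ob_in[OF g] by (simp add: double_func_def)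
      from fun_cong[OF this, of "act M g e \<one> m"] show ?thesis
        using act_in_fibre[OF M g _ one_closed True, of e] by simp
    qed
    moreover have "k m = (\<Oplus>\<^bsub>N\<^esub>g\<in>carrier G. k (act M g e \<one> m))" if k: "k \<in> linear_maps D M N" for k
    proof -
      have "k (\<Oplus>\<^bsub>M\<^esub>g\<in>carrier G. act M g e \<one> m) = (\<Oplus>\<^bsub>N\<^esub>g\<in>carrier G. k (act M g e \<one> m))"
        using True
        by (intro additive_finsum linear_mapsD[OF k] M.M.abelian_group_axioms N.M.abelian_group_axioms)
          (auto simp: act_closed[OF M])
      then show ?thesis by (simp add: act_sum[OF M True])
    qed
    moreover have "(\<Oplus>\<^bsub>N\<^esub>g\<in>carrier G. f (act M g e \<one> m)) = (\<Oplus>\<^bsub>N\<^esub>g\<in>carrier G. h (act M g e \<one> m))"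
      using True by (intro N.M.finsum_cong') (auto simp: calculation(1) linear_mapsD(1)[OF h] act_closed[OF M])
    ultimately show ?thesis using f h by simp
  qed (simp add: linear_mapsD(4)[OF f] linear_mapsD(4)[OF h])
qed

text \<open>The preimage applies to each component of m the map that \<tau> has at the base object
  over its group element, and adds up. Naturality along arrows over the unit shows that this
  recovers \<tau> at all objects; naturality along the other arrows gives compatibility with the
  double.\<close>

lemma double_func_surj:
  fixes M N :: "('g \<times> 'g \<Rightarrow> 'k, 'v) module"
  assumes M: "left_module D M" and N: "left_module D N"
    and tau: "\<tau> \<in> Hom InRep (fibre_func M) (fibre_func N)"
  shows "\<exists>f \<in> linear_maps D M N. FAr double_func M N f = \<tau>"
proof -
  interpret M: left_module D M by fact
  interpret N: left_module D N by fact
  have ext: "\<tau> \<in> extensional obs"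
    and lin: "\<And>X. X \<in> obs \<Longrightarrow> \<tau> X \<in> linear_maps K (fibre M (fst X)) (fibre N (fst X))"
    and nat: "\<And>X Y u. X \<in> obs \<Longrightarrow> Y \<in> obs \<Longrightarrow> u \<in> ars X Y \<Longrightarrow>
      compose (carrier (fibre M (fst X))) (\<tau> Y) (FAr (fibre_func M) X Y u) =
      compose (carrier (fibre M (fst X))) (FAr (fibre_func N) X Y u) (\<tau> X)"
    using tau by (auto simp: InRep_simps nat_trans_iff fibre_func_def)
  have carrM: "m \<in> carrier M" if "m \<in> carrier (fibre M g)" for m g using that by (simp add: fibre_simps)
  have carrN: "m \<in> carrier N" if "m \<in> carrier (fibre N g)" for m g using that by (simp add: fibre_simps)
  have nat': "\<tau> Y (act M (fst Y) x a m) = act N (fst Y) x a (\<tau> X m)"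
    if "X \<in> obs" "Y \<in> obs" "x \<in> carrier G" "fst X = conj x (fst Y)" "a \<in> Units K" "m \<in> carrier (fibre M (fst X))"
    for X Y x a m
    using fun_cong[OF nat[OF that(1,2) arrow_in(1)[OF that(1-5)]], of m] that(6) linear_mapsD(1)[OF lin[OF that(1)] that(6)]
    by (simp add: compose_def fibre_func_def arrow_in[OF that(1-5)])
  define t where "t g = \<tau> (base_ob g)" for g
  have t_lin: "t g \<in> linear_maps K (fibre M g) (fibre N g)" if "g \<in> carrier G" for g
    using lin[OF base_ob_in[OF that]] by (simp add: t_def)
  have t_fibre: "t g m \<in> carrier (fibre N g)" if "g \<in> carrier G" "m \<in> carrier (fibre M g)" for g m
    using linear_mapsD(1)[OF t_lin[OF that(1)] that(2)] .
  \<comment> \<open>Naturality along the arrow from \<open>X\<close> to the base object over the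
    unit with value 1, which acts as the identity on elements of both fibres.\<close>
  have t_tau: "\<tau> X m = t (fst X) m" if X: "X \<in> obs" and m: "m \<in> carrier (fibre M (fst X))" for X m
  proof -
    note g = obs_fst[OF X]
    have "t (fst X) (act M (fst X) e \<one> m) = act N (fst X) e \<one> (\<tau> X m)"
      using nat'[OF X base_ob_in[OF g], of e \<one> m] m g by (simp add: t_def)
    then show ?thesis
      using m linear_mapsD(1)[OF lin[OF X] m] by (simp add: fibre_simps)
  qed
  define f where "f = (\<lambda>m \<in> carrier M. \<Oplus>\<^bsub>N\<^esub>g\<in>carrier G. t g (act M g e \<one> m))"
  have t_act: "t g (act M g e \<one> m) \<in> carrier N" if "g \<in> carrier G" "m \<in> carrier M" for g m
    using that by (intro carrN[of _ g] t_fibre act_in_fibre[OF M]) auto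
  \<comment> \<open>An element of this form has only one nonzero component, so the sum defining
    \<open>f\<close> reduces to one term.\<close>
  have f_act: "f (act M g x c m) = t g (act M g x c m)"
    if g: "g \<in> carrier G" and x: "x \<in> carrier G" and c: "c \<in> carrier K" and m: "m \<in> carrier M" for g x c m
  proof -
    have z: "act M h e \<one> (act M g x c m) = (if h = g then act M g x c m else \<zero>\<^bsub>M\<^esub>)" if "h \<in> carrier G" for h
      using that g x c m by (auto simp: act_act[OF M] theta_one)
    have t0: "t h \<zero>\<^bsub>M\<^esub> = \<zero>\<^bsub>N\<^esub>" if h: "h \<in> carrier G" for h
      using additive_zero[OF left_module.axioms(2)[OF left_module_fibre[OF M h]] left_module.axioms(2)[OF left_module_fibre[OF N h]],
          of "t h"] linear_mapsD(1,2)[OF t_lin[OF h]]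
      by (simp add: fibre_simps(2,3))
    have "f (act M g x c m) = (\<Oplus>\<^bsub>N\<^esub>h\<in>carrier G. t h (act M h e \<one> (act M g x c m)))"
      using that by (simp add: f_def act_closed[OF M])
    also have "\<dots> = t g (act M g e \<one> (act M g x c m))"
      using that by (intro N.M.finsum_single finite_G t_act act_closed[OF M]) (simp_all add: z t0)
    finally show ?thesis using g by (simp add: z)
  qed
  \<comment> \<open>\<open>f\<close> commutes with the projections onto the fibres: orthogonality of
    the idempotents kills all summands but the one at \<open>g\<close>.\<close>
  have f_comp: "act N g e \<one> (f m) = t g (act M g e \<one> m)" if g: "g \<in> carrier G" and m: "m \<in> carrier M" for g m
  proof -
    have z: "act N g e \<one> (t h (act M h e \<one> m)) = (if h = g then t g (act M g e \<one> m) else \<zero>\<^bsub>N\<^esub>)" if h: "h \<in> carrier G" for h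
    proof -
      have F: "t h (act M h e \<one> m) \<in> carrier (fibre N h)"
        using h m by (intro t_fibre act_in_fibre[OF M]) auto
      then have "act N g e \<one> (t h (act M h e \<one> m)) = act N g e \<one> (act N h e \<one> (t h (act M h e \<one> m)))"
        by (simp add: fibre_simps)
      also have "\<dots> = (if h = g then act N g e \<one> (t h (act M h e \<one> m)) else \<zero>\<^bsub>N\<^esub>)"
        using g h carrN[OF F] by (auto simp: act_act[OF N] theta_one)
      finally show ?thesis using F by (auto simp: fibre_simps)
    qed
    have "act N g e \<one> (f m) = (\<Oplus>\<^bsub>N\<^esub>h\<in>carrier G. act N g e \<one> (t h (act M h e \<one> m)))"
      using m t_act by (simp add: f_def act_finsum[OF N] Pi_def)
    also have "\<dots> = act N g e \<one> (t g (act M g e \<one> m))"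
      using g m by (intro N.M.finsum_single finite_G act_closed[OF N] t_act) (simp_all add: z)
    finally show ?thesis using g by (simp add: z)
  qed
  have f_closed: "f m \<in> carrier N" if "m \<in> carrier M" for m
    using that t_act by (simp add: f_def Pi_def)
  have "f \<in> linear_maps D M N"
  proof (rule linear_mapsI_act[OF M N f_closed])
    fix m n assume mn: "m \<in> carrier M" "n \<in> carrier M"
    have "f (m \<oplus>\<^bsub>M\<^esub> n) = (\<Oplus>\<^bsub>N\<^esub>g\<in>carrier G. t g (act M g e \<one> m) \<oplus>\<^bsub>N\<^esub> t g (act M g e \<one> n))"
    proof -
      have "f (m \<oplus>\<^bsub>M\<^esub> n) = (\<Oplus>\<^bsub>N\<^esub>g\<in>carrier G. t g (act M g e \<one> (m \<oplus>\<^bsub>M\<^esub> n)))"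
        using mn by (simp add: f_def)
      also have "\<dots> = (\<Oplus>\<^bsub>N\<^esub>g\<in>carrier G. t g (act M g e \<one> m) \<oplus>\<^bsub>N\<^esub> t g (act M g e \<one> n))"
        by (intro N.M.finsum_cong' refl)
          (use mn linear_mapsD(2)[OF t_lin] t_act act_in_fibre[OF M] in
            \<open>auto simp: act_add_right[OF M] fibre_simps(3)\<close>)
      finally show ?thesis .
    qed
    then show "f (m \<oplus>\<^bsub>M\<^esub> n) = f m \<oplus>\<^bsub>N\<^esub> f n"
      using mn t_act by (simp add: f_def Pi_def)
  next
    fix g x c m assume gx: "g \<in> carrier G" "x \<in> carrier G" and c: "c \<in> carrier K" and m: "m \<in> carrier M"
    let ?h = "conj x g" let ?m = "act M ?h e \<one> m"
    have h: "?h \<in> carrier G" using gx by simp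
    have mF: "?m \<in> carrier (fibre M ?h)" using h m by (intro act_in_fibre[OF M]) auto
    have xF: "act M g x \<one> ?m \<in> carrier (fibre M g)" using gx m by (intro act_in_fibre[OF M] act_closed[OF M]) auto
    \<comment> \<open>The coefficient \<open>c\<close> may be zero, whereas arrows carry only units.
      It is split off as a scalar of the fibre over \<open>g\<close>, leaving the arrow over
      \<open>x\<close> with value 1.\<close>
    have "act M g x c m = act M g e c (act M g x \<one> ?m)"
      using gx c m by (simp add: act_act[OF M] theta_one)
    then have "f (act M g x c m) = t g (act M g e c (act M g x \<one> ?m))"
      using f_act[OF gx c m] by simp
    also have "\<dots> = act N g e c (t g (act M g x \<one> ?m))"
      using linear_mapsD(3)[OF t_lin[OF gx(1)] c xF] by (simp add: fibre_simps(4))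
    also have "t g (act M g x \<one> ?m) = act N g x \<one> (t ?h ?m)"
      using nat'[OF base_ob_in[OF h] base_ob_in[OF gx(1)], of x \<one> ?m] gx mF by (simp add: t_def)
    also have "\<dots> = act N g x \<one> (act N ?h e \<one> (f m))"
      using f_comp[OF h m] by simp
    also have "act N g e c \<dots> = act N g x c (f m)"
      using gx c f_closed[OF m] by (simp add: act_act[OF N] theta_one)
    finally show "f (act M g x c m) = act N g x c (f m)" .
  qed (auto simp: f_def)
  moreover have "FAr double_func M N f = \<tau>"
  proof
    fix X show "FAr double_func M N f X = \<tau> X"
    proof (cases "X \<in> obs")
      case True
      note g = obs_fst[OF True]
      have "f m = \<tau> X m" if m: "m \<in> carrier (fibre M (fst X))" for m
        using f_act[OF g _ one_closed carrM[OF m], of e] m t_tau[OF True m] by (simp add: fibre_simps)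
      then show ?thesis
        using True by (auto simp: double_func_def fun_eq_iff restrict_def linear_mapsD(4)[OF lin[OF True]])
    next
      case False
      then show ?thesis using extensional_arb[OF ext False] by (simp add: double_func_def)
    qed
  qed
  ultimately show ?thesis by blast
qed

section \<open>Representations as modules over the double\<close>

text \<open>The group being finite, the direct sum of the spaces is their product.
  \<open>T g x\<close> is the operator by which the basis element at (g, x) is to act: it takes the
  coordinate at the conjugate x^{-1} g x to the coordinate at g.\<close>

definition tuple_module :: "('g \<Rightarrow> ('k, 'v) module) \<Rightarrow> ('g \<Rightarrow> 'g \<Rightarrow> 'v \<Rightarrow> 'v) \<Rightarrow>
    ('g \<times> 'g \<Rightarrow> 'k, 'g \<Rightarrow> 'v) module" where
  "tuple_module V T = \<lparr>carrier = (\<Pi>\<^sub>E g \<in> carrier G. carrier (V g)), mult = undefined, one = undefined,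
     zero = (\<lambda>g \<in> carrier G. zero (V g)),
     add = (\<lambda>p q. \<lambda>g \<in> carrier G. add (V g) (p g) (q g)),
     smult = (\<lambda>a p. \<lambda>g \<in> carrier G. \<Oplus>\<^bsub>V g\<^esub>x \<in> carrier G. a (g, x) \<odot>\<^bsub>V g\<^esub> T g x (p (conj x g)))\<rparr>"

lemma tuple_module_simps:
  "carrier (tuple_module V T) = (\<Pi>\<^sub>E g \<in> carrier G. carrier (V g))"
  "zero (tuple_module V T) = (\<lambda>g \<in> carrier G. zero (V g))"
  "add (tuple_module V T) p q = (\<lambda>g \<in> carrier G. add (V g) (p g) (q g))"
  "smult (tuple_module V T) a p =
    (\<lambda>g \<in> carrier G. \<Oplus>\<^bsub>V g\<^esub>x \<in> carrier G. a (g, x) \<odot>\<^bsub>V g\<^esub> T g x (p (conj x g)))"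
  by (simp_all add: tuple_module_def)

context
  fixes V :: "'g \<Rightarrow> ('k, 'v) module" and T :: "'g \<Rightarrow> 'g \<Rightarrow> 'v \<Rightarrow> 'v"
  assumes V: "\<And>g. g \<in> carrier G \<Longrightarrow> left_module K (V g)"
    and T: "\<And>g x. g \<in> carrier G \<Longrightarrow> x \<in> carrier G \<Longrightarrow> T g x \<in> linear_maps K (V (conj x g)) (V g)"
    and T_T: "\<And>g x y v. g \<in> carrier G \<Longrightarrow> x \<in> carrier G \<Longrightarrow> y \<in> carrier G \<Longrightarrow>
      v \<in> carrier (V (conj (x \<cdot> y) g)) \<Longrightarrow> T g x (T (conj x g) y v) = \<theta> g x y \<odot>\<^bsub>V g\<^esub> T g (x \<cdot> y) v"
    and T_one: "\<And>g v. g \<in> carrier G \<Longrightarrow> v \<in> carrier (V g) \<Longrightarrow> T g e v = v"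
begin

lemma V_abelian: "g \<in> carrier G \<Longrightarrow> abelian_group (V g)"
  using V left_module.axioms(2) by blast

lemma T_closed:
  "g \<in> carrier G \<Longrightarrow> x \<in> carrier G \<Longrightarrow> v \<in> carrier (V (conj x g)) \<Longrightarrow> T g x v \<in> carrier (V g)"
  using linear_mapsD(1)[OF T] .

lemma tuple_apply_closed: "p \<in> carrier (tuple_module V T) \<Longrightarrow> g \<in> carrier G \<Longrightarrow> p g \<in> carrier (V g)"
  by (auto simp: tuple_module_simps)

lemma tuple_eqI:
  assumes "p \<in> carrier (tuple_module V T)" "q \<in> carrier (tuple_module V T)"
    and "\<And>g. g \<in> carrier G \<Longrightarrow> p g = q g"
  shows "p = q"
  using assms by (auto simp: tuple_module_simps intro: PiE_ext)

lemma tuple_closed: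
  assumes "p \<in> carrier (tuple_module V T)" "q \<in> carrier (tuple_module V T)"
  shows "p \<oplus>\<^bsub>tuple_module V T\<^esub> q \<in> carrier (tuple_module V T)"
  using tuple_apply_closed[OF assms(1)] tuple_apply_closed[OF assms(2)] abelian_groupE(1)[OF V_abelian]
  by (simp add: tuple_module_simps)

lemma tuple_zero_closed: "\<zero>\<^bsub>tuple_module V T\<^esub> \<in> carrier (tuple_module V T)"
  using abelian_groupE(2)[OF V_abelian] by (simp add: tuple_module_simps)

lemma tuple_term_closed:
  assumes "a \<in> carrier D" "p \<in> carrier (tuple_module V T)" "g \<in> carrier G" "x \<in> carrier G"
  shows "a (g, x) \<odot>\<^bsub>V g\<^esub> T g x (p (conj x g)) \<in> carrier (V g)"
  using assms by (intro left_module.smult_closed[OF V] T_closed tuple_apply_closed) auto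

lemma tuple_smult_closed:
  assumes "a \<in> carrier D" "p \<in> carrier (tuple_module V T)"
  shows "a \<odot>\<^bsub>tuple_module V T\<^esub> p \<in> carrier (tuple_module V T)"
proof -
  have "(\<Oplus>\<^bsub>V g\<^esub>x \<in> carrier G. a (g, x) \<odot>\<^bsub>V g\<^esub> T g x (p (conj x g))) \<in> carrier (V g)"
    if g: "g \<in> carrier G" for g
  proof -
    interpret Vg: left_module K "V g" by (rule V[OF g])
    show ?thesis using tuple_term_closed[OF assms g] by (intro Vg.M.finsum_closed) auto
  qed
  then show ?thesis by (simp add: tuple_module_simps)
qed

lemma tuple_add_apply: "g \<in> carrier G \<Longrightarrow> (p \<oplus>\<^bsub>tuple_module V T\<^esub> q) g = p g \<oplus>\<^bsub>V g\<^esub> q g"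
  and tuple_zero_apply: "g \<in> carrier G \<Longrightarrow> \<zero>\<^bsub>tuple_module V T\<^esub> g = \<zero>\<^bsub>V g\<^esub>"
  and tuple_smult_apply: "g \<in> carrier G \<Longrightarrow> (a \<odot>\<^bsub>tuple_module V T\<^esub> p) g =
    (\<Oplus>\<^bsub>V g\<^esub>x \<in> carrier G. a (g, x) \<odot>\<^bsub>V g\<^esub> T g x (p (conj x g)))"
  by (simp_all add: tuple_module_simps)

lemma abelian_group_tuple: "abelian_group (tuple_module V T)"
proof (rule abelian_groupI)
  fix p assume p: "p \<in> carrier (tuple_module V T)"
  define q where "q = (\<lambda>g \<in> carrier G. \<ominus>\<^bsub>V g\<^esub> p g)"
  have q: "q \<in> carrier (tuple_module V T)"
    using tuple_apply_closed[OF p] abelian_group.a_inv_closed[OF V_abelian]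
    by (simp add: q_def tuple_module_simps)
  have "q \<oplus>\<^bsub>tuple_module V T\<^esub> p = \<zero>\<^bsub>tuple_module V T\<^esub>"
    using tuple_apply_closed[OF p] abelian_group.l_neg[OF V_abelian]
    by (intro tuple_eqI tuple_closed tuple_zero_closed p q)
      (simp add: tuple_add_apply tuple_zero_apply, simp add: q_def)
  then show "\<exists>q \<in> carrier (tuple_module V T). q \<oplus>\<^bsub>tuple_module V T\<^esub> p = \<zero>\<^bsub>tuple_module V T\<^esub>"
    using q by blast
  show "\<zero>\<^bsub>tuple_module V T\<^esub> \<oplus>\<^bsub>tuple_module V T\<^esub> p = p"
    using tuple_apply_closed[OF p] abelian_groupE(5)[OF V_abelian]
    by (intro tuple_eqI tuple_closed tuple_zero_closed p) (simp add: tuple_add_apply tuple_zero_apply)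
next
  fix p q r assume pqr: "p \<in> carrier (tuple_module V T)" "q \<in> carrier (tuple_module V T)"
    "r \<in> carrier (tuple_module V T)"
  show "p \<oplus>\<^bsub>tuple_module V T\<^esub> q \<oplus>\<^bsub>tuple_module V T\<^esub> r = p \<oplus>\<^bsub>tuple_module V T\<^esub> (q \<oplus>\<^bsub>tuple_module V T\<^esub> r)"
    using pqr[THEN tuple_apply_closed] abelian_groupE(3)[OF V_abelian]
    by (intro tuple_eqI tuple_closed pqr) (simp add: tuple_add_apply)
next
  fix p q assume pq: "p \<in> carrier (tuple_module V T)" "q \<in> carrier (tuple_module V T)"
  show "p \<oplus>\<^bsub>tuple_module V T\<^esub> q = q \<oplus>\<^bsub>tuple_module V T\<^esub> p"
    using pq[THEN tuple_apply_closed] abelian_groupE(4)[OF V_abelian]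
    by (intro tuple_eqI tuple_closed pq) (simp add: tuple_add_apply)
qed (simp_all add: tuple_closed tuple_zero_closed)

text \<open>The same change of variables as in \<open>double_assoc\<close>: the right-hand side is
  indexed by x and by the product z of the two group elements, and \<open>T_T\<close> supplies the
  factor \<theta> that the product of the double contains.\<close>

lemma tuple_smult_assoc:
  assumes a: "a \<in> carrier D" and b: "b \<in> carrier D" and p: "p \<in> carrier (tuple_module V T)"
  shows "(a \<otimes>\<^bsub>D\<^esub> b) \<odot>\<^bsub>tuple_module V T\<^esub> p =
    a \<odot>\<^bsub>tuple_module V T\<^esub> (b \<odot>\<^bsub>tuple_module V T\<^esub> p)"
proof (rule tuple_eqI)
  fix g assume g: "g \<in> carrier G"
  interpret Vg: left_module K "V g" by (rule V[OF g])
  define w where "w z = T g z (p (conj z g))" for z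
  have w: "w z \<in> carrier (V g)" if "z \<in> carrier G" for z
    unfolding w_def using that g by (intro T_closed tuple_apply_closed[OF p]) auto
  define c where "c x z = a (g, x) \<otimes> b (conj x g, inv\<^bsub>G\<^esub> x \<cdot> z) \<otimes> \<theta> g x (inv\<^bsub>G\<^esub> x \<cdot> z)" for x z
  have c: "c x z \<in> carrier K" if "x \<in> carrier G" "z \<in> carrier G" for x z
    using that a b g by (simp add: c_def)
  have "((a \<otimes>\<^bsub>D\<^esub> b) \<odot>\<^bsub>tuple_module V T\<^esub> p) g = (\<Oplus>\<^bsub>V g\<^esub>z\<in>carrier G. \<Oplus>\<^bsub>V g\<^esub>x\<in>carrier G. c x z \<odot>\<^bsub>V g\<^esub> w z)"
    unfolding tuple_smult_apply[OF g]
  proof (intro Vg.M.finsum_cong' refl)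
    fix z assume z: "z \<in> carrier G"
    show "(a \<otimes>\<^bsub>D\<^esub> b) (g, z) \<odot>\<^bsub>V g\<^esub> T g z (p (conj z g)) = (\<Oplus>\<^bsub>V g\<^esub>x\<in>carrier G. c x z \<odot>\<^bsub>V g\<^esub> w z)"
      unfolding double_mult_apply[OF a b g z] w_def[symmetric] c_def[symmetric]
      using c z w by (intro Vg.smult_finsum_left) auto
  qed (use c w in \<open>auto intro!: Vg.M.finsum_closed Vg.smult_closed\<close>)
  also have "\<dots> = (\<Oplus>\<^bsub>V g\<^esub>x\<in>carrier G. \<Oplus>\<^bsub>V g\<^esub>z\<in>carrier G. c x z \<odot>\<^bsub>V g\<^esub> w z)"
    using c w by (intro Vg.M.finsum_swap finite_G Vg.smult_closed)
  also have "\<dots> = (a \<odot>\<^bsub>tuple_module V T\<^esub> (b \<odot>\<^bsub>tuple_module V T\<^esub> p)) g"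
    unfolding tuple_smult_apply[OF g]
  proof (intro Vg.M.finsum_cong' refl)
    fix x assume x: "x \<in> carrier G"
    let ?h = "conj x g"
    have h: "?h \<in> carrier G" using x g by simp
    interpret Vh: left_module K "V ?h" by (rule V[OF h])
    have cj: "conj (inv\<^bsub>G\<^esub> x \<cdot> z) ?h = conj z g" if "z \<in> carrier G" for z
      using x g that by (simp add: G.inv_mult_group G.m_assoc flip: G.m_assoc[of x "inv\<^bsub>G\<^esub> x"])
    have pz: "p (conj z g) \<in> carrier (V (conj z g))" if "z \<in> carrier G" for z
      using that g by (intro tuple_apply_closed[OF p]) auto
    define v where "v z = T ?h (inv\<^bsub>G\<^esub> x \<cdot> z) (p (conj z g))" for z
    have v: "v z \<in> carrier (V ?h)" if "z \<in> carrier G" for z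
      unfolding v_def using that x h pz cj by (intro T_closed) simp_all
    have "(b \<odot>\<^bsub>tuple_module V T\<^esub> p) ?h =
        (\<Oplus>\<^bsub>V ?h\<^esub>y\<in>carrier G. b (?h, y) \<odot>\<^bsub>V ?h\<^esub> T ?h y (p (conj y ?h)))"
      by (rule tuple_smult_apply[OF h])
    also have "\<dots> = (\<Oplus>\<^bsub>V ?h\<^esub>z\<in>carrier G. b (?h, inv\<^bsub>G\<^esub> x \<cdot> z) \<odot>\<^bsub>V ?h\<^esub>
        T ?h (inv\<^bsub>G\<^esub> x \<cdot> z) (p (conj (inv\<^bsub>G\<^esub> x \<cdot> z) ?h)))"
      using tuple_term_closed[OF b p h] by (intro finsum_translate Vh.M.abelian_monoid_axioms x) auto
    also have "\<dots> = (\<Oplus>\<^bsub>V ?h\<^esub>z\<in>carrier G. b (?h, inv\<^bsub>G\<^esub> x \<cdot> z) \<odot>\<^bsub>V ?h\<^esub> v z)"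
      by (intro Vh.M.finsum_cong' refl) (use x h b v in \<open>auto simp: cj v_def intro!: Vh.smult_closed\<close>)
    finally have bp: "(b \<odot>\<^bsub>tuple_module V T\<^esub> p) ?h = \<dots>" .
    \<comment> \<open>The composition law of the operators with second element x^{-1} z, so that the
      product of the two elements is z.\<close>
    have T_v: "T g x (v z) = \<theta> g x (inv\<^bsub>G\<^esub> x \<cdot> z) \<odot>\<^bsub>V g\<^esub> w z" if z: "z \<in> carrier G" for z
    proof -
      have "x \<cdot> (inv\<^bsub>G\<^esub> x \<cdot> z) = z" using x z by (simp flip: G.m_assoc)
      then show ?thesis
        using T_T[OF g x, of "inv\<^bsub>G\<^esub> x \<cdot> z" "p (conj z g)"] x z pz[OF z] by (simp add: v_def w_def)
    qed
    have "T g x ((b \<odot>\<^bsub>tuple_module V T\<^esub> p) ?h) =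
        (\<Oplus>\<^bsub>V g\<^esub>z\<in>carrier G. T g x (b (?h, inv\<^bsub>G\<^esub> x \<cdot> z) \<odot>\<^bsub>V ?h\<^esub> v z))"
      unfolding bp using x h b v
      by (intro additive_finsum linear_mapsD[OF T[OF g x]] Vh.M.abelian_group_axioms Vg.M.abelian_group_axioms)
        (auto intro!: Vh.smult_closed)
    also have "\<dots> = (\<Oplus>\<^bsub>V g\<^esub>z\<in>carrier G. b (?h, inv\<^bsub>G\<^esub> x \<cdot> z) \<odot>\<^bsub>V g\<^esub> (\<theta> g x (inv\<^bsub>G\<^esub> x \<cdot> z) \<odot>\<^bsub>V g\<^esub> w z))"
      by (intro Vg.M.finsum_cong' refl)
        (use x g h b v w in \<open>auto simp: linear_mapsD(3)[OF T[OF g x]] T_v intro!: Vg.smult_closed\<close>)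
    finally have "a (g, x) \<odot>\<^bsub>V g\<^esub> T g x ((b \<odot>\<^bsub>tuple_module V T\<^esub> p) ?h) =
        a (g, x) \<odot>\<^bsub>V g\<^esub> (\<Oplus>\<^bsub>V g\<^esub>z\<in>carrier G. b (?h, inv\<^bsub>G\<^esub> x \<cdot> z) \<odot>\<^bsub>V g\<^esub> (\<theta> g x (inv\<^bsub>G\<^esub> x \<cdot> z) \<odot>\<^bsub>V g\<^esub> w z))"
      by simp
    also have "\<dots> = (\<Oplus>\<^bsub>V g\<^esub>z\<in>carrier G. a (g, x) \<odot>\<^bsub>V g\<^esub> (b (?h, inv\<^bsub>G\<^esub> x \<cdot> z) \<odot>\<^bsub>V g\<^esub> (\<theta> g x (inv\<^bsub>G\<^esub> x \<cdot> z) \<odot>\<^bsub>V g\<^esub> w z)))"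
      using x g h a b w by (intro Vg.smult_finsum_right) (auto intro!: Vg.smult_closed)
    also have "\<dots> = (\<Oplus>\<^bsub>V g\<^esub>z\<in>carrier G. c x z \<odot>\<^bsub>V g\<^esub> w z)"
      by (intro Vg.M.finsum_cong' refl)
        (use x g h a b w in \<open>auto simp: c_def Vg.smult_assoc1 Vg.smult_closed\<close>)
    finally show "(\<Oplus>\<^bsub>V g\<^esub>z\<in>carrier G. c x z \<odot>\<^bsub>V g\<^esub> w z) =
        a (g, x) \<odot>\<^bsub>V g\<^esub> T g x ((b \<odot>\<^bsub>tuple_module V T\<^esub> p) ?h)" ..
  qed (use tuple_term_closed[OF a tuple_smult_closed[OF b p] g] in auto)
  finally show "((a \<otimes>\<^bsub>D\<^esub> b) \<odot>\<^bsub>tuple_module V T\<^esub> p) g =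
      (a \<odot>\<^bsub>tuple_module V T\<^esub> (b \<odot>\<^bsub>tuple_module V T\<^esub> p)) g" .
qed (use a b p in \<open>simp_all add: tuple_smult_closed double_mult_closed\<close>)

lemma tuple_act:
  assumes "g \<in> carrier G" "x \<in> carrier G" "c \<in> carrier K" "p \<in> carrier (tuple_module V T)"
  shows "act (tuple_module V T) g x c p =
    (\<lambda>h \<in> carrier G. if h = g then c \<odot>\<^bsub>V g\<^esub> T g x (p (conj x g)) else \<zero>\<^bsub>V h\<^esub>)"
proof -
  have "(\<Oplus>\<^bsub>V h\<^esub>y \<in> carrier G. basis_elem (g, x) c (h, y) \<odot>\<^bsub>V h\<^esub> T h y (p (conj y h))) =
      (if h = g then c \<odot>\<^bsub>V g\<^esub> T g x (p (conj x g)) else \<zero>\<^bsub>V h\<^esub>)" if h: "h \<in> carrier G" for h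
  proof -
    interpret Vh: left_module K "V h" by (rule V[OF h])
    have cl: "T h y (p (conj y h)) \<in> carrier (V h)" if "y \<in> carrier G" for y
      using that h by (intro T_closed tuple_apply_closed[OF assms(4)]) auto
    have "(\<Oplus>\<^bsub>V h\<^esub>y \<in> carrier G. basis_elem (g, x) c (h, y) \<odot>\<^bsub>V h\<^esub> T h y (p (conj y h))) =
        basis_elem (g, x) c (h, x) \<odot>\<^bsub>V h\<^esub> T h x (p (conj x h))"
      by (rule Vh.M.finsum_single)
        (use h assms cl finite_G in \<open>auto simp: basis_elem_apply Vh.smult_zero_left Vh.smult_closed\<close>)
    then show ?thesis using h assms cl by (auto simp: basis_elem_apply Vh.smult_zero_left)
  qed
  then show ?thesis by (auto simp: act_def tuple_module_simps(4) fun_eq_iff restrict_def)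
qed

lemma left_module_tuple: "left_module D (tuple_module V T)"
proof (intro left_module.intro left_module_axioms.intro ring_double abelian_group_tuple)
  fix a b p q assume a: "a \<in> carrier D" and b: "b \<in> carrier D"
    and p: "p \<in> carrier (tuple_module V T)" and q: "q \<in> carrier (tuple_module V T)"
  show "(a \<oplus>\<^bsub>D\<^esub> b) \<odot>\<^bsub>tuple_module V T\<^esub> p =
      a \<odot>\<^bsub>tuple_module V T\<^esub> p \<oplus>\<^bsub>tuple_module V T\<^esub> b \<odot>\<^bsub>tuple_module V T\<^esub> p"
  proof (rule tuple_eqI)
    fix g assume g: "g \<in> carrier G"
    interpret Vg: left_module K "V g" by (rule V[OF g])
    have cl: "T g x (p (conj x g)) \<in> carrier (V g)" if "x \<in> carrier G" for x
      using that g by (intro T_closed tuple_apply_closed[OF p]) auto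
    have "((a \<oplus>\<^bsub>D\<^esub> b) \<odot>\<^bsub>tuple_module V T\<^esub> p) g =
        (\<Oplus>\<^bsub>V g\<^esub>x \<in> carrier G. a (g, x) \<odot>\<^bsub>V g\<^esub> T g x (p (conj x g)) \<oplus>\<^bsub>V g\<^esub> b (g, x) \<odot>\<^bsub>V g\<^esub> T g x (p (conj x g)))"
      unfolding tuple_smult_apply[OF g]
      by (intro Vg.M.finsum_cong' refl)
        (use g a b cl in \<open>auto simp: double_add_apply Vg.smult_l_distr Vg.smult_closed\<close>)
    then show "((a \<oplus>\<^bsub>D\<^esub> b) \<odot>\<^bsub>tuple_module V T\<^esub> p) g =
        (a \<odot>\<^bsub>tuple_module V T\<^esub> p \<oplus>\<^bsub>tuple_module V T\<^esub> b \<odot>\<^bsub>tuple_module V T\<^esub> p) g"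
      using g tuple_term_closed[OF a p g] tuple_term_closed[OF b p g]
      by (simp add: tuple_add_apply tuple_smult_apply Vg.M.finsum_addf Pi_def)
  qed (use a b p in \<open>simp_all add: tuple_closed tuple_smult_closed double_closed\<close>)
  show "a \<odot>\<^bsub>tuple_module V T\<^esub> (p \<oplus>\<^bsub>tuple_module V T\<^esub> q) =
      a \<odot>\<^bsub>tuple_module V T\<^esub> p \<oplus>\<^bsub>tuple_module V T\<^esub> a \<odot>\<^bsub>tuple_module V T\<^esub> q"
  proof (rule tuple_eqI)
    fix g assume g: "g \<in> carrier G"
    interpret Vg: left_module K "V g" by (rule V[OF g])
    have cl: "r (conj x g) \<in> carrier (V (conj x g))" "T g x (r (conj x g)) \<in> carrier (V g)"
      if "x \<in> carrier G" "r \<in> carrier (tuple_module V T)" for x r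
      using that g tuple_apply_closed[OF that(2)] by (auto intro!: T_closed)
    have "(a \<odot>\<^bsub>tuple_module V T\<^esub> (p \<oplus>\<^bsub>tuple_module V T\<^esub> q)) g =
        (\<Oplus>\<^bsub>V g\<^esub>x \<in> carrier G. a (g, x) \<odot>\<^bsub>V g\<^esub> T g x (p (conj x g)) \<oplus>\<^bsub>V g\<^esub> a (g, x) \<odot>\<^bsub>V g\<^esub> T g x (q (conj x g)))"
      unfolding tuple_smult_apply[OF g]
      by (intro Vg.M.finsum_cong' refl)
        (use g a p q cl in \<open>auto simp: tuple_add_apply linear_mapsD(2)[OF T[OF g]] Vg.smult_r_distr Vg.smult_closed\<close>)
    then show "(a \<odot>\<^bsub>tuple_module V T\<^esub> (p \<oplus>\<^bsub>tuple_module V T\<^esub> q)) g =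
        (a \<odot>\<^bsub>tuple_module V T\<^esub> p \<oplus>\<^bsub>tuple_module V T\<^esub> a \<odot>\<^bsub>tuple_module V T\<^esub> q) g"
      using g tuple_term_closed[OF a p g] tuple_term_closed[OF a q g]
      by (simp add: tuple_add_apply tuple_smult_apply Vg.M.finsum_addf Pi_def)
  qed (use a p q in \<open>simp_all add: tuple_closed tuple_smult_closed\<close>)
next
  fix p assume p: "p \<in> carrier (tuple_module V T)"
  show "\<one>\<^bsub>D\<^esub> \<odot>\<^bsub>tuple_module V T\<^esub> p = p"
  proof (rule tuple_eqI)
    fix g assume g: "g \<in> carrier G"
    interpret Vg: left_module K "V g" by (rule V[OF g])
    have cl: "T g x (p (conj x g)) \<in> carrier (V g)" if "x \<in> carrier G" for x
      using that g by (intro T_closed tuple_apply_closed[OF p]) auto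
    have pg: "p g \<in> carrier (V g)" by (rule tuple_apply_closed[OF p g])
    have "(\<one>\<^bsub>D\<^esub> \<odot>\<^bsub>tuple_module V T\<^esub> p) g = \<one>\<^bsub>D\<^esub> (g, e) \<odot>\<^bsub>V g\<^esub> T g e (p (conj e g))"
      unfolding tuple_smult_apply[OF g]
      by (rule Vg.M.finsum_single)
        (use g cl pg finite_G in \<open>auto simp: double_one_apply Vg.smult_zero_left Vg.smult_closed T_one\<close>)
    then show "(\<one>\<^bsub>D\<^esub> \<odot>\<^bsub>tuple_module V T\<^esub> p) g = p g"
      using g pg by (simp add: double_one_apply T_one Vg.smult_one)
  qed (use p in \<open>simp_all add: tuple_smult_closed double_closed\<close>)
qed (simp_all add: tuple_smult_closed tuple_smult_assoc)

end

section \<open>Working with representations and their morphisms\<close>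

lemma nat_transD:
  assumes "\<tau> \<in> Hom InRep F F'"
  shows "X \<in> obs \<Longrightarrow> \<tau> X \<in> linear_maps K (FOb F X) (FOb F' X)"
    and "X \<in> obs \<Longrightarrow> Y \<in> obs \<Longrightarrow> u \<in> ars X Y \<Longrightarrow> v \<in> carrier (FOb F X) \<Longrightarrow>
      \<tau> Y (FAr F X Y u v) = FAr F' X Y u (\<tau> X v)"
proof -
  show "\<tau> X \<in> linear_maps K (FOb F X) (FOb F' X)" if "X \<in> obs" for X
    using assms that by (simp add: InRep_simps nat_trans_iff)
  assume "X \<in> obs" "Y \<in> obs" "u \<in> ars X Y" and v: "v \<in> carrier (FOb F X)"
  then have "compose (carrier (FOb F X)) (\<tau> Y) (FAr F X Y u) = compose (carrier (FOb F X)) (FAr F' X Y u) (\<tau> X)"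
    using assms by (simp add: InRep_simps nat_trans_iff)
  from fun_cong[OF this, of v] v show "\<tau> Y (FAr F X Y u v) = FAr F' X Y u (\<tau> X v)"
    by (simp add: compose_eq)
qed

lemma nat_transI:
  assumes "\<tau> \<in> extensional obs" and "\<And>X. X \<in> obs \<Longrightarrow> \<tau> X \<in> linear_maps K (FOb F X) (FOb F' X)"
    and "\<And>X Y u v. X \<in> obs \<Longrightarrow> Y \<in> obs \<Longrightarrow> u \<in> ars X Y \<Longrightarrow> v \<in> carrier (FOb F X) \<Longrightarrow>
      \<tau> Y (FAr F X Y u v) = FAr F' X Y u (\<tau> X v)"
  shows "\<tau> \<in> Hom InRep F F'"
  using assms by (simp add: InRep_simps nat_trans_iff compose_def fun_eq_iff restrict_def)

lemma InRep_obD: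
  assumes "F \<in> Ob InRep"
  shows "X \<in> obs \<Longrightarrow> left_module K (FOb F X)"
    and "X \<in> obs \<Longrightarrow> Y \<in> obs \<Longrightarrow> u \<in> ars X Y \<Longrightarrow> FAr F X Y u \<in> linear_maps K (FOb F X) (FOb F Y)"
    and "X \<in> obs \<Longrightarrow> FAr F X X (e, \<lambda>_. \<one>) = (\<lambda>v \<in> carrier (FOb F X). v)"
    and "X \<in> obs \<Longrightarrow> Y \<in> obs \<Longrightarrow> Z \<in> obs \<Longrightarrow> u \<in> ars X Y \<Longrightarrow> w \<in> ars Y Z \<Longrightarrow>
      FAr F X Z (inertia_comp G K \<alpha> X Y Z w u) = compose (carrier (FOb F X)) (FAr F Y Z w) (FAr F X Y u)"
    and "X \<in> obs \<Longrightarrow> Y \<in> obs \<Longrightarrow> u \<in> ars X Y \<Longrightarrow> a \<in> Units K \<Longrightarrow> v \<in> carrier (FOb F X) \<Longrightarrow>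
      FAr F X Y (central_action K a u) v = a \<odot>\<^bsub>FOb F Y\<^esub> FAr F X Y u v"
proof -
  have F: "is_functor (inertia_groupoid G K \<alpha>) (module_category K) F" "centre_acts_by_scalars G K \<alpha> F"
    using assms by (simp_all add: inertia_representations_def full_subcategory_def functor_category_def)
  interpret is_functor "inertia_groupoid G K \<alpha>" "module_category K" F by (rule F)
  show "X \<in> obs \<Longrightarrow> left_module K (FOb F X)"
    using FOb_in[of X] by (simp add: inertia_groupoid_def module_category_def)
  show "X \<in> obs \<Longrightarrow> Y \<in> obs \<Longrightarrow> u \<in> ars X Y \<Longrightarrow> FAr F X Y u \<in> linear_maps K (FOb F X) (FOb F Y)"
    using FAr_in[of X Y u] by (simp add: inertia_groupoid_def module_category_def)
  show "X \<in> obs \<Longrightarrow> FAr F X X (e, \<lambda>_. \<one>) = (\<lambda>v \<in> carrier (FOb F X). v)"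
    using FAr_Id[of X] by (simp add: inertia_groupoid_def module_category_def)
  show "X \<in> obs \<Longrightarrow> Y \<in> obs \<Longrightarrow> Z \<in> obs \<Longrightarrow> u \<in> ars X Y \<Longrightarrow> w \<in> ars Y Z \<Longrightarrow>
      FAr F X Z (inertia_comp G K \<alpha> X Y Z w u) = compose (carrier (FOb F X)) (FAr F Y Z w) (FAr F X Y u)"
    using FAr_Comp[of X Y Z u w] by (simp add: inertia_groupoid_def module_category_def)
  show "X \<in> obs \<Longrightarrow> Y \<in> obs \<Longrightarrow> u \<in> ars X Y \<Longrightarrow> a \<in> Units K \<Longrightarrow> v \<in> carrier (FOb F X) \<Longrightarrow>
      FAr F X Y (central_action K a u) v = a \<odot>\<^bsub>FOb F Y\<^esub> FAr F X Y u v"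
    using F(2) by (simp add: centre_acts_by_scalars_def)
qed

text \<open>The pointwise inverse is linear and natural: after applying the injective components of
  \<tau>, each required equation becomes the corresponding one for \<tau>.\<close>

lemma InRep_isosI:
  assumes F: "F \<in> Ob InRep" and tau: "\<tau> \<in> Hom InRep F F'"
    and bij: "\<And>X. X \<in> obs \<Longrightarrow> bij_betw (\<tau> X) (carrier (FOb F X)) (carrier (FOb F' X))"
    and F': "F' \<in> Ob InRep"
  shows "\<tau> \<in> isos InRep F F'"
proof -
  define \<sigma> where "\<sigma> = (\<lambda>X \<in> obs. \<lambda>w \<in> carrier (FOb F' X). inv_into (carrier (FOb F X)) (\<tau> X) w)"
  have s_in: "\<sigma> X w \<in> carrier (FOb F X)" and ts: "\<tau> X (\<sigma> X w) = w"
    if "X \<in> obs" "w \<in> carrier (FOb F' X)" for X w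
    using that bij[OF that(1)] by (auto simp: \<sigma>_def bij_betw_def f_inv_into_f inv_into_into)
  have st: "\<sigma> X (\<tau> X v) = v" if "X \<in> obs" "v \<in> carrier (FOb F X)" for X v
    using that bij[OF that(1)] by (auto simp: \<sigma>_def bij_betw_def)
  have inj: "v = w" if "X \<in> obs" "v \<in> carrier (FOb F X)" "w \<in> carrier (FOb F X)" "\<tau> X v = \<tau> X w" for X v w
    using bij[OF that(1)] that(2-4) by (auto simp: bij_betw_def inj_on_def)
  have "\<sigma> \<in> Hom InRep F' F"
  proof (rule nat_transI)
    show "\<sigma> \<in> extensional obs" by (simp add: \<sigma>_def)
    fix X assume X: "X \<in> obs"
    interpret V: left_module K "FOb F X" using InRep_obD(1)[OF F X] .
    interpret V': left_module K "FOb F' X" using InRep_obD(1)[OF F' X] .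
    note t = nat_transD(1)[OF tau X]
    show "\<sigma> X \<in> linear_maps K (FOb F' X) (FOb F X)"
    proof (rule linear_mapsI)
      fix w w' assume "w \<in> carrier (FOb F' X)" "w' \<in> carrier (FOb F' X)"
      then show "\<sigma> X (w \<oplus>\<^bsub>FOb F' X\<^esub> w') = \<sigma> X w \<oplus>\<^bsub>FOb F X\<^esub> \<sigma> X w'"
        using X by - (rule inj[OF X]; simp add: s_in ts linear_mapsD(2)[OF t])
    next
      fix a w assume "a \<in> carrier K" "w \<in> carrier (FOb F' X)"
      then show "\<sigma> X (a \<odot>\<^bsub>FOb F' X\<^esub> w) = a \<odot>\<^bsub>FOb F X\<^esub> \<sigma> X w"
        using X by - (rule inj[OF X]; simp add: s_in ts linear_mapsD(3)[OF t] V.smult_closed V'.smult_closed)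
    qed (simp_all add: s_in X, simp add: \<sigma>_def X)
  next
    fix X Y u w assume XY: "X \<in> obs" "Y \<in> obs" "u \<in> ars X Y" and w: "w \<in> carrier (FOb F' X)"
    show "\<sigma> Y (FAr F' X Y u w) = FAr F X Y u (\<sigma> X w)"
      using XY w linear_mapsD(1)[OF InRep_obD(2)[OF F XY]] linear_mapsD(1)[OF InRep_obD(2)[OF F' XY]]
      by - (rule inj[OF XY(2)]; simp add: s_in ts nat_transD(2)[OF tau XY])
  qed
  moreover have "Comp InRep F F' F \<sigma> \<tau> = Id InRep F"
    by (simp add: InRep_simps compose_def fun_eq_iff restrict_def st)
  moreover have "Comp InRep F' F F' \<tau> \<sigma> = Id InRep F'"
    by (simp add: InRep_simps compose_def fun_eq_iff restrict_def ts)
  ultimately show ?thesis using tau by (auto simp: isos_def)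
qed

section \<open>The module of tuples of a representation\<close>

context
  fixes F :: "(('g, 'k) inertia_ob, ('g, 'k) inertia_ar, ('k, 'v) module, 'v \<Rightarrow> 'v) func"
  assumes F: "F \<in> Ob InRep"
begin

definition rep_arrow where "rep_arrow X Y s a = FAr F X Y (arrow X Y s a)"

lemma rep_arrow_linear:
  assumes "X \<in> obs" "Y \<in> obs" "s \<in> carrier G" "fst X = conj s (fst Y)" "a \<in> Units K"
  shows "rep_arrow X Y s a \<in> linear_maps K (FOb F X) (FOb F Y)"
  unfolding rep_arrow_def using assms by (intro InRep_obD(2)[OF F] arrow_in)

lemma rep_arrow_comp:
  assumes "X \<in> obs" "Y \<in> obs" "Z \<in> obs" "s \<in> carrier G" "fst X = conj s (fst Y)" "a \<in> Units K"
    and "t \<in> carrier G" "fst Y = conj t (fst Z)" "b \<in> Units K" and "v \<in> carrier (FOb F X)"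
  shows "rep_arrow Y Z t b (rep_arrow X Y s a v) = rep_arrow X Z (t \<cdot> s) (a \<otimes> b \<otimes> \<theta> (fst Z) t s) v"
  unfolding rep_arrow_def arrow_comp[OF assms(1-9), symmetric]
    InRep_obD(4)[OF F assms(1-3) arrow_in(1)[OF assms(1,2,4-6)] arrow_in(1)[OF assms(2,3,7-9)]]
  using assms(10) by (simp add: compose_eq)

lemma rep_arrow_id: "X \<in> obs \<Longrightarrow> v \<in> carrier (FOb F X) \<Longrightarrow> rep_arrow X X e \<one> v = v"
  unfolding rep_arrow_def arrow_id[symmetric] by (simp add: InRep_obD(3)[OF F])

text \<open>The condition on the centre enters here: the arrow over s with value a is the translate
  by a of the arrow over s with value 1.\<close>

lemma rep_arrow_scalar:
  assumes "X \<in> obs" "Y \<in> obs" "s \<in> carrier G" "fst X = conj s (fst Y)" "a \<in> Units K"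
    and "v \<in> carrier (FOb F X)"
  shows "rep_arrow X Y s a v = a \<odot>\<^bsub>FOb F Y\<^esub> rep_arrow X Y s \<one> v"
  using InRep_obD(5)[OF F assms(1,2) arrow_in(1)[OF assms(1-4) Units_one_closed] assms(5,6)] assms(5)
  by (simp add: rep_arrow_def central_action_arrow[OF assms(1-4) Units_one_closed assms(5)] Units_closed)

definition comp_space where "comp_space g = FOb F (base_ob g)"
text \<open>The operators for \<open>tuple_module\<close>, normalised by the value 1 at 1; arrows
  with other values give scalar multiples by \<open>rep_arrow_scalar\<close>.\<close>

definition comp_map where "comp_map g x = rep_arrow (base_ob (conj x g)) (base_ob g) x \<one>"

lemma comp_space_module: "g \<in> carrier G \<Longrightarrow> left_module K (comp_space g)"
  unfolding comp_space_def by (intro InRep_obD(1)[OF F] base_ob_in)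

lemma comp_map_linear:
  "g \<in> carrier G \<Longrightarrow> x \<in> carrier G \<Longrightarrow> comp_map g x \<in> linear_maps K (comp_space (conj x g)) (comp_space g)"
  unfolding comp_space_def comp_map_def by (intro rep_arrow_linear base_ob_in) auto

text \<open>Arrows with value 1 are not closed under composition. The composite has value \<theta>
  at 1, and the condition on the centre turns this value into a scalar.\<close>

lemma comp_map_comp:
  assumes "g \<in> carrier G" "x \<in> carrier G" "y \<in> carrier G" and v: "v \<in> carrier (comp_space (conj (x \<cdot> y) g))"
  shows "comp_map g x (comp_map (conj x g) y v) = \<theta> g x y \<odot>\<^bsub>comp_space g\<^esub> comp_map g (x \<cdot> y) v"
proof -
  have cj: "conj y (conj x g) = conj (x \<cdot> y) g" by (rule conj_conj[OF assms(2,3,1)])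
  have "comp_map g x (comp_map (conj x g) y v) =
      rep_arrow (base_ob (conj (x \<cdot> y) g)) (base_ob g) (x \<cdot> y) (\<one> \<otimes> \<one> \<otimes> \<theta> (fst (base_ob g)) x y) v"
    using assms v unfolding comp_map_def cj comp_space_def
    by (intro rep_arrow_comp base_ob_in) (simp_all add: cj)
  also have "\<dots> = \<theta> g x y \<odot>\<^bsub>comp_space g\<^esub> comp_map g (x \<cdot> y) v"
    using assms v unfolding comp_map_def comp_space_def
    by (subst rep_arrow_scalar) (simp_all add: base_ob_in)
  finally show ?thesis .
qed

lemma comp_map_one: "g \<in> carrier G \<Longrightarrow> v \<in> carrier (comp_space g) \<Longrightarrow> comp_map g e v = v"
  by (simp add: comp_map_def comp_space_def rep_arrow_id base_ob_in)

lemmas comp_tuple = comp_space_module comp_map_linear comp_map_comp comp_map_one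

abbreviation "tuples \<equiv> tuple_module comp_space comp_map"

lemma left_module_tuples: "left_module D tuples"
  by (rule left_module_tuple) (fact comp_tuple)+

definition single where "single g v = (\<lambda>h \<in> carrier G. if h = g then v else \<zero>\<^bsub>comp_space h\<^esub>)"

lemma single_closed: "g \<in> carrier G \<Longrightarrow> v \<in> carrier (comp_space g) \<Longrightarrow> single g v \<in> carrier tuples"
  using abelian_groupE(2)[OF left_module.axioms(2)[OF comp_space_module]]
  by (simp add: single_def tuple_module_simps)

lemma single_apply: "g \<in> carrier G \<Longrightarrow> single g v g = v"
  by (simp add: single_def)

lemma single_add:
  assumes "g \<in> carrier G" "v \<in> carrier (comp_space g)" "w \<in> carrier (comp_space g)"
  shows "single g (v \<oplus>\<^bsub>comp_space g\<^esub> w) = single g v \<oplus>\<^bsub>tuples\<^esub> single g w"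
  using abelian_groupE(2)[OF left_module.axioms(2)[OF comp_space_module]]
    abelian_groupE(5)[OF left_module.axioms(2)[OF comp_space_module]]
  by (auto simp: single_def tuple_module_simps fun_eq_iff restrict_def)

lemma act_tuples:
  assumes "g \<in> carrier G" "x \<in> carrier G" "c \<in> carrier K" "p \<in> carrier tuples"
  shows "act tuples g x c p = single g (c \<odot>\<^bsub>comp_space g\<^esub> comp_map g x (p (conj x g)))"
  unfolding single_def by (rule tuple_act[OF _ _ _ _ assms]) (fact comp_tuple)+

lemma act_tuples_unit:
  assumes "g \<in> carrier G" "p \<in> carrier tuples"
  shows "act tuples g e \<one> p = single g (p g)"
proof -
  have "p g \<in> carrier (comp_space g)" using assms by (auto simp: tuple_module_simps)
  then show ?thesis
    using assms left_module.smult_one[OF comp_space_module] by (simp add: act_tuples comp_map_one)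
qed

text \<open>The canonical identification of the value at \<open>X\<close> with the value at the base
  object over the same group element.\<close>

definition to_comp where "to_comp X = rep_arrow X (base_ob (fst X)) e \<one>"

lemma to_comp_linear: "X \<in> obs \<Longrightarrow> to_comp X \<in> linear_maps K (FOb F X) (comp_space (fst X))"
  unfolding to_comp_def comp_space_def by (intro rep_arrow_linear base_ob_in) (auto simp: obs_fst)

text \<open>The reverse map belongs to the arrow in the other direction, also over the unit with
  value 1. Both composites lie over the unit and have value \<theta>(e, e) = 1, so by uniqueness of
  arrows they are identities.\<close>

lemma to_comp_bij: 
  assumes X: "X \<in> obs"
  shows "bij_betw (to_comp X) (carrier (FOb F X)) (carrier (comp_space (fst X)))"
proof (rule bij_betwI[where g = "rep_arrow (base_ob (fst X)) X e \<one>"])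
  note g = obs_fst[OF X]
  show "to_comp X \<in> carrier (FOb F X) \<rightarrow> carrier (comp_space (fst X))"
    using linear_mapsD(1)[OF to_comp_linear[OF X]] by blast
  have "rep_arrow (base_ob (fst X)) X e \<one> \<in> linear_maps K (comp_space (fst X)) (FOb F X)"
    unfolding comp_space_def using g X by (intro rep_arrow_linear base_ob_in) auto
  from linear_mapsD(1)[OF this]
  show "rep_arrow (base_ob (fst X)) X e \<one> \<in> carrier (comp_space (fst X)) \<rightarrow> carrier (FOb F X)"
    by blast
  show "rep_arrow (base_ob (fst X)) X e \<one> (to_comp X v) = v" if "v \<in> carrier (FOb F X)" for v
    unfolding to_comp_def using that g X
    by (subst rep_arrow_comp) (simp_all add: base_ob_in theta_one rep_arrow_id)
  show "to_comp X (rep_arrow (base_ob (fst X)) X e \<one> v) = v" if "v \<in> carrier (comp_space (fst X))" for v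
    unfolding to_comp_def using that g X
    by (subst rep_arrow_comp) (simp_all add: base_ob_in theta_one rep_arrow_id comp_space_def)
qed

text \<open>Both sides come from arrows from \<open>X\<close> to the base object over
  \<open>fst Y\<close> with the group element of \<open>u\<close>: composing with arrows over the
  unit with value 1 changes nothing, and the value of \<open>u\<close> at 1 can be split off as a
  scalar.\<close>

lemma to_comp_natural:
  assumes XY: "X \<in> obs" "Y \<in> obs" and u: "u \<in> ars X Y" and v: "v \<in> carrier (FOb F X)"
  shows "to_comp Y (FAr F X Y u v) =
    snd u 1 \<odot>\<^bsub>comp_space (fst Y)\<^esub> comp_map (fst Y) (fst u) (to_comp X v)"
proof -
  define s a where "s = fst u" and "a = snd u 1"
  have g: "fst Y \<in> carrier G" "s \<in> carrier G" "a \<in> Units K" and X: "fst X = conj s (fst Y)"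
    using obs_fst[OF XY(2)] arsD[OF u XY] by (simp_all add: s_def a_def)
  have u': "FAr F X Y u = rep_arrow X Y s a"
    unfolding rep_arrow_def using arrow_eqI[OF XY u] by (simp add: s_def a_def)
  have "to_comp Y (rep_arrow X Y s a v) = rep_arrow X (base_ob (fst Y)) s a v"
    unfolding to_comp_def using g X XY v
    by (subst rep_arrow_comp) (simp_all add: base_ob_in theta_one Units_closed)
  moreover have "comp_map (fst Y) s (to_comp X v) = rep_arrow X (base_ob (fst Y)) s \<one> v"
    unfolding to_comp_def comp_map_def X[symmetric] using g XY v obs_fst[OF XY(1)]
    by (subst rep_arrow_comp) (simp_all add: base_ob_in theta_one X)
  ultimately show ?thesis
    unfolding u' using rep_arrow_scalar[OF XY(1) base_ob_in[OF g(1)] g(2) _ g(3) v] X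
    by (simp add: comp_space_def s_def a_def)
qed

text \<open>The isomorphism carries a vector at \<open>X\<close> to the base object and then to the
  encoded tuple that is concentrated at \<open>fst X\<close>. These tuples make up the fibre over
  \<open>fst X\<close>, and the module structure on the codes is transported from the
  tuples.\<close>

lemma representation_from_module:
  assumes "infinite (UNIV :: 'v set)"
  shows "\<exists>M. left_module D M \<and> isos InRep F (fibre_func M) \<noteq> {}"
proof -
  obtain enc :: "('g \<Rightarrow> 'v) \<Rightarrow> 'v" where "inj_on enc (carrier G \<rightarrow>\<^sub>E UNIV)"
    using inj_tuples_exists[OF assms finite_G] by blast
  then have enc: "inj_on enc (carrier tuples)"
    by (rule inj_on_subset) (auto simp: tuple_module_simps)
  define M where "M = transport_module enc tuples"
  have M: "left_module D M"
    unfolding M_def by (rule left_module_transport[OF left_module_tuples enc])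
  have carr: "carrier M = enc ` carrier tuples" by (simp add: M_def transport_module_simps)
  have act_M: "act M g x c (enc p) = enc (act tuples g x c p)" if "p \<in> carrier tuples" for g x c p
    unfolding act_def M_def by (rule transport_module_simps(4)[OF enc that])
  have add_M: "enc p \<oplus>\<^bsub>M\<^esub> enc q = enc (p \<oplus>\<^bsub>tuples\<^esub> q)" if "p \<in> carrier tuples" "q \<in> carrier tuples" for p q
    unfolding M_def by (rule transport_module_simps(3)[OF enc that])
  have fib: "enc (single g v) \<in> carrier (fibre M g)" if "g \<in> carrier G" "v \<in> carrier (comp_space g)" for g v
    using that single_closed[OF that]
    by (simp add: fibre_simps carr act_M act_tuples_unit single_apply)
  have to_in: "to_comp X v \<in> carrier (comp_space (fst X))" if "X \<in> obs" "v \<in> carrier (FOb F X)" for X v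
    using linear_mapsD(1)[OF to_comp_linear[OF that(1)] that(2)] .
  define \<tau> where "\<tau> = (\<lambda>X \<in> obs. \<lambda>v \<in> carrier (FOb F X). enc (single (fst X) (to_comp X v)))"
  have "\<tau> \<in> Hom InRep F (fibre_func M)"
  proof (rule nat_transI)
    show "\<tau> \<in> extensional obs" by (simp add: \<tau>_def)
    fix X assume X: "X \<in> obs"
    note g = obs_fst[OF X] and lin = to_comp_linear[OF X]
    interpret V: left_module K "FOb F X" using InRep_obD(1)[OF F X] .
    show "\<tau> X \<in> linear_maps K (FOb F X) (FOb (fibre_func M) X)"
    proof (rule linear_mapsI)
      fix v w assume vw: "v \<in> carrier (FOb F X)" "w \<in> carrier (FOb F X)"
      then show "\<tau> X (v \<oplus>\<^bsub>FOb F X\<^esub> w) = \<tau> X v \<oplus>\<^bsub>FOb (fibre_func M) X\<^esub> \<tau> X w"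
        using X g to_in[OF X]
        by (simp add: \<tau>_def fibre_func_def fibre_simps add_M single_closed linear_mapsD(2)[OF lin] single_add)
    next
      fix a v assume av: "a \<in> carrier K" "v \<in> carrier (FOb F X)"
      then show "\<tau> X (a \<odot>\<^bsub>FOb F X\<^esub> v) = a \<odot>\<^bsub>FOb (fibre_func M) X\<^esub> \<tau> X v"
        using X g to_in[OF X av(2)]
        by (simp add: \<tau>_def fibre_func_def fibre_simps act_M single_closed linear_mapsD(3)[OF lin]
            act_tuples comp_map_one single_apply V.smult_closed)
    qed (use X g in \<open>simp_all add: \<tau>_def fibre_func_def fib to_in\<close>)
  next
    fix X Y u v assume XY: "X \<in> obs" "Y \<in> obs" and u: "u \<in> ars X Y" and v: "v \<in> carrier (FOb F X)"
    have "FAr F X Y u v \<in> carrier (FOb F Y)"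
      using linear_mapsD(1)[OF InRep_obD(2)[OF F XY u] v] .
    \<comment> \<open>The action over \<open>fst Y\<close> reads a tuple at the conjugate of
      \<open>fst Y\<close> by the group element of \<open>u\<close>. This is \<open>fst X\<close>,
      where the tuple in question is concentrated.\<close>
    moreover have "single (fst X) (to_comp X v) (conj (fst u) (fst Y)) = to_comp X v"
      using obs_fst[OF XY(1)] by (simp add: single_apply flip: ars_source[OF u XY])
    ultimately show "\<tau> Y (FAr F X Y u v) = FAr (fibre_func M) X Y u (\<tau> X v)"
      using XY v obs_fst[OF XY(1)] obs_fst[OF XY(2)] ars_fst[OF u XY] ars_closed[OF u XY] to_in[OF XY(1) v]
      by (simp add: \<tau>_def fibre_func_def fib act_M single_closed act_tuples to_comp_natural[OF XY u v])
  qed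
  moreover have "bij_betw (\<tau> X) (carrier (FOb F X)) (carrier (FOb (fibre_func M) X))" if X: "X \<in> obs" for X
  proof -
    note g = obs_fst[OF X]
    have "bij_betw (\<lambda>v. enc (single (fst X) v)) (carrier (comp_space (fst X))) (carrier (fibre M (fst X)))"
    proof (rule bij_betw_imageI)
      show "inj_on (\<lambda>v. enc (single (fst X) v)) (carrier (comp_space (fst X)))"
      proof (rule inj_onI)
        fix v w assume "v \<in> carrier (comp_space (fst X))" "w \<in> carrier (comp_space (fst X))"
          and "enc (single (fst X) v) = enc (single (fst X) w)"
        then have "single (fst X) v = single (fst X) w"
          using single_closed[OF g] by (intro inj_onD[OF enc])
        then have "single (fst X) v (fst X) = single (fst X) w (fst X)" by (rule fun_cong)
        then show "v = w" by (simp add: single_apply[OF g])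
      qed
      \<comment> \<open>The idempotent at g replaces a tuple by its coordinate at g, extended by
        zero. A fixed point is therefore concentrated at g.\<close>
      have "m \<in> (\<lambda>v. enc (single (fst X) v)) ` carrier (comp_space (fst X))"
        if m: "m \<in> carrier (fibre M (fst X))" for m
      proof -
        obtain p where p: "m = enc p" "p \<in> carrier tuples" using m by (auto simp: fibre_simps carr)
        then have "m = enc (single (fst X) (p (fst X)))"
          using m by (simp add: fibre_simps act_M act_tuples_unit[OF g])
        moreover have "p (fst X) \<in> carrier (comp_space (fst X))" using p(2) g by (auto simp: tuple_module_simps)
        ultimately show ?thesis by blast
      qed
      then show "(\<lambda>v. enc (single (fst X) v)) ` carrier (comp_space (fst X)) = carrier (fibre M (fst X))"
        using fib[OF g] by blast
    qed
    from bij_betw_trans[OF to_comp_bij[OF X] this]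
    have "bij_betw (\<tau> X) (carrier (FOb F X)) (carrier (fibre M (fst X)))"
      by (rule bij_betw_cong[THEN iffD1, rotated]) (simp add: \<tau>_def X)
    then show ?thesis by (simp add: fibre_func_def)
  qed
  ultimately have "\<tau> \<in> isos InRep F (fibre_func M)"
    by (rule InRep_isosI[OF F _ _ fibre_func_in_InRep[OF M]])
  with M show ?thesis by blast
qed

end

lemma double_func_bij:
  fixes M N :: "('g \<times> 'g \<Rightarrow> 'k, 'v) module"
  assumes "left_module D M" "left_module D N"
  shows "bij_betw (FAr double_func M N) (linear_maps D M N) (Hom InRep (fibre_func M) (fibre_func N))"
proof (rule bij_betw_imageI)
  show "inj_on (FAr double_func M N) (linear_maps D M N)"
    using double_func_inj[OF assms] by (rule inj_onI)
  show "FAr double_func M N ` linear_maps D M N = Hom InRep (fibre_func M) (fibre_func N)"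
    using double_func_arrow[OF assms(1)] double_func_surj[OF assms] by blast
qed

end

theorem corollary4p16:
  fixes G :: "('g, 'x) monoid_scheme"
    and K :: "('k, 'y) ring_scheme"
    and \<alpha> :: "'g \<Rightarrow> 'g \<Rightarrow> 'g \<Rightarrow> 'k"
  assumes "field K"
    and "group G"
    and "finite (carrier G)"
    and "normalised_3cocycle G K \<alpha>"
    and "infinite (UNIV :: 'v set)"
  shows "equivalent_categories
      (inertia_representations G K \<alpha> ::
        ((('g, 'k) inertia_ob, ('g, 'k) inertia_ar, ('k, 'v) module, 'v \<Rightarrow> 'v) func,
         ('g, 'k) inertia_ob \<Rightarrow> 'v \<Rightarrow> 'v) cat)
      (module_category (twisted_double G K \<alpha>) ::
        (('g \<times> 'g \<Rightarrow> 'k, 'v) module, 'v \<Rightarrow> 'v) cat)"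
proof -
  interpret twisted_group K G \<alpha>
    using assms(1-4) by (intro twisted_group.intro twisted_group_axioms.intro)
  show ?thesis
  \<comment> \<open>The functor runs from modules to representations, while the rule states the
    equivalence in the opposite order, from its target to its source.\<close>
  proof (rule is_functor.equivalent_categories_if_fully_faithful[OF is_functor_double_func])
    fix M N :: "('g \<times> 'g \<Rightarrow> 'k, 'v) module"
    assume "M \<in> Ob (module_category D)" "N \<in> Ob (module_category D)"
    then show "bij_betw (FAr double_func M N) (Hom (module_category D) M N)
        (Hom InRep (FOb double_func M) (FOb double_func N))"
      using double_func_bij[of M N] by (simp add: module_category_def double_func_def)
  next
    fix F :: "(('g, 'k) inertia_ob, ('g, 'k) inertia_ar, ('k, 'v) module, 'v \<Rightarrow> 'v) func"
    assume "F \<in> Ob InRep"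
    from representation_from_module[OF this assms(5)]
    show "\<exists>M \<in> Ob (module_category D). isos InRep F (FOb double_func M) \<noteq> {}"
      by (auto simp: module_category_def double_func_def)
  qed
qed

end
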